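(* For $a,b,c>0$ let $h_{a,b,c}$ be the left-invariant metric on $\mathrm{SU}(2)$ given by $h_{a,b,c}=\frac1a\sigma_1^2+\frac1b\sigma_2^2+\frac1c\sigma_3^2$, and let $d\mu$ be the common normalized volume element of the metrics $h_{a,b,c}$. Suppose that $a<b<c$. Then the embedding $\varphi\colon\mathrm{SU}(2)\to\mathbb{R}^7$, $$A(\zeta_1,\zeta_2)\mapsto\Bigl(\sqrt{1/c}\,\zeta_1,\ \sqrt{1/c}\,\zeta_2,\ \sqrt{(1/b)-(1/c)}\,\zeta_1\overline{\zeta_2},\ \tfrac{\sqrt{(1/b)-(1/c)}}{2}\,(\zeta_1\overline{\zeta_1}-\zeta_2\overline{\zeta_2})\Bigr),$$ is a short map (that is, $\varphi^*h_{\mathbb{R}^7}\le h_{a,b,c}$) by first eigenfunctions of $-\Delta_{(d\mu,h_{0,1/3,1}^* )}$ and satisfies $(h_{0,1/3,1}^*,\,h_{a,b,c}-\varphi^*h_{\mathbb{R}^7})\equiv0$. Therefore, $\varphi$ is an inflated map with respect to $(d\mu,h_{a,b,c})$, and the positive semidefinite metric $h_{0,1/3,1}^*$ gives a solution to the first-eigenvalue maximization problem associated with $(d\mu,h_{a,b,c})$.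
   Context: $\mathrm{SU}(2)$ is the set of matrices $A(\zeta_1,\zeta_2)=\begin{pmatrix}\zeta_1&-\overline{\zeta_2}\\ \zeta_2&\overline{\zeta_1}\end{pmatrix}$ with $|\zeta_1|^2+|\zeta_2|^2=1$. The real left-invariant one-forms $\sigma_1,\sigma_2,\sigma_3$ are given by $\sigma_1+i\sigma_2=i(\zeta_2\,d\zeta_1-\zeta_1\,d\zeta_2)$, $\sigma_3=-i(\overline{\zeta_1}\,d\zeta_1+\overline{\zeta_2}\,d\zeta_2)$, and $E_1,E_2,E_3$ are the dual left-invariant vector fields, $\sigma_a(E_b)=\delta_{ab}$. The common normalized volume element is the unique left-invariant volume element of total volume $1$. For $u,v,w\ge0$, $h_{u,v,w}^*=u\,E_1\otimes E_1+v\,E_2\otimes E_2+w\,E_3\otimes E_3$, so $h_{0,1/3,1}^*=\frac13E_2\otimes E_2+E_3\otimes E_3$. Here $\mathbb{R}^7=\mathbb{C}^3\times\mathbb{R}$ with Euclidean metric $h_{\mathbb{R}^7}$. On a compact manifold $M$ (connected, without boundary) with smooth volume element $d\mu$ and Riemannian metric $h$, put $d\mu_1=d\mu/\int_M d\mu$. $\mathcal{M}^*$ is the set of all smooth sections $g^*$ of $S^2TM$ that are positive semidefinite on $T^*M$ at every point; $(g^*,k)=g^{ij}k_{ij}$. The Bakry-Émery Laplacian $\Delta_{(d\mu,g^* )}$ is determined by $\int_M(\Delta_{(d\mu,g^* )}u)\,v\,d\mu=-\int_M g^*(du,dv)\,d\mu$ for all $u,v\in C^\infty(M)$. $\lambda_1(d\mu,g^*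 )=\inf\int_M g^*(du,du)\,d\mu\big/\int_M u^2\,d\mu$, the infimum over nonzero $C^1$-functions $u$ with $\int_M u\,d\mu=0$. First eigenfunctions of $-\Delta_{(d\mu,g^* )}$ are solutions $u$ of $-\Delta_{(d\mu,g^* )}u=\lambda_1(d\mu,g^* )u$; a map is "by first eigenfunctions" if every real component is such a function. The first-eigenvalue maximization problem associated with $(d\mu,h)$: over all nonzero $g^*\in\mathcal{M}^*$, maximize $\lambda_1(d\mu,g^* )\big/\int_M(g^*,h)\,d\mu_1$; a solution is a $g^*$ attaining the maximum. Let $l^2$ be the Hilbert space of square-summable real sequences with standard metric $h_{l^2}$ and norm $\|\cdot\|$. An inflated map with respect to $(d\mu,h)$ is a $C^\infty$-map $\varphi\colon M\to l^2$ that maximizes $\int_M\|\varphi\|^2\,d\mu_1$ among all $C^\infty$-maps $M\to l^2$ satisfying $\varphi^*h_{l^2}\le h$ and $\int_M\varphi\,d\mu_1=0$. Maps into $\mathbb{R}^N$ are regarded as maps into $l^2$ via a standard linear isometric inclusion. *)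

theory Defs
  imports "HOL-Analysis.Analysis"
begin

section \<open>The Hilbert space of square-summable real sequences\<close>

typedef l2 = "{x :: nat \<Rightarrow> real. summable (\<lambda>n. (x n)\<^sup>2)}"
  morphisms l2_nth Abs_l2
  by (rule exI[of _ "\<lambda>_. 0"]) simp

setup_lifting type_definition_l2

lemma l2_eqI: "(\<And>n. l2_nth x n = l2_nth y n) \<Longrightarrow> x = y"
  by transfer auto

lemma summable_l2_nth: "summable (\<lambda>n. (l2_nth x n)\<^sup>2)"
  using l2_nth[of x] by simp

lemma summable_mult_of_squares:
  fixes x y :: "nat \<Rightarrow> real"
  assumes "summable (\<lambda>n. (x n)\<^sup>2)" "summable (\<lambda>n. (y n)\<^sup>2)"
  shows "summable (\<lambda>n. x n * y n)"
proof (rule summable_comparison_test')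
  show "summable (\<lambda>n. (x n)\<^sup>2 + (y n)\<^sup>2)"
    using assms by (rule summable_add)
  show "norm (x n * y n) \<le> (x n)\<^sup>2 + (y n)\<^sup>2" for n
  proof -
    have "2 * (\<bar>x n\<bar> * \<bar>y n\<bar>) \<le> \<bar>x n\<bar>\<^sup>2 + \<bar>y n\<bar>\<^sup>2"
      using sum_squares_bound[of "\<bar>x n\<bar>" "\<bar>y n\<bar>"] by simp
    moreover have "0 \<le> \<bar>x n\<bar> * \<bar>y n\<bar>" by simp
    ultimately show ?thesis
      by (simp only: real_norm_def abs_mult power2_abs)
  qed
qed

lemma summable_square_add:
  fixes x y :: "nat \<Rightarrow> real"
  assumes "summable (\<lambda>n. (x n)\<^sup>2)" "summable (\<lambda>n. (y n)\<^sup>2)"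
  shows "summable (\<lambda>n. (x n + y n)\<^sup>2)"
proof -
  have "summable (\<lambda>n. (x n)\<^sup>2 + (y n)\<^sup>2 + 2 * (x n * y n))"
    by (intro summable_add summable_mult summable_mult_of_squares assms)
  then show ?thesis by (simp add: power2_sum mult.assoc)
qed

instantiation l2 :: real_inner
begin

lift_definition zero_l2 :: l2 is "\<lambda>_. 0" by simp

lift_definition plus_l2 :: "l2 \<Rightarrow> l2 \<Rightarrow> l2" is "\<lambda>x y n. x n + y n"
  by (rule summable_square_add)

lift_definition uminus_l2 :: "l2 \<Rightarrow> l2" is "\<lambda>x n. - x n" by simp

lift_definition minus_l2 :: "l2 \<Rightarrow> l2 \<Rightarrow> l2" is "\<lambda>x y n. x n - y n"
  subgoal for x y using summable_square_add[of x "\<lambda>n. - y n"] by simp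
  done

lift_definition scaleR_l2 :: "real \<Rightarrow> l2 \<Rightarrow> l2" is "\<lambda>c x n. c * x n"
  by (simp add: power_mult_distrib summable_mult)

lift_definition inner_l2 :: "l2 \<Rightarrow> l2 \<Rightarrow> real" is "\<lambda>x y. \<Sum>n. x n * y n" .

definition norm_l2 :: "l2 \<Rightarrow> real" where "norm_l2 x = sqrt (inner x x)"

definition dist_l2 :: "l2 \<Rightarrow> l2 \<Rightarrow> real" where "dist_l2 x y = norm (x - y)"

definition sgn_l2 :: "l2 \<Rightarrow> l2" where "sgn_l2 x = inverse (norm x) *\<^sub>R x"

definition uniformity_l2 :: "(l2 \<times> l2) filter"
  where "uniformity_l2 = (INF e\<in>{0 <..}. principal {(x, y). dist x y < e})"

definition open_l2 :: "l2 set \<Rightarrow> bool"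
  where "open_l2 S = (\<forall>x\<in>S. \<forall>\<^sub>F (x', y) in uniformity. x' = x \<longrightarrow> y \<in> S)"

instance
proof
  fix x y z :: l2 and a b c :: real
  show "x + y + z = x + (y + z)" "x + y = y + x" "0 + x = x" "- x + x = 0" "x - y = x + - y"
       "a *\<^sub>R (x + y) = a *\<^sub>R x + a *\<^sub>R y" "(a + b) *\<^sub>R x = a *\<^sub>R x + b *\<^sub>R x"
       "a *\<^sub>R b *\<^sub>R x = (a * b) *\<^sub>R x" "1 *\<^sub>R x = x"
    by (transfer; simp add: algebra_simps)+
  show "inner x y = inner y x" by transfer (simp add: mult.commute)
  show "inner (x + y) z = inner x z + inner y z"
    by transfer (simp add: distrib_right suminf_add summable_mult_of_squares)
  show "inner (a *\<^sub>R x) y = a * inner x y"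
    by transfer (simp add: mult.assoc suminf_mult summable_mult_of_squares)
  show "0 \<le> inner x x"
    by transfer (auto intro!: suminf_nonneg summable_mult_of_squares)
  show "inner x x = 0 \<longleftrightarrow> x = 0"
  proof transfer
    fix x :: "nat \<Rightarrow> real" assume "summable (\<lambda>n. (x n)\<^sup>2)"
    then have "summable (\<lambda>n. x n * x n)" by (simp add: power2_eq_square)
    then show "(\<Sum>n. x n * x n) = 0 \<longleftrightarrow> x = (\<lambda>_. 0)"
      by (auto simp: suminf_eq_zero_iff fun_eq_iff)
  qed
  show "norm x = sqrt (inner x x)" by (rule norm_l2_def)
  show "sgn x = inverse (norm x) *\<^sub>R x" by (rule sgn_l2_def)
  show "dist x y = norm (x - y)" by (rule dist_l2_def)
qed (rule uniformity_l2_def open_l2_def)+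

end

lemma l2_nth_simps [simp]:
  "l2_nth 0 n = 0" "l2_nth (x + y) n = l2_nth x n + l2_nth y n" "l2_nth (- x) n = - l2_nth x n"
  "l2_nth (x - y) n = l2_nth x n - l2_nth y n" "l2_nth (c *\<^sub>R x) n = c * l2_nth x n"
  by (transfer; simp)+

lemma inner_l2: "inner x y = (\<Sum>n. l2_nth x n * l2_nth y n)"
  by transfer simp

lemma norm_l2_square: "(norm x)\<^sup>2 = (\<Sum>n. (l2_nth x n)\<^sup>2)" for x :: l2
  unfolding power2_norm_eq_inner inner_l2 by (simp add: power2_eq_square)

lemma sum_square_le_norm_l2: "finite I \<Longrightarrow> (\<Sum>n\<in>I. (l2_nth x n)\<^sup>2) \<le> (norm x)\<^sup>2"
  unfolding norm_l2_square by (rule sum_le_suminf[OF summable_l2_nth]) auto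

lemma abs_l2_nth_le_norm: "\<bar>l2_nth x n\<bar> \<le> norm x"
proof (rule power2_le_imp_le)
  show "\<bar>l2_nth x n\<bar>\<^sup>2 \<le> (norm x)\<^sup>2"
    using sum_square_le_norm_l2[of "{n}" x] by simp
qed simp

instance l2 :: banach
proof
  fix X :: "nat \<Rightarrow> l2" assume X: "Cauchy X"
  have "Cauchy (\<lambda>m. l2_nth (X m) k)" for k
    unfolding Cauchy_altdef2
  proof (intro allI impI)
    fix e :: real assume "e > 0"
    then obtain N where N: "\<forall>n\<ge>N. dist (X n) (X N) < e"
      using X unfolding Cauchy_altdef2 by blast
    have "dist (l2_nth (X n) k) (l2_nth (X N) k) < e" if "n \<ge> N" for n
    proof -
      have "dist (l2_nth (X n) k) (l2_nth (X N) k) = \<bar>l2_nth (X n - X N) k\<bar>"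
        by (simp add: dist_real_def)
      also have "\<dots> \<le> norm (X n - X N)" by (rule abs_l2_nth_le_norm)
      also have "\<dots> < e" using N that by (simp add: dist_norm)
      finally show ?thesis .
    qed
    then show "\<exists>N. \<forall>n\<ge>N. dist (l2_nth (X n) k) (l2_nth (X N) k) < e" by blast
  qed
  then have "\<forall>k. \<exists>l. (\<lambda>m. l2_nth (X m) k) \<longlonglongrightarrow> l"
    unfolding Cauchy_convergent_iff convergent_def by blast
  then obtain L where L: "\<And>k. (\<lambda>m. l2_nth (X m) k) \<longlonglongrightarrow> L k"
    unfolding choice_iff by blast
  have tail: "\<exists>N. \<forall>m\<ge>N. summable (\<lambda>k. (l2_nth (X m) k - L k)\<^sup>2) \<and>
      (\<Sum>k. (l2_nth (X m) k - L k)\<^sup>2) \<le> e\<^sup>2" if e: "e > 0" for e :: real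
  proof -
    obtain N where N: "\<And>m n. m \<ge> N \<Longrightarrow> n \<ge> N \<Longrightarrow> dist (X m) (X n) < e"
      using X e unfolding Cauchy_def by blast
    have fin: "(\<Sum>k<K. (l2_nth (X m) k - L k)\<^sup>2) \<le> e\<^sup>2" if m: "m \<ge> N" for m K
    proof (rule tendsto_upperbound)
      show "(\<lambda>n. \<Sum>k<K. (l2_nth (X m) k - l2_nth (X n) k)\<^sup>2)
          \<longlonglongrightarrow> (\<Sum>k<K. (l2_nth (X m) k - L k)\<^sup>2)"
        by (intro tendsto_intros L)
      show "\<forall>\<^sub>F n in sequentially. (\<Sum>k<K. (l2_nth (X m) k - l2_nth (X n) k)\<^sup>2) \<le> e\<^sup>2"
      proof (rule eventually_sequentiallyI)
        fix n assume "N \<le> n"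
        then have "(norm (X m - X n))\<^sup>2 \<le> e\<^sup>2"
          using N[OF m] by (intro power_mono) (auto simp: dist_norm less_imp_le)
        with sum_square_le_norm_l2[of "{..<K}" "X m - X n"]
        show "(\<Sum>k<K. (l2_nth (X m) k - l2_nth (X n) k)\<^sup>2) \<le> e\<^sup>2" by simp
      qed
    qed simp
    have sm: "summable (\<lambda>k. (l2_nth (X m) k - L k)\<^sup>2)" if "m \<ge> N" for m
    proof (rule bounded_imp_summable)
      show "(\<Sum>k\<le>K. (l2_nth (X m) k - L k)\<^sup>2) \<le> e\<^sup>2" for K
        unfolding lessThan_Suc_atMost[symmetric] by (rule fin[OF that])
    qed simp
    show ?thesis
    proof (intro exI allI impI conjI)
      fix m assume m: "m \<ge> N"
      show "summable (\<lambda>k. (l2_nth (X m) k - L k)\<^sup>2)" by (rule sm[OF m])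
      show "(\<Sum>k. (l2_nth (X m) k - L k)\<^sup>2) \<le> e\<^sup>2"
        by (rule suminf_le_const[OF sm[OF m] fin[OF m]])
    qed
  qed
  obtain N where "\<forall>m\<ge>N. summable (\<lambda>k. (l2_nth (X m) k - L k)\<^sup>2)"
    using tail[of 1] by auto
  then have "summable (\<lambda>k. (L k - l2_nth (X N) k)\<^sup>2)"
    by (simp add: power2_commute)
  from summable_square_add[OF this summable_l2_nth[of "X N"]]
  have sL: "summable (\<lambda>k. (L k)\<^sup>2)" by simp
  define l where "l = Abs_l2 L"
  have l: "l2_nth l = L" unfolding l_def by (rule Abs_l2_inverse) (simp add: sL)
  have "X \<longlonglongrightarrow> l"
  proof (rule metric_LIMSEQ_I)
    fix e :: real assume e: "e > 0"
    then obtain N where N: "\<forall>m\<ge>N. (\<Sum>k. (l2_nth (X m) k - L k)\<^sup>2) \<le> (e/2)\<^sup>2"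
      using tail[of "e/2"] by auto
    have "dist (X m) l < e" if "m \<ge> N" for m
    proof -
      have "(dist (X m) l)\<^sup>2 \<le> (e/2)\<^sup>2"
        using N that by (simp add: dist_norm norm_l2_square l)
      then have "dist (X m) l \<le> e/2" by (rule power2_le_imp_le) (use e in simp)
      with e show ?thesis by linarith
    qed
    then show "\<exists>N. \<forall>m\<ge>N. dist (X m) l < e" by blast
  qed
  then show "convergent X" unfolding convergent_def by blast
qed

lemma l2_dense_rational:
  assumes e: "e > 0"
  shows "\<exists>q::rat list. dist (x::l2) (Abs_l2 (\<lambda>n. if n < length q then of_rat (q ! n) else 0)) < e"
proof -
  define e' where "e' = e\<^sup>2 / 2"
  have e': "e' > 0" using e by (simp add: e'_def)
  obtain N where N: "norm (\<Sum>i. (l2_nth x (i + N))\<^sup>2) < e'"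
    using suminf_exist_split[OF e' summable_l2_nth[of x]] by blast
  define d where "d = sqrt (e' / (real N + 1))"
  have d: "d > 0" "d\<^sup>2 = e' / (real N + 1)"
    using e' by (auto simp: d_def)
  have "\<exists>r. \<bar>l2_nth x k - of_rat r\<bar> < d" for k
  proof -
    obtain r where "l2_nth x k - d < of_rat r" "of_rat r < l2_nth x k + d"
      using of_rat_dense[of "l2_nth x k - d" "l2_nth x k + d"] d by auto
    then show ?thesis by (intro exI[of _ r]) auto
  qed
  then obtain r where r: "\<And>k. \<bar>l2_nth x k - of_rat (r k)\<bar> < d" by metis
  define q where "q = map r [0..<N]"
  define y where "y = (\<lambda>n. if n < length q then of_rat (q ! n) else (0::real))"
  have y: "y n = (if n < N then of_rat (r n) else 0)" for n by (auto simp: y_def q_def)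
  have sy: "summable (\<lambda>n. (y n)\<^sup>2)"
    by (rule summable_finite[of "{..<N}"]) (auto simp: y)
  have nth: "l2_nth (Abs_l2 y) = y" by (rule Abs_l2_inverse) (simp add: sy)
  have "(dist x (Abs_l2 y))\<^sup>2 = (\<Sum>n. (l2_nth x n - y n)\<^sup>2)"
    by (simp add: dist_norm norm_l2_square nth)
  also have "\<dots> = (\<Sum>n. (l2_nth x (n + N) - y (n + N))\<^sup>2) + (\<Sum>n<N. (l2_nth x n - y n)\<^sup>2)"
    by (rule suminf_split_initial_segment) (use summable_l2_nth[of "x - Abs_l2 y"] in \<open>simp add: nth\<close>)
  also have "(\<Sum>n. (l2_nth x (n + N) - y (n + N))\<^sup>2) < e'"
    using N by (simp add: y)
  also have "(\<Sum>n<N. (l2_nth x n - y n)\<^sup>2) \<le> (\<Sum>n<N. d\<^sup>2)"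
  proof (rule sum_mono)
    fix n assume "n \<in> {..<N}"
    then have "\<bar>l2_nth x n - y n\<bar> \<le> d" using r[of n] by (simp add: y less_imp_le)
    then show "(l2_nth x n - y n)\<^sup>2 \<le> d\<^sup>2" using abs_le_square_iff d by fastforce
  qed
  also have "(\<Sum>n<N. d\<^sup>2) \<le> e'"
    using e' by (simp add: d field_simps)
  finally have "(dist x (Abs_l2 y))\<^sup>2 < e\<^sup>2" by (simp add: e'_def)
  then have "dist x (Abs_l2 y) < e" by (rule power_less_imp_less_base) (use e in simp)
  then show ?thesis unfolding y_def by blast
qed

instance l2 :: second_countable_topology
proof
  define D where "D = range (\<lambda>q::rat list. Abs_l2 (\<lambda>n. if n < length q then of_rat (q ! n) else 0))"
  define B where "B = (\<lambda>(d, n). ball d (1 / real (Suc n))) ` (D \<times> UNIV)"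
  have "countable B" unfolding B_def D_def by auto
  moreover have "topological_basis B"
  proof (rule topological_basisI)
    show "open S" if "S \<in> B" for S using that by (auto simp: B_def)
    fix S and x :: l2 assume "open S" "x \<in> S"
    then obtain e where e: "e > 0" "ball x e \<subseteq> S" using open_contains_ball by blast
    then obtain n where n: "1 / real (Suc n) < e / 2"
      using nat_approx_posE[of "e/2"] by auto
    obtain d where d: "d \<in> D" "dist x d < 1 / real (Suc n)"
      using l2_dense_rational[of "1 / real (Suc n)" x] by (auto simp: D_def)
    have "ball d (1 / real (Suc n)) \<subseteq> ball x e"
    proof
      fix z assume "z \<in> ball d (1 / real (Suc n))"
      then have "dist d z < 1 / real (Suc n)" by simp
      with d n dist_triangle[of x z d] show "z \<in> ball x e" by simp
    qed
    moreover have "x \<in> ball d (1 / real (Suc n))" using d by (simp add: dist_commute)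
    moreover have "ball d (1 / real (Suc n)) \<in> B" using d by (auto simp: B_def)
    ultimately show "\<exists>S'\<in>B. x \<in> S' \<and> S' \<subseteq> S" using e by blast
  qed
  ultimately show "\<exists>B::l2 set set. countable B \<and> open = generate_topology B"
    using topological_basis_imp_subbasis by blast
qed


section \<open>Analysis on submanifolds of Euclidean space\<close>

text \<open>
  A compact manifold is represented by a compact, connected, smooth embedded submanifold
  \<open>M\<close> of a Euclidean space, and its tangent spaces by subspaces of the ambient space.
  Fields on \<open>M\<close> are total functions whose values off \<open>M\<close>, and off the tangent spaces,
  are irrelevant.
\<close>

fun n_times_continuously_differentiable_on ::
  "nat \<Rightarrow> 'a::euclidean_space set \<Rightarrow> ('a \<Rightarrow> 'b::real_normed_vector) \<Rightarrow> bool" where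
  "n_times_continuously_differentiable_on 0 U F \<longleftrightarrow> continuous_on U F"
| "n_times_continuously_differentiable_on (Suc n) U F \<longleftrightarrow>
     (\<forall>x\<in>U. F differentiable (at x)) \<and>
     (\<forall>v. n_times_continuously_differentiable_on n U (\<lambda>x. frechet_derivative F (at x) v))"

definition C_map ::
  "enat \<Rightarrow> 'a::euclidean_space set \<Rightarrow> ('a \<Rightarrow> 'b::real_normed_vector) \<Rightarrow> bool" where
  "C_map k M f \<longleftrightarrow>
     (\<forall>p\<in>M. \<exists>U F. open U \<and> p \<in> U \<and> (\<forall>x\<in>M \<inter> U. F x = f x) \<and>
        (\<forall>n. enat n \<le> k \<longrightarrow> n_times_continuously_differentiable_on n U F))"

definition tangent_space :: "'a::euclidean_space set \<Rightarrow> 'a \<Rightarrow> 'a set" where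
  "tangent_space M x =
     {v. \<exists>\<gamma>. (\<forall>t. \<gamma> t \<in> M) \<and> \<gamma> 0 = x \<and> (\<gamma> has_vector_derivative v) (at (0::real))}"

text \<open>Covectors at \<open>x\<close> are identified when they agree on the tangent space at \<open>x\<close>.\<close>

definition cotangent_space :: "'a::euclidean_space set \<Rightarrow> 'a \<Rightarrow> ('a \<Rightarrow> real) set" where
  "cotangent_space M x = {\<alpha>. \<exists>L. linear L \<and> (\<forall>v\<in>tangent_space M x. \<alpha> v = L v)}"

definition differential ::
  "'a::euclidean_space set \<Rightarrow> ('a \<Rightarrow> 'b::real_normed_vector) \<Rightarrow> 'a \<Rightarrow> 'a \<Rightarrow> 'b" where
  "differential M f x v =
     (THE w. \<forall>\<gamma>. (\<forall>t. \<gamma> t \<in> M) \<and> \<gamma> 0 = x \<and> (\<gamma> has_vector_derivative v) (at (0::real)) \<longrightarrow>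
        ((\<lambda>t. f (\<gamma> t)) has_vector_derivative w) (at 0))"

definition smooth_embedding ::
  "'a::euclidean_space set \<Rightarrow> ('a \<Rightarrow> 'b::real_normed_vector) \<Rightarrow> bool" where
  "smooth_embedding M f \<longleftrightarrow>
     C_map \<infinity> M f \<and> (\<forall>x\<in>M. inj_on (differential M f x) (tangent_space M x)) \<and>
     (\<exists>g. homeomorphism M (f ` M) f g)"

definition pullback_metric ::
  "'a::euclidean_space set \<Rightarrow> ('a \<Rightarrow> 'b::real_inner) \<Rightarrow> 'a \<Rightarrow> 'a \<Rightarrow> 'a \<Rightarrow> real" where
  "pullback_metric M f x v w = inner (differential M f x v) (differential M f x w)"

definition short_map ::
  "'a::euclidean_space set \<Rightarrow> ('a \<Rightarrow> 'a \<Rightarrow> 'a \<Rightarrow> real) \<Rightarrow> ('a \<Rightarrow> 'b::real_inner) \<Rightarrow> bool" where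
  "short_map M h f \<longleftrightarrow>
     (\<forall>x\<in>M. \<forall>v\<in>tangent_space M x. pullback_metric M f x v v \<le> h x v v)"

text \<open>
  An element of \<open>S\<^sup>2TM\<close> at \<open>x\<close> is a symmetric bilinear form on the cotangent space at \<open>x\<close>.
  Smoothness of a section is smoothness of its components in the coordinates of the ambient space.
\<close>

definition S2T_sections ::
  "'a::euclidean_space set \<Rightarrow> ('a \<Rightarrow> ('a \<Rightarrow> real) \<Rightarrow> ('a \<Rightarrow> real) \<Rightarrow> real) set" where
  "S2T_sections M =
     {g. (\<forall>x\<in>M. \<forall>\<alpha>\<in>cotangent_space M x. \<forall>\<beta>\<in>cotangent_space M x.
            g x \<alpha> \<beta> = g x \<beta> \<alpha> \<and>
            (\<forall>\<gamma>\<in>cotangent_space M x. \<forall>c.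
               g x (\<lambda>v. \<alpha> v + c * \<gamma> v) \<beta> = g x \<alpha> \<beta> + c * g x \<gamma> \<beta>) \<and>
            (\<forall>\<gamma>. (\<forall>v\<in>tangent_space M x. \<gamma> v = \<alpha> v) \<longrightarrow> g x \<gamma> \<beta> = g x \<alpha> \<beta>)) \<and>
         (\<forall>i\<in>Basis. \<forall>j\<in>Basis. C_map \<infinity> M (\<lambda>x. g x (\<lambda>v. inner v i) (\<lambda>v. inner v j)))}"

definition M_star ::
  "'a::euclidean_space set \<Rightarrow> ('a \<Rightarrow> ('a \<Rightarrow> real) \<Rightarrow> ('a \<Rightarrow> real) \<Rightarrow> real) set" where
  "M_star M = {g \<in> S2T_sections M. \<forall>x\<in>M. \<forall>\<alpha>\<in>cotangent_space M x. 0 \<le> g x \<alpha> \<alpha>}"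

definition nonzero_section ::
  "'a::euclidean_space set \<Rightarrow> ('a \<Rightarrow> ('a \<Rightarrow> real) \<Rightarrow> ('a \<Rightarrow> real) \<Rightarrow> real) \<Rightarrow> bool" where
  "nonzero_section M g \<longleftrightarrow>
     (\<exists>x\<in>M. \<exists>\<alpha>\<in>cotangent_space M x. \<exists>\<beta>\<in>cotangent_space M x. g x \<alpha> \<beta> \<noteq> 0)"

text \<open>
  The contraction \<open>g\<^sup>i\<^sup>j k\<^sub>i\<^sub>j\<close>; \<open>\<lambda>v. representation B v e\<close> is the element dual to \<open>e\<close> of the dual
  basis of \<open>B\<close>, and the value does not depend on the choice of \<open>B\<close>.
\<close>

definition contraction ::
  "'a::euclidean_space set \<Rightarrow> ('a \<Rightarrow> ('a \<Rightarrow> real) \<Rightarrow> ('a \<Rightarrow> real) \<Rightarrow> real) \<Rightarrow>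
   ('a \<Rightarrow> 'a \<Rightarrow> 'a \<Rightarrow> real) \<Rightarrow> 'a \<Rightarrow> real" where
  "contraction M g k x =
     (let B = (SOME B. independent B \<and> span B = tangent_space M x)
      in \<Sum>e\<in>B. \<Sum>f\<in>B. g x (\<lambda>v. representation B v e) (\<lambda>v. representation B v f) * k x e f)"


section \<open>Eigenvalue maximization and inflated maps\<close>

text \<open>
  Volume elements enter only through the measures \<open>\<mu>\<close> on \<open>M\<close> that they induce;
  \<open>average \<mu>\<close> is integration against \<open>d\<mu>\<^sub>1 = d\<mu> / \<integral>d\<mu>\<close>.
\<close>

definition average :: "'a measure \<Rightarrow> ('a \<Rightarrow> 'b::{banach, second_countable_topology}) \<Rightarrow> 'b" where
  "average \<mu> f = (\<integral>x. f x \<partial>\<mu>) /\<^sub>R measure \<mu> (space \<mu>)"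

definition BE_laplacian ::
  "'a::euclidean_space set \<Rightarrow> 'a measure \<Rightarrow> ('a \<Rightarrow> ('a \<Rightarrow> real) \<Rightarrow> ('a \<Rightarrow> real) \<Rightarrow> real) \<Rightarrow>
   ('a \<Rightarrow> real) \<Rightarrow> ('a \<Rightarrow> real)" where
  "BE_laplacian M \<mu> g u =
     (THE w. w \<in> extensional M \<and> C_map \<infinity> M w \<and>
        (\<forall>v. C_map \<infinity> M v \<longrightarrow>
           (\<integral>x. w x * v x \<partial>\<mu>) = - (\<integral>x. g x (differential M u x) (differential M v x) \<partial>\<mu>)))"

definition lambda1 ::
  "'a::euclidean_space set \<Rightarrow> 'a measure \<Rightarrow> ('a \<Rightarrow> ('a \<Rightarrow> real) \<Rightarrow> ('a \<Rightarrow> real) \<Rightarrow> real) \<Rightarrow> real" where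
  "lambda1 M \<mu> g =
     Inf {(\<integral>x. g x (differential M u x) (differential M u x) \<partial>\<mu>) / (\<integral>x. (u x)\<^sup>2 \<partial>\<mu>) | u.
            C_map 1 M u \<and> (\<exists>x\<in>M. u x \<noteq> 0) \<and> (\<integral>x. u x \<partial>\<mu>) = 0}"

definition first_eigenfunction ::
  "'a::euclidean_space set \<Rightarrow> 'a measure \<Rightarrow> ('a \<Rightarrow> ('a \<Rightarrow> real) \<Rightarrow> ('a \<Rightarrow> real) \<Rightarrow> real) \<Rightarrow>
   ('a \<Rightarrow> real) \<Rightarrow> bool" where
  "first_eigenfunction M \<mu> g u \<longleftrightarrow>
     C_map \<infinity> M u \<and> (\<forall>x\<in>M. - BE_laplacian M \<mu> g u x = lambda1 M \<mu> g * u x)"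

definition by_first_eigenfunctions ::
  "'a::euclidean_space set \<Rightarrow> 'a measure \<Rightarrow> ('a \<Rightarrow> ('a \<Rightarrow> real) \<Rightarrow> ('a \<Rightarrow> real) \<Rightarrow> real) \<Rightarrow>
   ('a \<Rightarrow> 'b::euclidean_space) \<Rightarrow> bool" where
  "by_first_eigenfunctions M \<mu> g f \<longleftrightarrow>
     (\<forall>i\<in>Basis. first_eigenfunction M \<mu> g (\<lambda>x. inner (f x) i))"

definition solves_first_eigenvalue_maximization ::
  "'a::euclidean_space set \<Rightarrow> 'a measure \<Rightarrow> ('a \<Rightarrow> 'a \<Rightarrow> 'a \<Rightarrow> real) \<Rightarrow>
   ('a \<Rightarrow> ('a \<Rightarrow> real) \<Rightarrow> ('a \<Rightarrow> real) \<Rightarrow> real) \<Rightarrow> bool" where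
  "solves_first_eigenvalue_maximization M \<mu> h g \<longleftrightarrow>
     g \<in> M_star M \<and> nonzero_section M g \<and>
     (\<forall>g'\<in>M_star M. nonzero_section M g' \<longrightarrow>
        lambda1 M \<mu> g' / average \<mu> (contraction M g' h)
        \<le> lambda1 M \<mu> g / average \<mu> (contraction M g h))"

definition inflated_candidates ::
  "'a::euclidean_space set \<Rightarrow> 'a measure \<Rightarrow> ('a \<Rightarrow> 'a \<Rightarrow> 'a \<Rightarrow> real) \<Rightarrow> ('a \<Rightarrow> l2) set" where
  "inflated_candidates M \<mu> h = {f. C_map \<infinity> M f \<and> short_map M h f \<and> average \<mu> f = 0}"

definition inflated_map ::
  "'a::euclidean_space set \<Rightarrow> 'a measure \<Rightarrow> ('a \<Rightarrow> 'a \<Rightarrow> 'a \<Rightarrow> real) \<Rightarrow> ('a \<Rightarrow> l2) \<Rightarrow> bool" where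
  "inflated_map M \<mu> h f \<longleftrightarrow>
     f \<in> inflated_candidates M \<mu> h \<and>
     (\<forall>f'\<in>inflated_candidates M \<mu> h.
        average \<mu> (\<lambda>x. (norm (f' x))\<^sup>2) \<le> average \<mu> (\<lambda>x. (norm (f x))\<^sup>2))"


section \<open>The group SU(2)\<close>

definition A_mat :: "complex \<Rightarrow> complex \<Rightarrow> complex^2^2" where
  "A_mat \<zeta>\<^sub>1 \<zeta>\<^sub>2 = vector [vector [\<zeta>\<^sub>1, - cnj \<zeta>\<^sub>2], vector [\<zeta>\<^sub>2, cnj \<zeta>\<^sub>1]]"

definition SU2 :: "(complex^2^2) set" where
  "SU2 = {A_mat \<zeta>\<^sub>1 \<zeta>\<^sub>2 | \<zeta>\<^sub>1 \<zeta>\<^sub>2. (cmod \<zeta>\<^sub>1)\<^sup>2 + (cmod \<zeta>\<^sub>2)\<^sup>2 = 1}"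

text \<open>
  Below, \<open>\<zeta>\<^sub>1 = X $ 1 $ 1\<close> and \<open>\<zeta>\<^sub>2 = X $ 2 $ 1\<close> are coordinates on \<open>SU2\<close>, so that
  \<open>d\<zeta>\<^sub>1(V) = V $ 1 $ 1\<close> and \<open>d\<zeta>\<^sub>2(V) = V $ 2 $ 1\<close>. The \<open>a\<close>-th component of \<open>sigma X V\<close> is
  \<open>\<sigma>\<^sub>a(V)\<close>; the expression for \<open>\<sigma>\<^sub>3\<close> is real on tangent vectors.
\<close>

definition sigma :: "complex^2^2 \<Rightarrow> complex^2^2 \<Rightarrow> real^3" where
  "sigma X V = vector
     [Re (\<i> * (X $ 2 $ 1 * V $ 1 $ 1 - X $ 1 $ 1 * V $ 2 $ 1)),
      Im (\<i> * (X $ 2 $ 1 * V $ 1 $ 1 - X $ 1 $ 1 * V $ 2 $ 1)),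
      Re (- \<i> * (cnj (X $ 1 $ 1) * V $ 1 $ 1 + cnj (X $ 2 $ 1) * V $ 2 $ 1))]"

definition E_field :: "3 \<Rightarrow> complex^2^2 \<Rightarrow> complex^2^2" where
  "E_field b X =
     (THE V. V \<in> tangent_space SU2 X \<and> (\<forall>a. sigma X V $ a = (if a = b then 1 else 0)))"

definition h_metric ::
  "real \<Rightarrow> real \<Rightarrow> real \<Rightarrow> complex^2^2 \<Rightarrow> complex^2^2 \<Rightarrow> complex^2^2 \<Rightarrow> real" where
  "h_metric a b c X V W =
     1 / a * (sigma X V $ 1 * sigma X W $ 1) + 1 / b * (sigma X V $ 2 * sigma X W $ 2)
     + 1 / c * (sigma X V $ 3 * sigma X W $ 3)"

definition h_star ::
  "real \<Rightarrow> real \<Rightarrow> real \<Rightarrow> complex^2^2 \<Rightarrow> (complex^2^2 \<Rightarrow> real) \<Rightarrow> (complex^2^2 \<Rightarrow> real) \<Rightarrow> real" where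
  "h_star u v w X \<alpha> \<beta> =
     u * (\<alpha> (E_field 1 X) * \<beta> (E_field 1 X)) + v * (\<alpha> (E_field 2 X) * \<beta> (E_field 2 X))
     + w * (\<alpha> (E_field 3 X) * \<beta> (E_field 3 X))"

text \<open>
  The measure of the left-invariant volume element of total volume \<open>1\<close>. By uniqueness of Haar
  measure, the conditions determine \<open>\<mu>\<close>.
\<close>

definition normalized_left_invariant_volume :: "(complex^2^2) measure \<Rightarrow> bool" where
  "normalized_left_invariant_volume \<mu> \<longleftrightarrow>
     space \<mu> = SU2 \<and> sets \<mu> = sets (restrict_space borel SU2) \<and> emeasure \<mu> SU2 = 1 \<and>
     (\<forall>A\<in>SU2. distr \<mu> \<mu> (\<lambda>B. A ** B) = \<mu>)"

definition l2_of_R7 :: "complex \<times> complex \<times> complex \<times> real \<Rightarrow> l2" where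
  "l2_of_R7 = (\<lambda>(z\<^sub>1, z\<^sub>2, z\<^sub>3, t). Abs_l2 (\<lambda>n.
     if n < 7 then [Re z\<^sub>1, Im z\<^sub>1, Re z\<^sub>2, Im z\<^sub>2, Re z\<^sub>3, Im z\<^sub>3, t] ! n else 0))"

lemma l2_nth_l2_of_R7:
  "l2_nth (l2_of_R7 (z\<^sub>1, z\<^sub>2, z\<^sub>3, t)) n =
     (if n < 7 then [Re z\<^sub>1, Im z\<^sub>1, Re z\<^sub>2, Im z\<^sub>2, Re z\<^sub>3, Im z\<^sub>3, t] ! n else 0)"
proof -
  let ?x = "\<lambda>n. if n < 7 then [Re z\<^sub>1, Im z\<^sub>1, Re z\<^sub>2, Im z\<^sub>2, Re z\<^sub>3, Im z\<^sub>3, t] ! n else 0"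
  have "summable (\<lambda>n. (?x n)\<^sup>2)"
    by (rule summable_finite[of "{..<7}"]) auto
  then show ?thesis unfolding l2_of_R7_def by (simp add: Abs_l2_inverse)
qed

lemma linear_l2_of_R7: "linear l2_of_R7"
proof (rule linearI)
  fix x y :: "complex \<times> complex \<times> complex \<times> real" and c :: real
  obtain x\<^sub>1 x\<^sub>2 x\<^sub>3 s y\<^sub>1 y\<^sub>2 y\<^sub>3 t where xy: "x = (x\<^sub>1, x\<^sub>2, x\<^sub>3, s)" "y = (y\<^sub>1, y\<^sub>2, y\<^sub>3, t)"
    by (metis prod_cases4)
  have nth: "n = 0 \<or> n = 1 \<or> n = 2 \<or> n = 3 \<or> n = 4 \<or> n = 5 \<or> n = 6 \<or> \<not> n < 7" for n :: nat
    by linarith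
  show "l2_of_R7 (x + y) = l2_of_R7 x + l2_of_R7 y"
  proof (rule l2_eqI)
    show "l2_nth (l2_of_R7 (x + y)) n = l2_nth (l2_of_R7 x + l2_of_R7 y) n" for n
      using nth[of n] by (auto simp: xy l2_nth_l2_of_R7)
  qed
  show "l2_of_R7 (c *\<^sub>R x) = c *\<^sub>R l2_of_R7 x"
  proof (rule l2_eqI)
    show "l2_nth (l2_of_R7 (c *\<^sub>R x)) n = l2_nth (c *\<^sub>R l2_of_R7 x) n" for n
      using nth[of n] by (auto simp: xy l2_nth_l2_of_R7)
  qed
qed

lemma norm_l2_of_R7: "norm (l2_of_R7 x) = norm x"
proof -
  obtain z\<^sub>1 z\<^sub>2 z\<^sub>3 t where x: "x = (z\<^sub>1, z\<^sub>2, z\<^sub>3, t)" by (metis prod_cases4)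
  have "(norm (l2_of_R7 x))\<^sup>2 = (\<Sum>n<7. (l2_nth (l2_of_R7 x) n)\<^sup>2)"
    unfolding norm_l2_square by (rule suminf_finite) (auto simp: x l2_nth_l2_of_R7)
  also have "\<dots> = (norm x)\<^sup>2"
    by (simp add: x l2_nth_l2_of_R7 eval_nat_numeral norm_Pair norm_complex_def)
  finally show ?thesis by (metis norm_ge_zero power2_eq_imp_eq)
qed

end

theory Submission
  imports Defs
begin

text \<open>
  \<^bold>\<open>Duality.\<close> Let \<open>g\<close> be positive semidefinite and let \<open>f\<close> be short with respect to \<open>h\<close> and of mean zero,
  with components \<open>f\<^sub>i\<close>. The Rayleigh quotient bound for each component, and the monotonicity of the
  contraction with \<open>g\<close>, give
  \<open>\<lambda>\<^sub>1(g) \<integral>\<parallel>f\<parallel>\<^sup>2 \<le> \<Sum>\<^sub>i \<integral>g(df\<^sub>i, df\<^sub>i) = \<integral>(g, f\<^sup>*h) \<le> \<integral>(g, h)\<close>.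
  Hence \<open>\<integral>\<parallel>f\<parallel>\<^sup>2\<close> is at most \<open>\<integral>(g, h) / \<lambda>\<^sub>1(g)\<close> whenever \<open>\<lambda>\<^sub>1(g) > 0\<close>. If a pair \<open>(\<phi>, g)\<close> turns both
  inequalities into equalities, then \<open>\<phi>\<close> is inflated and \<open>g\<close> solves the eigenvalue problem. The first
  inequality is an equality when the components of \<open>\<phi>\<close> are first eigenfunctions, the second when
  \<open>(g, h - \<phi>\<^sup>*h) = 0\<close>.

  \<^bold>\<open>The pair at hand.\<close> The first two components of \<open>\<phi>\<close> are linear, the others form a Hopf map onto a
  2-sphere, which is constant along \<open>E\<^sub>3\<close> and, up to scaling, a Riemannian submersion. This gives
  \<open>\<phi>\<^sup>*h = \<sigma>\<^sub>1\<^sup>2/b + \<sigma>\<^sub>2\<^sup>2/b + \<sigma>\<^sub>3\<^sup>2/c\<close> (\<open>hopf_deriv_inner\<close>), so \<open>h - \<phi>\<^sup>*h\<close> is a nonnegative multiple of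
  \<open>\<sigma>\<^sub>1\<^sup>2\<close>, which \<open>E\<^sub>2 \<otimes> E\<^sub>2 / 3 + E\<^sub>3 \<otimes> E\<^sub>3\<close> does not see. Differentiating twice shows that all components of
  \<open>\<phi>\<close> are eigenfunctions for the eigenvalue 4/3 (\<open>hopf_flows\<close>).

  \<^bold>\<open>The spectral gap.\<close> It remains to see that no smaller eigenvalue occurs, that is,
  \<open>\<integral>(E\<^sub>2 u)\<^sup>2 + 3 \<integral>(E\<^sub>3 u)\<^sup>2 \<ge> 4 \<integral>u\<^sup>2\<close> for \<open>u\<close> of mean zero (\<open>spectral_gap\<close>). Right translation by
  \<open>-1\<close>, and on even functions also by \<open>e\<^sub>2\<close> and \<open>e\<^sub>3\<close>, is an involution, which splits \<open>u\<close> orthogonally into a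
  symmetric and an antisymmetric part. An antisymmetric function is antiperiodic along the orbits of a
  circle subgroup, and the one-dimensional Wirtinger inequality gives the claim. A function \<open>w\<close> that
  is invariant under all three translations has the short period \<open>\<pi>/2\<close> along both families of circles. Then \<open>E\<^sub>3 w\<close> controls the distance of \<open>w\<close> to its average \<open>f\<close> along the
  \<open>E\<^sub>3\<close>-circles, and \<open>E\<^sub>2 w\<close> controls how far translations along the \<open>E\<^sub>2\<close>-circles move \<open>f\<close>. By the Euler
  decomposition \<open>exp(\<alpha> e\<^sub>3) exp(\<beta> e\<^sub>2) exp(\<gamma> e\<^sub>3)\<close> of the group elements, these translations decide the
  correlation of \<open>f\<close> with every translate of \<open>f\<close>; as \<open>f\<close> has mean zero, the average of these correlations
  is zero, so that some translation moves \<open>f\<close> by an amount comparable to its norm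
  (\<open>invariant_correlation\<close>, \<open>gap_invariant\<close>).
\<close>

section \<open>Wirtinger inequalities on an interval\<close>

text \<open>
  For \<open>w < \<pi>/T\<close> and the midpoint \<open>m\<close> of the interval, the function \<open>k t = - w tan (w (t - m))\<close> is regular on
  the closed interval and satisfies \<open>k' = - w\<^sup>2 - k\<^sup>2\<close>. Therefore \<open>v'\<^sup>2 - w\<^sup>2 v\<^sup>2 = (v' - k v)\<^sup>2 + (k v\<^sup>2)'\<close>, where the
  last term integrates to zero by the boundary conditions. Letting \<open>w\<close> tend to \<open>\<pi>/T\<close> gives the claim.
\<close>

lemma wirtinger_dirichlet:
  fixes v v' :: "real \<Rightarrow> real"
  assumes T: "0 < T"
    and deriv: "\<And>t. (v has_real_derivative v' t) (at t)"
    and cont: "continuous_on UNIV v'"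
    and zero: "v p = 0" "v (p + T) = 0"
  shows "(pi / T)\<^sup>2 * integral {p..p+T} (\<lambda>t. (v t)\<^sup>2) \<le> integral {p..p+T} (\<lambda>t. (v' t)\<^sup>2)"
proof -
  let ?I = "integral {p..p+T} (\<lambda>t. (v t)\<^sup>2)" and ?J = "integral {p..p+T} (\<lambda>t. (v' t)\<^sup>2)"
  have cv: "continuous_on S v" for S
    using deriv by (meson DERIV_continuous_on has_field_derivative_at_within)
  have cv': "continuous_on S v'" for S
    using cont continuous_on_subset by blast
  have int: "(\<lambda>t. (v t)\<^sup>2) integrable_on {p..p+T}" "(\<lambda>t. (v' t)\<^sup>2) integrable_on {p..p+T}"
    by (auto intro!: integrable_continuous_interval continuous_intros cv cv')
  have sub: "w\<^sup>2 * ?I \<le> ?J" if w: "0 \<le> w" "w < pi / T" for w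
  proof -
    define m where "m = p + T / 2"
    define k where "k = (\<lambda>t. - w * tan (w * (t - m)))"
    define G' where
      "G' = (\<lambda>t. - (w\<^sup>2 * inverse ((cos (w * (t - m)))\<^sup>2)) * (v t)\<^sup>2 + 2 * k t * v t * v' t)"
    have cos: "cos (w * (t - m)) > 0" if "t \<in> {p..p+T}" for t
    proof -
      have "\<bar>t - m\<bar> \<le> T / 2" using that by (auto simp: m_def abs_le_iff field_simps)
      then have "\<bar>w * (t - m)\<bar> \<le> w * (T / 2)"
        using w by (metis abs_mult abs_of_nonneg mult_left_mono)
      also have "\<dots> < pi / 2" using w T by (simp add: field_simps)
      finally show ?thesis by (intro cos_gt_zero_pi) (simp_all add: abs_less_iff)
    qed
    have "(G' has_integral (k (p+T) * (v (p+T))\<^sup>2 - k p * (v p)\<^sup>2)) {p..p+T}"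
    proof (rule fundamental_theorem_of_calculus)
      show "p \<le> p + T" using T by simp
      fix t assume t: "t \<in> {p..p+T}"
      have "(k has_real_derivative - (w\<^sup>2 * inverse ((cos (w * (t - m)))\<^sup>2))) (at t)"
        unfolding k_def using cos[OF t]
        by (auto intro!: derivative_eq_intros simp: power2_eq_square)
      then have "((\<lambda>t. k t * (v t)\<^sup>2) has_real_derivative G' t) (at t)"
        unfolding G'_def by (auto intro!: derivative_eq_intros deriv)
      then show "((\<lambda>t. k t * (v t)\<^sup>2) has_vector_derivative G' t) (at t within {p..p+T})"
        by (simp add: has_real_derivative_iff_has_vector_derivative has_vector_derivative_at_within)
    qed
    then have G: "(G' has_integral 0) {p..p+T}" by (simp add: zero)
    have "((\<lambda>t. (v' t)\<^sup>2 - w\<^sup>2 * (v t)\<^sup>2) has_integral (?J - w\<^sup>2 * ?I)) {p..p+T}"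
      by (intro has_integral_diff has_integral_mult_right integrable_integral int)
    with G have "0 \<le> ?J - w\<^sup>2 * ?I"
    proof (rule has_integral_le)
      fix t assume t: "t \<in> {p..p+T}"
      have "1 + (tan (w * (t - m)))\<^sup>2 = inverse ((cos (w * (t - m)))\<^sup>2)"
        using tan_sec[of "w * (t - m)"] cos[OF t] by (simp add: power_inverse)
      then have "w\<^sup>2 * inverse ((cos (w * (t - m)))\<^sup>2) = w\<^sup>2 + (k t)\<^sup>2"
        unfolding k_def by (metis (no_types, lifting) distrib_left mult.right_neutral
            mult_minus_left power2_minus power_mult_distrib)
      then have "(v' t)\<^sup>2 - w\<^sup>2 * (v t)\<^sup>2 - G' t = (v' t - k t * v t)\<^sup>2"
        unfolding G'_def by (simp add: power2_eq_square algebra_simps)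
      then show "G' t \<le> (v' t)\<^sup>2 - w\<^sup>2 * (v t)\<^sup>2"
        using zero_le_power2[of "v' t - k t * v t"] by linarith
    qed
    then show ?thesis by simp
  qed
  show ?thesis
  proof (rule tendsto_upperbound)
    show "((\<lambda>w. w\<^sup>2 * ?I) \<longlongrightarrow> (pi / T)\<^sup>2 * ?I) (at_left (pi / T))"
      by (intro tendsto_intros)
    have "\<forall>\<^sub>F w in at_left (pi / T). 0 < w \<and> w < pi / T"
      using eventually_at_left_real[of 0 "pi / T"] T by simp
    then show "\<forall>\<^sub>F w in at_left (pi / T). w\<^sup>2 * ?I \<le> ?J"
      by eventually_elim (simp add: sub)
  qed simp
qed

lemma integral_shift_period:
  fixes f :: "real \<Rightarrow> real"
  assumes T: "0 < T" and cont: "continuous_on UNIV f" and per: "\<And>t. f (t + T) = f t"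
  shows "integral {s..s+T} f = integral {0..T} f"
proof -
  have c: "continuous_on S f" for S using cont continuous_on_subset by blast
  have int: "f integrable_on {a..b}" for a b
    by (auto intro!: integrable_continuous_interval c)
  have per_int: "f (t + of_int k * T) = f t" for t k
  proof (induction k)
    case (nonneg n)
    show ?case
    proof (induction n)
      case (Suc n)
      then show ?case using per[of "t + real n * T"] by (simp add: algebra_simps)
    qed simp
  next
    case (neg n)
    show ?case
    proof (induction n)
      case 0
      then show ?case using per[of "t - T"] by simp
    next
      case (Suc n)
      then show ?case using per[of "t - T - (real n + 1) * T"] by (simp add: algebra_simps)
    qed
  qed
  have shift: "integral {a + of_int k * T..b + of_int k * T} f = integral {a..b} f" for a b k
  proof -
    have "integral {a..b} (f \<circ> (\<lambda>x. x + of_int k * T)) =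
        integral {a + of_int k * T..b + of_int k * T} f"
      by (rule integral_shift) (rule c)
    then show ?thesis by (simp add: per_int o_def)
  qed
  have small: "integral {r..r+T} f = integral {0..T} f" if "0 \<le> r" "r \<le> T" for r
  proof -
    have "integral {r..r+T} f = integral {r..T} f + integral {T..r+T} f"
      using that by (intro Henstock_Kurzweil_Integration.integral_combine[symmetric] int) auto
    also have "integral {T..r+T} f = integral {0..r} f"
      using shift[of 0 1 r] by simp
    also have "integral {r..T} f + integral {0..r} f = integral {0..T} f"
      using that by (subst add.commute)
        (intro Henstock_Kurzweil_Integration.integral_combine int; simp)
    finally show ?thesis .
  qed
  define k where "k = \<lfloor>s / T\<rfloor>"
  have "of_int k \<le> s / T" "s / T < of_int k + 1" unfolding k_def by linarith+
  then have "0 \<le> s - of_int k * T" "s - of_int k * T \<le> T"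
    using T by (simp_all add: field_simps)
  then have "integral {s - of_int k * T..s - of_int k * T + T} f = integral {0..T} f"
    by (rule small)
  then show ?thesis using shift[of "s - of_int k * T" k "s - of_int k * T + T"] by simp
qed

text \<open>
  An antiperiodic function has a zero \<open>p\<close>, and then \<open>p + T\<close> is a zero as well.
\<close>

lemma wirtinger_antiperiodic:
  fixes v v' :: "real \<Rightarrow> real"
  assumes T: "0 < T"
    and deriv: "\<And>t. (v has_real_derivative v' t) (at t)"
    and cont: "continuous_on UNIV v'"
    and anti: "\<And>t. v (t + T) = - v t"
  shows "(pi / T)\<^sup>2 * integral {0..T} (\<lambda>t. (v t)\<^sup>2) \<le> integral {0..T} (\<lambda>t. (v' t)\<^sup>2)"
proof -
  have cv: "continuous_on S v" for S
    using deriv by (meson DERIV_continuous_on has_field_derivative_at_within)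
  have anti': "v' (t + T) = - v' t" for t
  proof -
    have "((\<lambda>s. v (s + T)) has_real_derivative v' (t + T)) (at t)"
      using DERIV_shift deriv by blast
    moreover have "((\<lambda>s. v (s + T)) has_real_derivative - v' t) (at t)"
      unfolding anti by (intro derivative_intros deriv)
    ultimately show ?thesis by (rule DERIV_unique)
  qed
  have "\<exists>p. v p = 0"
  proof -
    have "v 0 \<le> 0 \<and> 0 \<le> v T \<or> v T \<le> 0 \<and> 0 \<le> v 0" using anti[of 0] by auto
    then show ?thesis
      using IVT'[of v 0 0 T, OF _ _ _ cv] IVT2'[of v T 0 0, OF _ _ _ cv] T by force
  qed
  then obtain p where p: "v p = 0" by blast
  from wirtinger_dirichlet[OF T deriv cont p] anti[of p] p
  have "(pi / T)\<^sup>2 * integral {p..p+T} (\<lambda>t. (v t)\<^sup>2) \<le> integral {p..p+T} (\<lambda>t. (v' t)\<^sup>2)"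
    by simp
  moreover have "integral {p..p+T} (\<lambda>t. (v t)\<^sup>2) = integral {0..T} (\<lambda>t. (v t)\<^sup>2)"
    by (intro integral_shift_period T continuous_intros cv) (simp add: anti)
  moreover have "integral {p..p+T} (\<lambda>t. (v' t)\<^sup>2) = integral {0..T} (\<lambda>t. (v' t)\<^sup>2)"
    by (intro integral_shift_period T continuous_intros cont) (simp add: anti')
  ultimately show ?thesis by simp
qed

text \<open>
  By the intermediate value theorem, \<open>v\<close> takes the same value \<open>c\<close> at some points \<open>p\<close> and \<open>p + T/2\<close>, so that
  the Dirichlet case applies to \<open>v - c\<close> on both halves of a period. Here \<open>c\<close> need not be the mean of \<open>v\<close>,
  but the mean is the constant closest to \<open>v\<close>.
\<close>

lemma wirtinger_periodic:
  fixes v v' :: "real \<Rightarrow> real"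
  assumes T: "0 < T"
    and deriv: "\<And>t. (v has_real_derivative v' t) (at t)"
    and cont: "continuous_on UNIV v'"
    and per: "\<And>t. v (t + T) = v t"
  shows "\<exists>c. (2 * pi / T)\<^sup>2 * integral {0..T} (\<lambda>t. (v t - c)\<^sup>2) \<le> integral {0..T} (\<lambda>t. (v' t)\<^sup>2)"
proof -
  have cv: "continuous_on S v" for S
    using deriv by (meson DERIV_continuous_on has_field_derivative_at_within)
  have cv': "continuous_on S v'" for S
    using cont continuous_on_subset by blast
  have per': "v' (t + T) = v' t" for t
  proof -
    have "((\<lambda>s. v (s + T)) has_real_derivative v' (t + T)) (at t)"
      using DERIV_shift deriv by blast
    then show ?thesis unfolding per using deriv DERIV_unique by blast
  qed
  define d where "d = (\<lambda>t. v t - v (t + T / 2))"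
  have cd: "continuous_on S d" for S
    unfolding d_def by (intro continuous_intros cv continuous_on_compose2[OF cv[of UNIV]]) auto
  have "\<exists>p. d p = 0"
  proof -
    have "d (T / 2) = - d 0" using per[of 0] by (simp add: d_def)
    then have "d 0 \<le> 0 \<and> 0 \<le> d (T/2) \<or> d (T/2) \<le> 0 \<and> 0 \<le> d 0" by auto
    then show ?thesis
      using IVT'[of d 0 0 "T/2", OF _ _ _ cd] IVT2'[of d "T/2" 0 0, OF _ _ _ cd] T by force
  qed
  then obtain p where "d p = 0" by blast
  then have p: "v (p + T / 2) = v p" by (simp add: d_def)
  define c where "c = v p"
  have half: "(2 * pi / T)\<^sup>2 * integral {q..q + T/2} (\<lambda>t. (v t - c)\<^sup>2) \<le> integral {q..q + T/2} (\<lambda>t. (v' t)\<^sup>2)"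
    if "v q = c" "v (q + T / 2) = c" for q
  proof -
    have "((\<lambda>t. v t - c) has_real_derivative v' t) (at t)" for t
      using deriv[of t] by (auto intro!: derivative_eq_intros)
    from wirtinger_dirichlet[OF _ this cont, of "T / 2" q] T that show ?thesis by (simp add: mult.commute)
  qed
  have split: "integral {p..p+T} g = integral {p..p+T/2} g + integral {p+T/2..p+T/2+T/2} g"
    if "continuous_on UNIV g" for g :: "real \<Rightarrow> real"
  proof -
    have eq: "p + T / 2 + T / 2 = p + T" by simp
    have "integral {p..p+T/2} g + integral {p+T/2..p+T} g = integral {p..p+T} g"
      using T by (intro Henstock_Kurzweil_Integration.integral_combine)
        (auto intro!: integrable_continuous_interval continuous_on_subset[OF that])
    then show ?thesis unfolding eq by simp
  qed
  have "(2 * pi / T)\<^sup>2 * integral {p..p+T} (\<lambda>t. (v t - c)\<^sup>2) \<le> integral {p..p+T} (\<lambda>t. (v' t)\<^sup>2)"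
  proof -
    have "(2 * pi / T)\<^sup>2 * integral {p + T/2..p + T/2 + T/2} (\<lambda>t. (v t - c)\<^sup>2)
        \<le> integral {p + T/2..p + T/2 + T/2} (\<lambda>t. (v' t)\<^sup>2)"
      by (rule half) (use p per[of p] in \<open>simp_all add: c_def add.commute\<close>)
    moreover have "(2 * pi / T)\<^sup>2 * integral {p..p + T/2} (\<lambda>t. (v t - c)\<^sup>2)
        \<le> integral {p..p + T/2} (\<lambda>t. (v' t)\<^sup>2)"
      by (rule half) (use p in \<open>simp_all add: c_def\<close>)
    moreover have "continuous_on UNIV (\<lambda>t. (v t - c)\<^sup>2)" "continuous_on UNIV (\<lambda>t. (v' t)\<^sup>2)"
      by (intro continuous_intros cv cv')+
    ultimately show ?thesis unfolding split[OF \<open>continuous_on UNIV (\<lambda>t. (v t - c)\<^sup>2)\<close>]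
        split[OF \<open>continuous_on UNIV (\<lambda>t. (v' t)\<^sup>2)\<close>] distrib_left by linarith
  qed
  moreover have "integral {p..p+T} (\<lambda>t. (v t - c)\<^sup>2) = integral {0..T} (\<lambda>t. (v t - c)\<^sup>2)"
    by (intro integral_shift_period T continuous_intros cv) (simp add: per)
  moreover have "integral {p..p+T} (\<lambda>t. (v' t)\<^sup>2) = integral {0..T} (\<lambda>t. (v' t)\<^sup>2)"
    by (intro integral_shift_period T continuous_intros cont) (simp add: per')
  ultimately show ?thesis by auto
qed

lemma integral_power2_diff_mean_le:
  fixes v :: "real \<Rightarrow> real"
  assumes T: "0 < T" and cont: "continuous_on {0..T} v"
  shows "integral {0..T} (\<lambda>t. (v t - integral {0..T} v / T)\<^sup>2) \<le> integral {0..T} (\<lambda>t. (v t - c)\<^sup>2)"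
proof -
  define m where "m = integral {0..T} v / T"
  have int: "v integrable_on {0..T}" "(\<lambda>t. (v t)\<^sup>2) integrable_on {0..T}"
    by (auto intro!: integrable_continuous_interval continuous_intros cont)
  have expand: "integral {0..T} (\<lambda>t. (v t - k)\<^sup>2) = integral {0..T} (\<lambda>t. (v t)\<^sup>2) - 2 * k * (T * m) + T * k\<^sup>2" for k
  proof -
    have "((\<lambda>t. (v t)\<^sup>2 - (2 * k) * v t + k\<^sup>2) has_integral
        integral {0..T} (\<lambda>t. (v t)\<^sup>2) - (2 * k) * integral {0..T} v + measure lborel {0..T} *\<^sub>R k\<^sup>2) {0..T}"
      by (intro has_integral_add has_integral_diff has_integral_mult_right integrable_integral int
          has_integral_const_real)
    then have "integral {0..T} (\<lambda>t. (v t)\<^sup>2 - (2 * k) * v t + k\<^sup>2) =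
        integral {0..T} (\<lambda>t. (v t)\<^sup>2) - (2 * k) * integral {0..T} v + T * k\<^sup>2"
      using T by (simp add: integral_unique)
    moreover have "(v t - k)\<^sup>2 = (v t)\<^sup>2 - (2 * k) * v t + k\<^sup>2" for t
      by (simp add: power2_diff)
    moreover have "integral {0..T} v = T * m" using T by (simp add: m_def)
    ultimately show ?thesis by simp
  qed
  have "0 \<le> T * (m - c)\<^sup>2" using T by simp
  moreover have "T * (m - c)\<^sup>2 = (- 2 * c * (T * m) + T * c\<^sup>2) - (- 2 * m * (T * m) + T * m\<^sup>2)"
    by (simp add: power2_eq_square algebra_simps)
  ultimately show ?thesis unfolding m_def[symmetric] expand by simp
qed

text \<open>
  Both \<open>v\<close> and its translate are as close to the constant \<open>c\<close> as the periodic inequality allows.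
\<close>

lemma integral_power2_diff_shift_le:
  fixes v v' :: "real \<Rightarrow> real"
  assumes T: "0 < T"
    and deriv: "\<And>t. (v has_real_derivative v' t) (at t)"
    and cont: "continuous_on UNIV v'"
    and per: "\<And>t. v (t + T) = v t"
  shows "(pi / T)\<^sup>2 * integral {0..T} (\<lambda>t. (v t - v (t + s))\<^sup>2) \<le> integral {0..T} (\<lambda>t. (v' t)\<^sup>2)"
proof -
  have cv: "continuous_on S v" for S
    using deriv by (meson DERIV_continuous_on has_field_derivative_at_within)
  have cs: "continuous_on S (\<lambda>t. v (t + s))" for S
    by (intro continuous_on_compose2[OF cv[of UNIV]] continuous_intros) auto
  obtain c where c: "(2 * pi / T)\<^sup>2 * integral {0..T} (\<lambda>t. (v t - c)\<^sup>2) \<le> integral {0..T} (\<lambda>t. (v' t)\<^sup>2)"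
    using wirtinger_periodic[OF assms] by blast
  have "integral {0..T} (\<lambda>t. (v (t + s) - c)\<^sup>2) = integral {0..T} ((\<lambda>t. (v t - c)\<^sup>2) \<circ> (\<lambda>t. t + s))"
    by (simp add: o_def)
  also have "\<dots> = integral {0 + s..T + s} (\<lambda>t. (v t - c)\<^sup>2)"
    by (intro integral_shift continuous_intros cv)
  also have "\<dots> = integral {0..T} (\<lambda>t. (v t - c)\<^sup>2)"
    using integral_shift_period[OF T, of "\<lambda>t. (v t - c)\<^sup>2" s] by (simp add: per cv continuous_intros add.commute)
  finally have shift: "integral {0..T} (\<lambda>t. (v (t + s) - c)\<^sup>2) = integral {0..T} (\<lambda>t. (v t - c)\<^sup>2)" .
  have "integral {0..T} (\<lambda>t. (v t - v (t + s))\<^sup>2)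
      \<le> integral {0..T} (\<lambda>t. 2 * (v t - c)\<^sup>2 + 2 * (v (t + s) - c)\<^sup>2)"
  proof (rule integral_le)
    show "(v t - v (t + s))\<^sup>2 \<le> 2 * (v t - c)\<^sup>2 + 2 * (v (t + s) - c)\<^sup>2" for t
    proof -
      have "0 \<le> ((v t - c) + (v (t + s) - c))\<^sup>2" by simp
      then show ?thesis by (simp add: power2_eq_square algebra_simps)
    qed
  qed (auto intro!: integrable_continuous_interval continuous_intros cv cs)
  also have "\<dots> = 2 * integral {0..T} (\<lambda>t. (v t - c)\<^sup>2) + 2 * integral {0..T} (\<lambda>t. (v (t + s) - c)\<^sup>2)"
    by (subst integral_add) (auto intro!: integrable_continuous_interval continuous_intros cv cs)
  also have "\<dots> = 4 * integral {0..T} (\<lambda>t. (v t - c)\<^sup>2)" by (simp add: shift)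
  finally have "(pi / T)\<^sup>2 * integral {0..T} (\<lambda>t. (v t - v (t + s))\<^sup>2)
      \<le> (pi / T)\<^sup>2 * (4 * integral {0..T} (\<lambda>t. (v t - c)\<^sup>2))"
    by (rule mult_left_mono) simp
  also have "\<dots> = (2 * pi / T)\<^sup>2 * integral {0..T} (\<lambda>t. (v t - c)\<^sup>2)"
    by (simp add: power2_eq_square)
  also note c
  finally show ?thesis .
qed

section \<open>Smooth functions and their differentials on submanifolds\<close>

lemma n_times_cong:
  assumes "open U" "\<And>x. x \<in> U \<Longrightarrow> F x = G x"
    and "n_times_continuously_differentiable_on n U F"
  shows "n_times_continuously_differentiable_on n U G"
  using assms
proof (induction n arbitrary: F G)
  case 0
  then show ?case using continuous_on_cong[of U U F G] by simp
next
  case (Suc n)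
  have d: "(G has_derivative F') (at x)" if "x \<in> U" "(F has_derivative F') (at x)" for x F'
    using has_derivative_transform_within_open[OF that(2) Suc.prems(1) that(1)] Suc.prems(2) by blast
  have fr: "G differentiable (at x) \<and> frechet_derivative G (at x) = frechet_derivative F (at x)"
    if "x \<in> U" for x
  proof -
    have "(F has_derivative frechet_derivative F (at x)) (at x)"
      using Suc.prems(3) that by (simp add: frechet_derivative_works)
    from d[OF that this] show ?thesis
      by (metis differentiableI frechet_derivative_at)
  qed
  have "n_times_continuously_differentiable_on n U (\<lambda>x. frechet_derivative G (at x) v)" for v
    by (rule Suc.IH[of "\<lambda>x. frechet_derivative F (at x) v"]) (use Suc.prems fr in auto)
  with fr show ?case by auto
qed

lemma n_times_subset:
  assumes "n_times_continuously_differentiable_on n U F" "V \<subseteq> U"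
  shows "n_times_continuously_differentiable_on n V F"
  using assms(1)
proof (induction n arbitrary: F)
  case 0
  then show ?case using assms(2) continuous_on_subset by simp
next
  case (Suc n)
  then show ?case using assms(2) by (simp add: subset_iff)
qed

lemma n_times_imp_continuous_on:
  assumes "n_times_continuously_differentiable_on n U F"
  shows "continuous_on U F"
proof (cases n)
  case (Suc m)
  then have "F differentiable (at x)" if "x \<in> U" for x using assms that by simp
  then show ?thesis
    by (intro continuous_at_imp_continuous_on ballI differentiable_imp_continuous_within)
qed (use assms in simp)

text \<open>
  Replaces the Frechet derivative by any explicit formula for it. All closure properties below are
  inductions on the order of differentiability with this rule.
\<close>

lemma n_times_SucI:
  assumes U: "open U"
    and deriv: "\<And>x. x \<in> U \<Longrightarrow> (F has_derivative F' x) (at x)"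
    and "\<And>v. n_times_continuously_differentiable_on n U (\<lambda>x. F' x v)"
  shows "n_times_continuously_differentiable_on (Suc n) U F"
proof -
  have "frechet_derivative F (at x) = F' x" if "x \<in> U" for x
    using deriv[OF that] frechet_derivative_at by metis
  then show ?thesis
    using assms by (auto intro!: n_times_cong[OF U _ assms(3)] differentiableI)
qed

lemma n_times_SucD:
  assumes "n_times_continuously_differentiable_on (Suc n) U F"
  shows "\<And>x. x \<in> U \<Longrightarrow> (F has_derivative frechet_derivative F (at x)) (at x)"
    and "\<And>v. n_times_continuously_differentiable_on n U (\<lambda>x. frechet_derivative F (at x) v)"
proof -
  show "(F has_derivative frechet_derivative F (at x)) (at x)" if "x \<in> U" for x
    using assms that unfolding frechet_derivative_works[symmetric] by simp
  show "n_times_continuously_differentiable_on n U (\<lambda>x. frechet_derivative F (at x) v)" for v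
    using assms by simp
qed

lemma n_times_Suc_imp:
  "n_times_continuously_differentiable_on (Suc n) U F \<Longrightarrow> n_times_continuously_differentiable_on n U F"
proof (induction n arbitrary: F)
  case 0
  then show ?case using n_times_imp_continuous_on by fastforce
next
  case (Suc n)
  then show ?case by (metis n_times_continuously_differentiable_on.simps(2))
qed

lemma n_times_const: "open U \<Longrightarrow> n_times_continuously_differentiable_on n U (\<lambda>x. c)"
proof (induction n arbitrary: c)
  case (Suc n)
  then show ?case by (intro n_times_SucI[where F' = "\<lambda>x v. 0"]) auto
qed simp

lemma n_times_bounded_linear:
  assumes "open U" "bounded_linear h"
  shows "n_times_continuously_differentiable_on n U h"
proof (cases n)
  case 0
  then show ?thesis using assms(2) by (simp add: linear_continuous_on)
next
  case (Suc m)
  have "n_times_continuously_differentiable_on (Suc m) U h"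
    by (rule n_times_SucI[OF assms(1) bounded_linear_imp_has_derivative[OF assms(2)] n_times_const[OF assms(1)]])
  then show ?thesis using Suc by simp
qed

lemma n_times_compose_linear:
  assumes "open U" "bounded_linear h" "n_times_continuously_differentiable_on n U F"
  shows "n_times_continuously_differentiable_on n U (\<lambda>x. h (F x))"
  using assms(3)
proof (induction n arbitrary: F)
  case 0
  then show ?case using assms(2) by (simp add: bounded_linear.continuous_on)
next
  case (Suc n)
  show ?case
    by (rule n_times_SucI[OF assms(1) bounded_linear.has_derivative[OF assms(2) n_times_SucD(1)[OF Suc.prems]]
          Suc.IH[OF n_times_SucD(2)[OF Suc.prems]]])
qed

lemma n_times_add:
  assumes "open U" "n_times_continuously_differentiable_on n U F" "n_times_continuously_differentiable_on n U G"
  shows "n_times_continuously_differentiable_on n U (\<lambda>x. F x + G x)"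
  using assms(2,3)
proof (induction n arbitrary: F G)
  case 0
  then show ?case by (simp add: continuous_on_add)
next
  case (Suc n)
  show ?case
    by (rule n_times_SucI[OF assms(1), where
          F' = "\<lambda>x v. frechet_derivative F (at x) v + frechet_derivative G (at x) v"])
      (use n_times_SucD[OF Suc.prems(1)] n_times_SucD[OF Suc.prems(2)] Suc.IH in
        \<open>auto intro!: has_derivative_add\<close>)
qed

lemma n_times_mult:
  fixes F G :: "'a::euclidean_space \<Rightarrow> 'b::real_normed_algebra"
  assumes "open U" "n_times_continuously_differentiable_on n U F" "n_times_continuously_differentiable_on n U G"
  shows "n_times_continuously_differentiable_on n U (\<lambda>x. F x * G x)"
  using assms(2,3)
proof (induction n arbitrary: F G)
  case 0
  then show ?case by (simp add: continuous_on_mult)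
next
  case (Suc n)
  show ?case
    by (rule n_times_SucI[OF assms(1), where
          F' = "\<lambda>x v. F x * frechet_derivative G (at x) v + frechet_derivative F (at x) v * G x"])
      (use n_times_SucD[OF Suc.prems(1)] n_times_SucD[OF Suc.prems(2)] Suc.IH
         n_times_Suc_imp[OF Suc.prems(1)] n_times_Suc_imp[OF Suc.prems(2)] assms(1) in
        \<open>auto intro!: has_derivative_mult n_times_add\<close>)
qed

lemma n_times_Pair:
  assumes "open U" "n_times_continuously_differentiable_on n U F" "n_times_continuously_differentiable_on n U G"
  shows "n_times_continuously_differentiable_on n U (\<lambda>x. (F x, G x))"
  using assms(2,3)
proof (induction n arbitrary: F G)
  case 0
  then show ?case by (simp add: continuous_on_Pair)
next
  case (Suc n)
  show ?case
    by (rule n_times_SucI[OF assms(1), where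
          F' = "\<lambda>x v. (frechet_derivative F (at x) v, frechet_derivative G (at x) v)"])
      (use n_times_SucD[OF Suc.prems(1)] n_times_SucD[OF Suc.prems(2)] Suc.IH in
        \<open>auto intro!: has_derivative_Pair\<close>)
qed

lemma C_map_globalI:
  assumes "\<And>n. n_times_continuously_differentiable_on n UNIV F" "\<And>x. x \<in> M \<Longrightarrow> F x = f x"
  shows "C_map k M f"
  unfolding C_map_def
proof (intro ballI exI[of _ UNIV] exI[of _ F] conjI)
  show "F x = f x" if "x \<in> M \<inter> UNIV" for x using assms(2) that by blast
  show "\<forall>n. enat n \<le> k \<longrightarrow> n_times_continuously_differentiable_on n UNIV F" using assms(1) by blast
qed simp_all

lemma C_map_cong: "(\<And>x. x \<in> M \<Longrightarrow> f x = g x) \<Longrightarrow> C_map k M f \<longleftrightarrow> C_map k M g"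
proof -
  assume eq: "\<And>x. x \<in> M \<Longrightarrow> f x = g x"
  have "(\<forall>x\<in>M \<inter> U. F x = f x) \<longleftrightarrow> (\<forall>x\<in>M \<inter> U. F x = g x)" for U F
    using eq by simp
  then show ?thesis unfolding C_map_def by simp
qed

lemma C_map_compose_linear:
  assumes "C_map k M f" "bounded_linear h"
  shows "C_map k M (\<lambda>x. h (f x))"
  unfolding C_map_def
proof
  fix p assume "p \<in> M"
  then obtain U F where "open U" "p \<in> U" "\<forall>x\<in>M \<inter> U. F x = f x"
      "\<forall>n. enat n \<le> k \<longrightarrow> n_times_continuously_differentiable_on n U F"
    using assms(1) unfolding C_map_def by blast
  then show "\<exists>U F. open U \<and> p \<in> U \<and> (\<forall>x\<in>M \<inter> U. F x = h (f x)) \<and>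
        (\<forall>n. enat n \<le> k \<longrightarrow> n_times_continuously_differentiable_on n U F)"
    by (intro exI[of _ U] exI[of _ "\<lambda>x. h (F x)"]) (simp add: n_times_compose_linear[OF _ assms(2)])
qed

lemma C_map_add:
  assumes "C_map k M f" "C_map k M g"
  shows "C_map k M (\<lambda>x. f x + g x)"
  unfolding C_map_def
proof
  fix p assume p: "p \<in> M"
  obtain U F where U: "open U" "p \<in> U" "\<forall>x\<in>M \<inter> U. F x = f x"
      "\<forall>n. enat n \<le> k \<longrightarrow> n_times_continuously_differentiable_on n U F"
    using assms(1) p unfolding C_map_def by blast
  obtain V G where V: "open V" "p \<in> V" "\<forall>x\<in>M \<inter> V. G x = g x"
      "\<forall>n. enat n \<le> k \<longrightarrow> n_times_continuously_differentiable_on n V G"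
    using assms(2) p unfolding C_map_def by blast
  have "n_times_continuously_differentiable_on n (U \<inter> V) (\<lambda>x. F x + G x)" if "enat n \<le> k" for n
    by (rule n_times_add) (use U V that in \<open>auto intro: n_times_subset\<close>)
  then show "\<exists>U F. open U \<and> p \<in> U \<and> (\<forall>x\<in>M \<inter> U. F x = f x + g x) \<and>
        (\<forall>n. enat n \<le> k \<longrightarrow> n_times_continuously_differentiable_on n U F)"
    using U V by (intro exI[of _ "U \<inter> V"] exI[of _ "\<lambda>x. F x + G x"]) auto
qed

lemma C_map_diff:
  assumes "C_map k M f" "C_map k M g"
  shows "C_map k M (\<lambda>x. f x - g x)"
proof -
  have "C_map k M (\<lambda>x. - g x)"
    by (rule C_map_compose_linear[OF assms(2)]) (intro bounded_linear_minus bounded_linear_ident)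
  from C_map_add[OF assms(1) this] show ?thesis by simp
qed

lemma continuous_on_locally:
  fixes f :: "'a::t2_space \<Rightarrow> 'b::topological_space"
  assumes "\<And>p. p \<in> M \<Longrightarrow> \<exists>U. open U \<and> p \<in> U \<and> continuous_on (M \<inter> U) f"
  shows "continuous_on M f"
  unfolding continuous_on_eq_continuous_within
proof (rule ballI)
  fix p assume p: "p \<in> M"
  then obtain U where U: "open U" "p \<in> U" "continuous_on (M \<inter> U) f" using assms by blast
  then have "continuous (at p within M \<inter> U) f"
    using p by (metis Int_iff continuous_on_eq_continuous_within)
  then show "continuous (at p within M) f"
  proof -
    have "at p within M \<inter> U = at p within M" using U by (intro at_within_nhd[of p U]) auto
    with \<open>continuous (at p within M \<inter> U) f\<close> show ?thesis by simp
  qed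
qed

lemma C_map_imp_continuous_on:
  assumes "C_map k M f"
  shows "continuous_on M f"
proof (rule continuous_on_locally)
  fix p assume "p \<in> M"
  then obtain U F where U: "open U" "p \<in> U" "\<forall>x\<in>M \<inter> U. F x = f x"
      "\<forall>n. enat n \<le> k \<longrightarrow> n_times_continuously_differentiable_on n U F"
    using assms(1) unfolding C_map_def by blast
  then have "continuous_on U F" by (auto dest: spec[of _ 0] simp: enat_0)
  then have "continuous_on (M \<inter> U) F" by (rule continuous_on_subset) auto
  then have "continuous_on (M \<inter> U) f" 
    by (rule continuous_on_eq) (use U(3) in simp)
  then show "\<exists>U. open U \<and> p \<in> U \<and> continuous_on (M \<inter> U) f" using U by blast
qed

text \<open>
  The definite description in the differential is determined because a tangent vector is, by
  definition, the velocity of some curve in \<open>M\<close>.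
\<close>

lemma differential_eqI:
  assumes v: "v \<in> tangent_space M x"
    and w: "\<And>\<gamma>. \<lbrakk>\<And>t. \<gamma> t \<in> M; \<gamma> 0 = x; (\<gamma> has_vector_derivative v) (at (0::real))\<rbrakk> \<Longrightarrow>
        ((\<lambda>t. f (\<gamma> t)) has_vector_derivative w) (at 0)"
  shows "differential M f x v = w"
  unfolding differential_def
proof (rule the_equality)
  fix w' assume w': "\<forall>\<gamma>. (\<forall>t. \<gamma> t \<in> M) \<and> \<gamma> 0 = x \<and> (\<gamma> has_vector_derivative v) (at (0::real)) \<longrightarrow>
        ((\<lambda>t. f (\<gamma> t)) has_vector_derivative w') (at 0)"
  obtain \<gamma> where "\<forall>t. \<gamma> t \<in> M" "\<gamma> 0 = x" "(\<gamma> has_vector_derivative v) (at (0::real))"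
    using v unfolding tangent_space_def by blast
  then show "w' = w" using w w' vector_derivative_unique_at by blast
qed (use w in blast)

text \<open>
  The derivative of a local extension of \<open>f\<close> to the ambient space computes the velocity of \<open>f\<close> along every
  curve in \<open>M\<close>. This is what makes the differential linear on tangent spaces and continuous.
\<close>

lemma C_map_local_derivative:
  assumes "C_map k M f" "1 \<le> k" "p \<in> M"
  shows "\<exists>U D. open U \<and> p \<in> U \<and> (\<forall>x\<in>M \<inter> U. linear (D x)) \<and>
      (\<forall>v. continuous_on (M \<inter> U) (\<lambda>x. D x v)) \<and>
      (\<forall>x\<in>M \<inter> U. \<forall>v \<gamma>. (\<forall>t. \<gamma> t \<in> M) \<and> \<gamma> 0 = x \<and> (\<gamma> has_vector_derivative v) (at (0::real)) \<longrightarrow>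
        ((\<lambda>t. f (\<gamma> t)) has_vector_derivative D x v) (at 0))"
proof -
  obtain U F where U: "open U" "p \<in> U" "\<forall>x\<in>M \<inter> U. F x = f x"
      "\<forall>n. enat n \<le> k \<longrightarrow> n_times_continuously_differentiable_on n U F"
    using assms(1,3) unfolding C_map_def by blast
  then have N: "n_times_continuously_differentiable_on (Suc 0) U F"
    using assms(2) by (metis One_nat_def one_enat_def)
  note D = n_times_SucD[OF N]
  show ?thesis
  proof (intro exI[of _ U] exI[of _ "\<lambda>x. frechet_derivative F (at x)"] conjI ballI allI impI)
    show "open U" "p \<in> U" by fact+
    show "linear (frechet_derivative F (at x))" if "x \<in> M \<inter> U" for x
      using D(1)[of x] that has_derivative_linear by blast
    show "continuous_on (M \<inter> U) (\<lambda>x. frechet_derivative F (at x) v)" for v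
      using D(2)[of v] by (auto intro: continuous_on_subset)
    fix x v and \<gamma> :: "real \<Rightarrow> 'a"
    assume x: "x \<in> M \<inter> U" and "(\<forall>t. \<gamma> t \<in> M) \<and> \<gamma> 0 = x \<and> (\<gamma> has_vector_derivative v) (at 0)"
    then have \<gamma>: "\<And>t. \<gamma> t \<in> M" "\<gamma> 0 = x" "(\<gamma> has_vector_derivative v) (at 0)" by auto
    have "((F \<circ> \<gamma>) has_derivative (frechet_derivative F (at x) \<circ> (\<lambda>t. t *\<^sub>R v))) (at 0)"
      using \<gamma> x D(1)[of x] by (intro diff_chain_at) (auto simp: has_vector_derivative_def)
    then have "((F \<circ> \<gamma>) has_vector_derivative frechet_derivative F (at x) v) (at 0)"
      using D(1)[of x] x linear_scale[OF has_derivative_linear[OF D(1)[of x]]]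
      by (simp add: has_vector_derivative_def o_def)
    moreover have "\<forall>\<^sub>F t in nhds 0. (F \<circ> \<gamma>) t = f (\<gamma> t)"
    proof -
      have "isCont \<gamma> 0" using \<gamma>(3) by (rule has_vector_derivative_continuous)
      then have "(\<gamma> \<longlongrightarrow> \<gamma> 0) (nhds 0)" by (simp add: isCont_def tendsto_at_iff_tendsto_nhds)
      then have "\<forall>\<^sub>F t in nhds 0. \<gamma> t \<in> U"
        using U(1) x \<gamma>(2) by (auto dest: topological_tendstoD)
      then show ?thesis by eventually_elim (use U(3) \<gamma>(1) in auto)
    qed
    then obtain d where "0 < d" "\<And>t. dist t 0 < d \<Longrightarrow> (F \<circ> \<gamma>) t = f (\<gamma> t)"
      unfolding eventually_nhds_metric by blast
    ultimately show "((\<lambda>t. f (\<gamma> t)) has_vector_derivative frechet_derivative F (at x) v) (at 0)"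
      using has_vector_derivative_transform_within[of "F \<circ> \<gamma>" _ 0 UNIV d "\<lambda>t. f (\<gamma> t)"] by simp
  qed
qed

lemma C_map_has_vector_derivative:
  assumes "C_map k M f" "1 \<le> k" "\<And>t. \<gamma> t \<in> M" "\<gamma> 0 = x" "(\<gamma> has_vector_derivative v) (at (0::real))"
  shows "((\<lambda>t. f (\<gamma> t)) has_vector_derivative differential M f x v) (at 0)"
proof -
  have x: "x \<in> M" using assms(3)[of 0] assms(4) by simp
  have v: "v \<in> tangent_space M x" using assms(3-5) unfolding tangent_space_def by blast
  obtain U D where D: "open U" "x \<in> U" "\<forall>x\<in>M \<inter> U. linear (D x)"
    "\<forall>v. continuous_on (M \<inter> U) (\<lambda>x. D x v)"
    "\<forall>x\<in>M \<inter> U. \<forall>v \<gamma>. (\<forall>t. \<gamma> t \<in> M) \<and> \<gamma> 0 = x \<and> (\<gamma> has_vector_derivative v) (at (0::real)) \<longrightarrow>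
        ((\<lambda>t. f (\<gamma> t)) has_vector_derivative D x v) (at 0)"
    using C_map_local_derivative[OF assms(1,2) x] by (elim exE conjE) (rule that)
  have "differential M f x v = D x v"
    by (rule differential_eqI[OF v]) (use x D(2,5) in auto)
  then show ?thesis using D(5) assms(3-5) x D(2) by auto
qed

lemma differential_compose_linear:
  assumes "C_map k M f" "1 \<le> k" "bounded_linear h" "v \<in> tangent_space M x"
  shows "differential M (\<lambda>x. h (f x)) x v = h (differential M f x v)"
  by (rule differential_eqI[OF assms(4)])
   (rule bounded_linear.has_vector_derivative[OF assms(3) C_map_has_vector_derivative[OF assms(1,2)]])

lemma differential_in_cotangent_space:
  assumes "C_map k M f" "1 \<le> k" "x \<in> M"
  shows "differential M f x \<in> cotangent_space M x"
proof -
  obtain U D where D: "open U" "x \<in> U" "\<forall>x\<in>M \<inter> U. linear (D x)"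
    "\<forall>v. continuous_on (M \<inter> U) (\<lambda>x. D x v)"
    "\<forall>x\<in>M \<inter> U. \<forall>v \<gamma>. (\<forall>t. \<gamma> t \<in> M) \<and> \<gamma> 0 = x \<and> (\<gamma> has_vector_derivative v) (at (0::real)) \<longrightarrow>
        ((\<lambda>t. f (\<gamma> t)) has_vector_derivative D x v) (at 0)"
    using C_map_local_derivative[OF assms] by (elim exE conjE) (rule that)
  have "differential M f x v = D x v" if "v \<in> tangent_space M x" for v
    by (rule differential_eqI[OF that]) (use assms(3) D(2,5) in auto)
  with D(2,3) assms(3) show ?thesis unfolding cotangent_space_def by auto
qed

lemma continuous_on_differential:
  assumes "C_map k M f" "1 \<le> k" "continuous_on M V" "\<And>x. x \<in> M \<Longrightarrow> V x \<in> tangent_space M x"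
  shows "continuous_on M (\<lambda>x. differential M f x (V x))"
proof (rule continuous_on_locally)
  fix p assume p: "p \<in> M"
  obtain U D where D: "open U" "p \<in> U" "\<forall>x\<in>M \<inter> U. linear (D x)"
    "\<forall>v. continuous_on (M \<inter> U) (\<lambda>x. D x v)"
    "\<forall>x\<in>M \<inter> U. \<forall>v \<gamma>. (\<forall>t. \<gamma> t \<in> M) \<and> \<gamma> 0 = x \<and> (\<gamma> has_vector_derivative v) (at (0::real)) \<longrightarrow>
        ((\<lambda>t. f (\<gamma> t)) has_vector_derivative D x v) (at 0)"
    using C_map_local_derivative[OF assms(1,2) p] by (elim exE conjE) (rule that)
  have "differential M f x (V x) = (\<Sum>i\<in>Basis. inner (V x) i *\<^sub>R D x i)" if "x \<in> M \<inter> U" for x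
  proof -
    have "differential M f x (V x) = D x (V x)"
      by (rule differential_eqI[OF assms(4)]) (use that D(5) in auto)
    also have "\<dots> = D x (\<Sum>i\<in>Basis. inner (V x) i *\<^sub>R i)" by (simp add: euclidean_representation)
    also have "\<dots> = (\<Sum>i\<in>Basis. inner (V x) i *\<^sub>R D x i)"
      using bspec[OF D(3) that] by (simp add: linear_sum linear_scale)
    finally show ?thesis .
  qed
  moreover have "continuous_on (M \<inter> U) (\<lambda>x. \<Sum>i\<in>Basis. inner (V x) i *\<^sub>R D x i)"
    by (intro continuous_intros D(4)[rule_format] continuous_on_subset[OF assms(3)]) auto
  ultimately have "continuous_on (M \<inter> U) (\<lambda>x. differential M f x (V x))"
    by (metis (no_types, lifting) continuous_on_cong)
  with D show "\<exists>U. open U \<and> p \<in> U \<and> continuous_on (M \<inter> U) (\<lambda>x. differential M f x (V x))" by blast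
qed

section \<open>The group SU(2) and its tangent spaces\<close>

lemma A_mat_nth [simp]:
  "A_mat z w $ 1 $ 1 = z" "A_mat z w $ 2 $ 1 = w" "A_mat z w $ 1 $ 2 = - cnj w" "A_mat z w $ 2 $ 2 = cnj z"
  by (simp_all add: A_mat_def)

lemma matrix_2_eq_iff:
  "X = Y \<longleftrightarrow> X $ 1 $ 1 = Y $ 1 $ 1 \<and> X $ 2 $ 1 = Y $ 2 $ 1 \<and> X $ 1 $ 2 = Y $ 1 $ 2 \<and> X $ 2 $ 2 = Y $ 2 $ 2"
  for X Y :: "complex^2^2"
  by (auto simp: vec_eq_iff forall_2)

lemma A_mat_mult: "A_mat a b ** A_mat c d = A_mat (a * c - cnj b * d) (b * c + cnj a * d)"
  by (simp add: matrix_2_eq_iff matrix_matrix_mult_def sum_2)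

lemma A_mat_add: "A_mat a b + A_mat c d = A_mat (a + c) (b + d)"
  by (simp add: matrix_2_eq_iff)

lemma scaleR_A_mat: "r *\<^sub>R A_mat a b = A_mat (r *\<^sub>R a) (r *\<^sub>R b)"
  by (simp add: matrix_2_eq_iff)

lemma mat_1_A_mat: "mat 1 = A_mat 1 0"
  by (simp add: matrix_2_eq_iff mat_def)

lemma A_mat_eq_iff [simp]: "A_mat a b = A_mat c d \<longleftrightarrow> a = c \<and> b = d"
  by (auto simp: matrix_2_eq_iff)

lemma bounded_bilinear_matrix_mult: "bounded_bilinear ((**) :: complex^2^2 \<Rightarrow> complex^2^2 \<Rightarrow> complex^2^2)"
  unfolding bilinear_conv_bounded_bilinear[symmetric] bilinear_def
  by (auto intro!: linearI simp: matrix_2_eq_iff matrix_matrix_mult_def sum_2 algebra_simps)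

lemmas matrix_mult_derivative = bounded_bilinear.has_vector_derivative[OF bounded_bilinear_matrix_mult]
lemmas continuous_on_matrix_mult [continuous_intros] =
  bounded_bilinear.continuous_on[OF bounded_bilinear_matrix_mult]
lemmas matrix_mult_scaleR_right = bounded_bilinear.scaleR_right[OF bounded_bilinear_matrix_mult]
lemmas matrix_mult_add_right = bounded_bilinear.add_right[OF bounded_bilinear_matrix_mult]

lemma SU2_cases [elim?]:
  assumes "X \<in> SU2"
  obtains z w where "X = A_mat z w" "(cmod z)\<^sup>2 + (cmod w)\<^sup>2 = 1"
  using assms unfolding SU2_def by blast

lemma A_mat_in_SU2: "A_mat z w \<in> SU2 \<longleftrightarrow> (cmod z)\<^sup>2 + (cmod w)\<^sup>2 = 1"
  unfolding SU2_def by auto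

lemma SU2_mult:
  assumes "X \<in> SU2" "Y \<in> SU2"
  shows "X ** Y \<in> SU2"
proof -
  obtain a b where X: "X = A_mat a b" "(cmod a)\<^sup>2 + (cmod b)\<^sup>2 = 1" using assms(1) by (rule SU2_cases)
  obtain c d where Y: "Y = A_mat c d" "(cmod c)\<^sup>2 + (cmod d)\<^sup>2 = 1" using assms(2) by (rule SU2_cases)
  have "(cmod (a * c - cnj b * d))\<^sup>2 + (cmod (b * c + cnj a * d))\<^sup>2
      = ((cmod a)\<^sup>2 + (cmod b)\<^sup>2) * ((cmod c)\<^sup>2 + (cmod d)\<^sup>2)"
    unfolding cmod_power2 by (simp add: power2_eq_square algebra_simps)
  then show ?thesis by (simp add: X Y A_mat_mult A_mat_in_SU2)
qed

definition adjoint_mat :: "complex^2^2 \<Rightarrow> complex^2^2" where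
  "adjoint_mat X = A_mat (cnj (X $ 1 $ 1)) (- (X $ 2 $ 1))"

lemma adjoint_mat_in_SU2: "X \<in> SU2 \<Longrightarrow> adjoint_mat X \<in> SU2"
  by (auto elim!: SU2_cases simp: adjoint_mat_def A_mat_in_SU2)

lemma SU2_mult_adjoint:
  assumes "X \<in> SU2"
  shows "X ** adjoint_mat X = mat 1" "adjoint_mat X ** X = mat 1"
proof -
  obtain a b where X: "X = A_mat a b" "(cmod a)\<^sup>2 + (cmod b)\<^sup>2 = 1" using assms by (rule SU2_cases)
  have "a * cnj a + b * cnj b = complex_of_real ((cmod a)\<^sup>2 + (cmod b)\<^sup>2)"
    by (simp only: complex_norm_square of_real_add)
  then have "a * cnj a + b * cnj b = 1" by (simp add: X(2))
  then show "X ** adjoint_mat X = mat 1" "adjoint_mat X ** X = mat 1"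
    by (simp_all add: X(1) adjoint_mat_def A_mat_mult mat_1_A_mat algebra_simps)
qed

lemma adjoint_mult:
  assumes "X \<in> SU2" "Y \<in> SU2"
  shows "adjoint_mat (X ** Y) = adjoint_mat Y ** adjoint_mat X"
  using assms by (auto elim!: SU2_cases simp: adjoint_mat_def A_mat_mult algebra_simps)

lemma adjoint_mat_involution: "X \<in> SU2 \<Longrightarrow> adjoint_mat (adjoint_mat X) = X"
  by (auto elim!: SU2_cases simp: adjoint_mat_def)

lemma mat_1_in_SU2: "mat 1 \<in> SU2"
  by (simp add: mat_1_A_mat A_mat_in_SU2)

lemma continuous_on_adjoint [continuous_intros]:
  "continuous_on S f \<Longrightarrow> continuous_on S (\<lambda>x. adjoint_mat (f x))"
proof -
  have "linear adjoint_mat"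
    by (auto intro!: linearI simp: adjoint_mat_def matrix_2_eq_iff)
  then have "bounded_linear adjoint_mat" by (simp add: linear_conv_bounded_linear)
  then show "continuous_on S f \<Longrightarrow> continuous_on S (\<lambda>x. adjoint_mat (f x))"
    by (rule bounded_linear.continuous_on)
qed

lemma compact_SU2: "compact SU2"
proof -
  have eq: "SU2 = (\<lambda>(z, w). A_mat z w) ` sphere 0 1"
    by (force simp: SU2_def image_iff norm_Pair norm_prod_def real_sqrt_eq_1_iff)
  have "linear (\<lambda>(z, w). A_mat z w)"
    by (auto intro!: linearI simp: A_mat_add scaleR_A_mat split: prod.split)
  then have "continuous_on (sphere 0 1) (\<lambda>(z, w). A_mat z w)"
    by (rule linear_continuous_on[OF linear_conv_bounded_linear[THEN iffD1]])
  then show ?thesis unfolding eq by (intro compact_continuous_image) auto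
qed

text \<open>
  The Lie algebra basis for which \<open>X ** generator b\<close> is the value of the left-invariant field \<open>E\<^sub>b\<close> at \<open>X\<close>.
\<close>

definition generator :: "3 \<Rightarrow> complex^2^2" where
  "generator b = (if b = 1 then A_mat 0 \<i> else if b = 2 then A_mat 0 (-1) else A_mat \<i> 0)"

text \<open>
  The exponential of \<open>t\<close> times the generator, whose square is \<open>-1\<close>.
\<close>

definition one_param :: "3 \<Rightarrow> real \<Rightarrow> complex^2^2" where
  "one_param b t = cos t *\<^sub>R mat 1 + sin t *\<^sub>R generator b"

lemma generator_simps [simp]:
  "generator 1 = A_mat 0 \<i>" "generator 2 = A_mat 0 (-1)" "generator 3 = A_mat \<i> 0"
  by (simp_all add: generator_def)

lemma one_param_A_mat:
  "one_param 1 t = A_mat (cos t) (\<i> * sin t)" "one_param 2 t = A_mat (cos t) (- sin t)"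
  "one_param 3 t = A_mat (cis t) 0"
  by (simp_all add: one_param_def mat_1_A_mat scaleR_A_mat A_mat_add complex_eq_iff)

lemma one_param_in_SU2: "one_param b t \<in> SU2"
  using exhaust_3[of b] by (auto simp: one_param_A_mat A_mat_in_SU2 cmod_power2)

lemma one_param_0 [simp]: "one_param b 0 = mat 1"
  by (simp add: one_param_def)

lemma one_param_add: "one_param b s ** one_param b t = one_param b (s + t)"
  using exhaust_3[of b]
  by (auto simp: one_param_A_mat A_mat_mult cos_add sin_add cis_mult complex_eq_iff algebra_simps)

lemma one_param_derivative:
  fixes X :: "complex^2^2"
  shows "((\<lambda>t. X ** one_param b t) has_vector_derivative (X ** one_param b t) ** generator b) (at t)"
proof -
  have "(one_param b has_vector_derivative (- sin t) *\<^sub>R mat 1 + cos t *\<^sub>R generator b) (at t)"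
    unfolding one_param_def[abs_def] has_vector_derivative_def
    by (auto intro!: derivative_eq_intros simp: algebra_simps)
  moreover have "(- sin t) *\<^sub>R mat 1 + cos t *\<^sub>R generator b = one_param b t ** generator b"
    using exhaust_3[of b]
    by (auto simp: one_param_A_mat A_mat_mult mat_1_A_mat scaleR_A_mat A_mat_add complex_eq_iff)
  ultimately have "(one_param b has_vector_derivative one_param b t ** generator b) (at t)" by simp
  from matrix_mult_derivative[OF has_vector_derivative_const this, of X] show ?thesis
    by (simp add: matrix_mul_assoc bounded_bilinear.zero_left[OF bounded_bilinear_matrix_mult])
qed

lemma continuous_on_one_param [continuous_intros]:
  fixes f :: "'a::t2_space \<Rightarrow> real"
  assumes "continuous_on S f"
  shows "continuous_on S (\<lambda>x. one_param b (f x))"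
  unfolding one_param_def by (intro continuous_intros assms)

text \<open>
  If \<open>\<zeta>\<^sub>1 = cos \<beta> exp(i\<theta>)\<close> and \<open>\<zeta>\<^sub>2 = sin \<beta> exp(i\<psi>)\<close>, then the outer angles are \<open>(\<theta> - \<psi>)/2\<close> and \<open>(\<theta> + \<psi>)/2\<close>; the
  middle one is \<open>-\<beta>\<close> because the second generator has \<open>-1\<close> in its lower left corner.
\<close>

lemma Euler_decomposition:
  assumes "g \<in> SU2"
  obtains \<alpha> \<beta> \<gamma> where "g = one_param 3 \<alpha> ** one_param 2 \<beta> ** one_param 3 \<gamma>"
proof -
  obtain z w where g: "g = A_mat z w" "(cmod z)\<^sup>2 + (cmod w)\<^sup>2 = 1" using assms by (rule SU2_cases)
  obtain \<beta> where \<beta>: "cmod z = cos \<beta>" "cmod w = sin \<beta>" 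
    using sincos_total_2pi[OF g(2)] by blast
  define \<theta> where "\<theta> = Arg z"
  define \<psi> where "\<psi> = Arg w"
  have z: "z = cos \<beta> * cis \<theta>" unfolding \<theta>_def \<beta>(1)[symmetric] by (metis rcis_cmod_Arg rcis_def)
  have w: "w = sin \<beta> * cis \<psi>" unfolding \<psi>_def \<beta>(2)[symmetric] by (metis rcis_cmod_Arg rcis_def)
  have "g = one_param 3 ((\<theta> - \<psi>) / 2) ** one_param 2 (- \<beta>) ** one_param 3 ((\<theta> + \<psi>) / 2)"
    by (simp add: g(1) z w one_param_A_mat A_mat_mult cis_mult cis_cnj field_simps)
  then show ?thesis by (rule that)
qed

lemma sigma_nth [simp]:
  "sigma X V $ 1 = Re (\<i> * (X $ 2 $ 1 * V $ 1 $ 1 - X $ 1 $ 1 * V $ 2 $ 1))"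
  "sigma X V $ 2 = Im (\<i> * (X $ 2 $ 1 * V $ 1 $ 1 - X $ 1 $ 1 * V $ 2 $ 1))"
  "sigma X V $ 3 = Re (- \<i> * (cnj (X $ 1 $ 1) * V $ 1 $ 1 + cnj (X $ 2 $ 1) * V $ 2 $ 1))"
  by (simp_all add: sigma_def vector_3)

lemma linear_sigma: "linear (sigma X)"
  by (rule linearI) (auto simp: vec_eq_iff forall_3 algebra_simps)

lemma sigma_generator:
  assumes "X \<in> SU2"
  shows "sigma X (X ** generator b) $ a = (if a = b then 1 else 0)"
proof -
  obtain z w where X: "X = A_mat z w" "(cmod z)\<^sup>2 + (cmod w)\<^sup>2 = 1" using assms by (rule SU2_cases)
  have "Re z * Re z + Im z * Im z + (Re w * Re w + Im w * Im w) = 1"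
    using X(2) unfolding cmod_power2 by (simp add: power2_eq_square)
  then show ?thesis using exhaust_3[of a] exhaust_3[of b]
    by (auto simp: X(1) A_mat_mult)
qed

text \<open>
  A tangent vector \<open>X ** Y\<close> of length \<open>n \<noteq> 0\<close> is the velocity of the great circle
  \<open>cos (n t) X + (sin (n t) / n) X ** Y\<close>.
\<close>

lemma sum_generator_in_tangent_space:
  assumes X: "X \<in> SU2"
  shows "(\<Sum>b\<in>UNIV. x b *\<^sub>R (X ** generator b)) \<in> tangent_space SU2 X"
proof -
  define n where "n = sqrt ((x 1)\<^sup>2 + (x 2)\<^sup>2 + (x 3)\<^sup>2)"
  have V: "(\<Sum>b\<in>UNIV. x b *\<^sub>R (X ** generator b)) = X ** A_mat (\<i> * x 3) (\<i> * x 1 - x 2)"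
  proof -
    have "(\<Sum>b\<in>UNIV. x b *\<^sub>R (X ** generator b)) =
        X ** (x 1 *\<^sub>R A_mat 0 \<i> + x 2 *\<^sub>R A_mat 0 (-1) + x 3 *\<^sub>R A_mat \<i> 0)"
      by (simp only: sum_3 generator_simps matrix_mult_scaleR_right matrix_mult_add_right)
    also have "x 1 *\<^sub>R A_mat 0 \<i> + x 2 *\<^sub>R A_mat 0 (-1) + x 3 *\<^sub>R A_mat \<i> 0
        = A_mat (\<i> * x 3) (\<i> * x 1 - x 2)"
      by (simp add: A_mat_add scaleR_A_mat complex_eq_iff)
    finally show ?thesis .
  qed
  show ?thesis
  proof (cases "n = 0")
    case True
    then have "x 1 = 0" "x 2 = 0" "x 3 = 0"
      unfolding n_def by (simp_all add: add_nonneg_eq_0_iff)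
    then have "((\<lambda>t. X) has_vector_derivative (\<Sum>b\<in>UNIV. x b *\<^sub>R (X ** generator b))) (at (0::real))"
      by (simp add: sum_3)
    then show ?thesis using X unfolding tangent_space_def
      by (intro CollectI exI[of _ "\<lambda>t. X"]) simp
  next
    case False
    define \<gamma> where "\<gamma> = (\<lambda>t. X ** (cos (n * t) *\<^sub>R mat 1 + (sin (n * t) / n) *\<^sub>R A_mat (\<i> * x 3) (\<i> * x 1 - x 2)))"
    have n2: "n\<^sup>2 = (x 1)\<^sup>2 + (x 2)\<^sup>2 + (x 3)\<^sup>2" unfolding n_def by simp
    have "\<gamma> t \<in> SU2" for t
    proof -
      define s where "s = sin (n * t) / n"
      have "(s * x 3)\<^sup>2 + (s * x 1)\<^sup>2 + (s * x 2)\<^sup>2 = s\<^sup>2 * n\<^sup>2"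
        unfolding n2 by (simp add: power2_eq_square algebra_simps)
      also have "\<dots> = (s * n)\<^sup>2" by (simp add: power_mult_distrib)
      also have "s * n = sin (n * t)" using False by (simp add: s_def)
      finally have "(s * x 3)\<^sup>2 + (s * x 1)\<^sup>2 + (s * x 2)\<^sup>2 = (sin (n * t))\<^sup>2" .
      then have "A_mat (of_real (cos (n * t)) + \<i> * of_real (s * x 3)) (\<i> * of_real (s * x 1) - of_real (s * x 2)) \<in> SU2"
        unfolding A_mat_in_SU2 cmod_power2 sin_squared_eq by simp
      moreover have "cos (n * t) *\<^sub>R mat 1 + s *\<^sub>R A_mat (\<i> * x 3) (\<i> * x 1 - x 2)
          = A_mat (of_real (cos (n * t)) + \<i> * of_real (s * x 3)) (\<i> * of_real (s * x 1) - of_real (s * x 2))"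
        by (simp add: mat_1_A_mat scaleR_A_mat A_mat_add complex_eq_iff)
      ultimately show ?thesis unfolding \<gamma>_def s_def[symmetric] using SU2_mult[OF X] by simp
    qed
    moreover have "\<gamma> 0 = X" by (simp add: \<gamma>_def)
    moreover have "(\<gamma> has_vector_derivative X ** A_mat (\<i> * x 3) (\<i> * x 1 - x 2)) (at 0)"
    proof -
      let ?Y = "A_mat (\<i> * x 3) (\<i> * x 1 - x 2)"
      have "((\<lambda>t. cos (n * t) *\<^sub>R mat 1 + (sin (n * t) / n) *\<^sub>R ?Y) has_vector_derivative ?Y) (at 0)"
        unfolding has_vector_derivative_def using False
        by (auto intro!: derivative_eq_intros simp: algebra_simps)
      from matrix_mult_derivative[OF has_vector_derivative_const this, of X] show ?thesis
        unfolding \<gamma>_def by (simp add: bounded_bilinear.zero_left[OF bounded_bilinear_matrix_mult])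
    qed
    ultimately show ?thesis unfolding tangent_space_def V by blast
  qed
qed

text \<open>
  Along a curve in the group, the equations between the matrix entries and the equation
  \<open>|\<zeta>\<^sub>1|\<^sup>2 + |\<zeta>\<^sub>2|\<^sup>2 = 1\<close> can be differentiated. The last one says that \<open>cnj \<zeta>\<^sub>1 d\<zeta>\<^sub>1 + cnj \<zeta>\<^sub>2 d\<zeta>\<^sub>2\<close> is imaginary, so
  it equals \<open>i \<sigma>\<^sub>3\<close>; together with \<open>\<sigma>\<^sub>1 + i \<sigma>\<^sub>2\<close> it gives the coordinates in a unitary frame of \<open>\<complex>\<^sup>2\<close>.
\<close>

lemma tangent_space_expand:
  assumes X: "X \<in> SU2" and V: "V \<in> tangent_space SU2 X"
  shows "V = (\<Sum>b\<in>UNIV. sigma X V $ b *\<^sub>R (X ** generator b))"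
proof -
  obtain \<gamma> where \<gamma>: "\<And>t. \<gamma> t \<in> SU2" "\<gamma> 0 = X" "(\<gamma> has_vector_derivative V) (at (0::real))"
    using V unfolding tangent_space_def by blast
  have nth: "((\<lambda>t. \<gamma> t $ i $ j) has_vector_derivative V $ i $ j) (at 0)" for i j
    using bounded_linear.has_vector_derivative[OF bounded_linear_compose[OF bounded_linear_vec_nth bounded_linear_vec_nth] \<gamma>(3)] .
  have entries: "Z $ 1 $ 2 = - cnj (Z $ 2 $ 1)" "Z $ 2 $ 2 = cnj (Z $ 1 $ 1)"
      "Re (cnj (Z $ 1 $ 1) * Z $ 1 $ 1 + cnj (Z $ 2 $ 1) * Z $ 2 $ 1) = 1" if Z: "Z \<in> SU2" for Z
  proof -
    obtain z w where "Z = A_mat z w" "(cmod z)\<^sup>2 + (cmod w)\<^sup>2 = 1" using Z by (rule SU2_cases)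
    then show "Z $ 1 $ 2 = - cnj (Z $ 2 $ 1)" "Z $ 2 $ 2 = cnj (Z $ 1 $ 1)"
      "Re (cnj (Z $ 1 $ 1) * Z $ 1 $ 1 + cnj (Z $ 2 $ 1) * Z $ 2 $ 1) = 1"
      unfolding cmod_power2 by (simp_all add: power2_eq_square)
  qed
  have "((\<lambda>t. - cnj (\<gamma> t $ 2 $ 1)) has_vector_derivative - cnj (V $ 2 $ 1)) (at 0)"
    by (intro has_vector_derivative_minus bounded_linear.has_vector_derivative[OF bounded_linear_cnj] nth)
  then have V12: "V $ 1 $ 2 = - cnj (V $ 2 $ 1)"
    using nth[of 1 2] vector_derivative_unique_at by (simp add: entries[OF \<gamma>(1)])
  have "((\<lambda>t. cnj (\<gamma> t $ 1 $ 1)) has_vector_derivative cnj (V $ 1 $ 1)) (at 0)"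
    by (intro bounded_linear.has_vector_derivative[OF bounded_linear_cnj] nth)
  then have V22: "V $ 2 $ 2 = cnj (V $ 1 $ 1)"
    using nth[of 2 2] vector_derivative_unique_at by (simp add: entries[OF \<gamma>(1)])
  have "((\<lambda>t. Re (cnj (\<gamma> t $ 1 $ 1) * \<gamma> t $ 1 $ 1 + cnj (\<gamma> t $ 2 $ 1) * \<gamma> t $ 2 $ 1)) has_vector_derivative
      Re (cnj (\<gamma> 0 $ 1 $ 1) * V $ 1 $ 1 + cnj (V $ 1 $ 1) * \<gamma> 0 $ 1 $ 1
        + (cnj (\<gamma> 0 $ 2 $ 1) * V $ 2 $ 1 + cnj (V $ 2 $ 1) * \<gamma> 0 $ 2 $ 1))) (at 0)"
    by (intro bounded_linear.has_vector_derivative[OF bounded_linear_Re] has_vector_derivative_add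
        has_vector_derivative_mult bounded_linear.has_vector_derivative[OF bounded_linear_cnj] nth)
  then have "((\<lambda>t. 1) has_vector_derivative
      Re (cnj (X $ 1 $ 1) * V $ 1 $ 1 + cnj (V $ 1 $ 1) * X $ 1 $ 1
        + (cnj (X $ 2 $ 1) * V $ 2 $ 1 + cnj (V $ 2 $ 1) * X $ 2 $ 1))) (at (0::real))"
    by (simp only: entries[OF \<gamma>(1)] \<gamma>(2))
  then have orth: "Re (cnj (X $ 1 $ 1) * V $ 1 $ 1 + cnj (V $ 1 $ 1) * X $ 1 $ 1
        + (cnj (X $ 2 $ 1) * V $ 2 $ 1 + cnj (V $ 2 $ 1) * X $ 2 $ 1)) = 0"
    using vector_derivative_unique_at has_vector_derivative_const by blast
  obtain z w where Xzw: "X = A_mat z w" "(cmod z)\<^sup>2 + (cmod w)\<^sup>2 = 1" using X by (rule SU2_cases)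
  define p q where "p = V $ 1 $ 1" and "q = V $ 2 $ 1"
  have Vpq: "V = A_mat p q" by (simp add: matrix_2_eq_iff V12 V22 p_def q_def)
  have unit: "z * cnj z + w * cnj w = 1"
    using Xzw(2) by (metis complex_norm_square of_real_1 of_real_add)
  have r: "of_real (sigma X V $ 1) + \<i> * of_real (sigma X V $ 2) = \<i> * (w * p - z * q)"
    by (simp add: Xzw Vpq complex_eq_iff)
  have s: "\<i> * of_real (sigma X V $ 3) = cnj z * p + cnj w * q"
    using orth by (simp add: Xzw Vpq complex_eq_iff algebra_simps)
  have "(\<Sum>b\<in>UNIV. sigma X V $ b *\<^sub>R (X ** generator b)) $ 1 $ 1 =
      (\<i> * of_real (sigma X V $ 3)) * z
      - \<i> * cnj w * (of_real (sigma X V $ 1) + \<i> * of_real (sigma X V $ 2))"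
    by (simp add: sum_3 A_mat_mult Xzw(1) complex_eq_iff algebra_simps del: sigma_nth)
  also have "\<dots> = p * (z * cnj z + w * cnj w)"
    unfolding r s by (simp add: algebra_simps)
  finally have p: "(\<Sum>b\<in>UNIV. sigma X V $ b *\<^sub>R (X ** generator b)) $ 1 $ 1 = p"
    by (simp add: unit)
  have "(\<Sum>b\<in>UNIV. sigma X V $ b *\<^sub>R (X ** generator b)) $ 2 $ 1 =
      (\<i> * of_real (sigma X V $ 3)) * w
      + \<i> * cnj z * (of_real (sigma X V $ 1) + \<i> * of_real (sigma X V $ 2))"
    by (simp add: sum_3 A_mat_mult Xzw(1) complex_eq_iff algebra_simps del: sigma_nth)
  also have "\<dots> = q * (z * cnj z + w * cnj w)"
    unfolding r s by (simp add: algebra_simps)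
  finally have q: "(\<Sum>b\<in>UNIV. sigma X V $ b *\<^sub>R (X ** generator b)) $ 2 $ 1 = q"
    by (simp add: unit)
  have "(\<Sum>b\<in>UNIV. sigma X V $ b *\<^sub>R (X ** generator b)) =
      A_mat ((\<Sum>b\<in>UNIV. sigma X V $ b *\<^sub>R (X ** generator b)) $ 1 $ 1)
        ((\<Sum>b\<in>UNIV. sigma X V $ b *\<^sub>R (X ** generator b)) $ 2 $ 1)"
    by (simp add: matrix_2_eq_iff sum_3 Xzw(1) A_mat_mult del: sigma_nth)
  also have "\<dots> = V" by (simp only: p q Vpq[symmetric])
  finally show ?thesis by (rule sym)
qed

lemma generator_in_tangent_space: "X \<in> SU2 \<Longrightarrow> X ** generator b \<in> tangent_space SU2 X"
  using sum_generator_in_tangent_space[of X "\<lambda>a. if a = b then 1 else 0"]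
  by (simp add: if_distrib[of "\<lambda>c. c *\<^sub>R _"] cong: if_cong)

lemma E_field_eq:
  assumes "X \<in> SU2"
  shows "E_field b X = X ** generator b"
  unfolding E_field_def
proof (rule the_equality)
  show "X ** generator b \<in> tangent_space SU2 X \<and>
      (\<forall>a. sigma X (X ** generator b) $ a = (if a = b then 1 else 0))"
    using assms generator_in_tangent_space sigma_generator by blast
  fix V assume V: "V \<in> tangent_space SU2 X \<and> (\<forall>a. sigma X V $ a = (if a = b then 1 else 0))"
  then have "V = (\<Sum>a\<in>UNIV. (if a = b then 1 else 0) *\<^sub>R (X ** generator a))"
    using tangent_space_expand[OF assms, of V] by simp
  then show "V = X ** generator b" by (simp add: if_distrib[of "\<lambda>c. c *\<^sub>R _"] cong: if_cong)
qed

lemma E_field_in_tangent_space: "X \<in> SU2 \<Longrightarrow> E_field b X \<in> tangent_space SU2 X"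
  by (simp add: E_field_eq generator_in_tangent_space)

lemma continuous_on_E_field: "continuous_on SU2 (E_field b)"
  using continuous_on_matrix_mult[OF continuous_on_id continuous_on_const, of SU2 "generator b"]
  by (rule continuous_on_eq) (simp add: E_field_eq)

lemma sigma_E_field: "X \<in> SU2 \<Longrightarrow> sigma X (E_field b X) $ a = (if a = b then 1 else 0)"
  by (simp add: E_field_eq sigma_generator)

lemma subspace_tangent_space_SU2:
  assumes X: "X \<in> SU2"
  shows "subspace (tangent_space SU2 X)"
proof -
  have "tangent_space SU2 X = range (\<lambda>x::real^3. \<Sum>b\<in>UNIV. x $ b *\<^sub>R (X ** generator b))"
    using tangent_space_expand[OF X] sum_generator_in_tangent_space[OF X] by auto
  moreover have "linear (\<lambda>x::real^3. \<Sum>b\<in>UNIV. x $ b *\<^sub>R (X ** generator b))"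
    by (rule linearI) (simp_all add: sum_3 algebra_simps)
  ultimately show ?thesis using linear_subspace_image[of _ UNIV] by simp
qed

section \<open>The invariant volume\<close>

locale SU2_volume =
  fixes \<mu> :: "(complex^2^2) measure"
  assumes volume: "normalized_left_invariant_volume \<mu>"
begin

lemma space_volume [simp]: "space \<mu> = SU2"
  and sets_volume [measurable_cong]: "sets \<mu> = sets (restrict_space borel SU2)"
  and left_invariant_distr: "A \<in> SU2 \<Longrightarrow> distr \<mu> \<mu> (\<lambda>B. A ** B) = \<mu>"
  and emeasure_SU2: "emeasure \<mu> SU2 = 1"
  using volume unfolding normalized_left_invariant_volume_def by auto

lemma measure_SU2 [simp]: "measure \<mu> SU2 = 1"
  by (simp add: measure_def emeasure_SU2)

sublocale finite_measure \<mu>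
  by (rule finite_measureI) (simp add: emeasure_SU2)

lemma average_eq: "average \<mu> f = (\<integral>x. f x \<partial>\<mu>)"
  by (simp add: average_def)

lemma borel_measurable_continuous:
  fixes f :: "complex^2^2 \<Rightarrow> 'b::topological_space"
  shows "continuous_on SU2 f \<Longrightarrow> f \<in> borel_measurable \<mu>"
  by (subst measurable_cong_sets[OF sets_volume refl]) (rule borel_measurable_continuous_on_restrict)

lemma integrable_continuous:
  fixes f :: "complex^2^2 \<Rightarrow> 'b::{banach, second_countable_topology}"
  assumes "continuous_on SU2 f"
  shows "integrable \<mu> f"
proof -
  have "bounded (f ` SU2)"
    using compact_imp_bounded compact_continuous_image compact_SU2 assms by blast
  then obtain B where "\<forall>x\<in>SU2. norm (f x) \<le> B" unfolding bounded_iff by auto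
  then show ?thesis
    by (intro integrable_const_bound[of _ B] borel_measurable_continuous assms AE_I2) simp
qed

lemma integral_left_translate:
  fixes f :: "complex^2^2 \<Rightarrow> real"
  assumes "continuous_on SU2 f" "A \<in> SU2"
  shows "(\<integral>X. f (A ** X) \<partial>\<mu>) = (\<integral>X. f X \<partial>\<mu>)"
proof -
  have "(\<lambda>X. A ** X) \<in> measurable \<mu> \<mu>"
  proof (subst measurable_cong_sets[OF refl sets_volume], rule measurable_restrict_space2)
    show "(\<lambda>X. A ** X) \<in> space \<mu> \<rightarrow> SU2" using SU2_mult assms(2) by auto
    show "(\<lambda>X. A ** X) \<in> borel_measurable \<mu>"
      by (intro borel_measurable_continuous continuous_intros)
  qed
  then have "(\<integral>X. f X \<partial>distr \<mu> \<mu> (\<lambda>B. A ** B)) = (\<integral>X. f (A ** X) \<partial>\<mu>)"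
    by (rule integral_distr) (rule borel_measurable_continuous[OF assms(1)])
  then show ?thesis by (simp add: left_invariant_distr[OF assms(2)])
qed

lemma integral_swap:
  fixes F :: "complex^2^2 \<Rightarrow> complex^2^2 \<Rightarrow> real"
  assumes "continuous_on (SU2 \<times> SU2) (\<lambda>(X, Y). F X Y)"
  shows "(\<integral>X. \<integral>Y. F X Y \<partial>\<mu> \<partial>\<mu>) = (\<integral>Y. \<integral>X. F X Y \<partial>\<mu> \<partial>\<mu>)"
    and "integrable \<mu> (\<lambda>Y. \<integral>X. F X Y \<partial>\<mu>)"
proof -
  interpret pair_sigma_finite \<mu> \<mu> ..
  interpret P: finite_measure "\<mu> \<Otimes>\<^sub>M \<mu>" by (rule finite_measure_pair_measure) unfold_locales
  have sp: "space (\<mu> \<Otimes>\<^sub>M \<mu>) = SU2 \<times> SU2" by (simp add: space_pair_measure)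
  have id: "(\<lambda>x. x) \<in> measurable \<mu> borel" by (rule borel_measurable_continuous) (rule continuous_on_id)
  have "(\<lambda>p. (fst p, snd p)) \<in> measurable (\<mu> \<Otimes>\<^sub>M \<mu>) (borel \<Otimes>\<^sub>M borel)"
    using id by measurable
  then have m: "(\<lambda>p. p) \<in> measurable (\<mu> \<Otimes>\<^sub>M \<mu>) borel" by (simp add: borel_prod)
  have "closed (SU2 \<times> SU2)" using compact_Times[OF compact_SU2 compact_SU2] compact_imp_closed by blast
  then have "(\<lambda>p. indicator (SU2 \<times> SU2) p *\<^sub>R (\<lambda>(X, Y). F X Y) p) \<in> borel_measurable borel"
    using assms by (intro borel_measurable_continuous_on_indicator) auto
  from measurable_compose[OF m this]
  have "(\<lambda>p. indicator (SU2 \<times> SU2) p *\<^sub>R (\<lambda>(X, Y). F X Y) p) \<in> borel_measurable (\<mu> \<Otimes>\<^sub>M \<mu>)" .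
  then have meas: "(\<lambda>(X, Y). F X Y) \<in> borel_measurable (\<mu> \<Otimes>\<^sub>M \<mu>)"
    by (rule measurable_cong[THEN iffD1, rotated]) (simp add: sp)
  have "bounded ((\<lambda>(X, Y). F X Y) ` (SU2 \<times> SU2))"
    using compact_imp_bounded compact_continuous_image compact_Times compact_SU2 assms by blast
  then obtain B where B: "\<forall>p\<in>SU2 \<times> SU2. norm ((\<lambda>(X, Y). F X Y) p) \<le> B"
    unfolding bounded_iff by auto
  have "integrable (\<mu> \<Otimes>\<^sub>M \<mu>) (\<lambda>(X, Y). F X Y)"
    by (intro P.integrable_const_bound[of _ B] meas AE_I2) (use B sp in auto)
  then show "(\<integral>X. \<integral>Y. F X Y \<partial>\<mu> \<partial>\<mu>) = (\<integral>Y. \<integral>X. F X Y \<partial>\<mu> \<partial>\<mu>)"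
    and "integrable \<mu> (\<lambda>Y. \<integral>X. F X Y \<partial>\<mu>)"
    by (rule Fubini_integral[symmetric], rule integrable_snd)
qed

text \<open>
  The double integral of \<open>f (X\<^sup>* Y)\<close> is the integral of \<open>f\<close> if \<open>Y\<close> is integrated first. If \<open>X\<close> is integrated
  first, then writing \<open>X\<^sup>* Y = (Y\<^sup>* X)\<^sup>*\<close> shows that it is the integral of \<open>f\<close> composed with the inversion.
  So left invariance and compactness imply invariance under inversion, hence right invariance.
\<close>

lemma integral_adjoint:
  fixes f :: "complex^2^2 \<Rightarrow> real"
  assumes f: "continuous_on SU2 f"
  shows "(\<integral>X. f (adjoint_mat X) \<partial>\<mu>) = (\<integral>X. f X \<partial>\<mu>)"
proof -
  have "continuous_on (SU2 \<times> SU2) (\<lambda>p. f (adjoint_mat (fst p) ** snd p))"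
    by (rule continuous_on_compose2[OF f]) (auto intro!: continuous_intros SU2_mult adjoint_mat_in_SU2)
  then have "(\<integral>X. \<integral>Y. f (adjoint_mat X ** Y) \<partial>\<mu> \<partial>\<mu>) = (\<integral>Y. \<integral>X. f (adjoint_mat X ** Y) \<partial>\<mu> \<partial>\<mu>)"
    by (intro integral_swap(1)) (simp add: case_prod_unfold)
  moreover have "(\<integral>X. \<integral>Y. f (adjoint_mat X ** Y) \<partial>\<mu> \<partial>\<mu>) = (\<integral>X. \<integral>Y. f Y \<partial>\<mu> \<partial>\<mu>)"
    by (intro Bochner_Integration.integral_cong refl integral_left_translate f adjoint_mat_in_SU2) simp
  moreover have "(\<integral>X. f (adjoint_mat X ** Y) \<partial>\<mu>) = (\<integral>X. f (adjoint_mat X) \<partial>\<mu>)" if Y: "Y \<in> SU2" for Y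
  proof -
    have "(\<integral>X. f (adjoint_mat X ** Y) \<partial>\<mu>) = (\<integral>X. f (adjoint_mat (adjoint_mat Y ** X)) \<partial>\<mu>)"
      using Y by (intro Bochner_Integration.integral_cong) (auto simp: adjoint_mult adjoint_mat_involution adjoint_mat_in_SU2)
    also have "\<dots> = (\<integral>X. f (adjoint_mat X) \<partial>\<mu>)"
      by (rule integral_left_translate[of "\<lambda>X. f (adjoint_mat X)"])
        (auto intro!: continuous_on_compose2[OF f] continuous_intros adjoint_mat_in_SU2 Y)
    finally show ?thesis .
  qed
  then have "(\<integral>Y. \<integral>X. f (adjoint_mat X ** Y) \<partial>\<mu> \<partial>\<mu>) = (\<integral>Y. \<integral>X. f (adjoint_mat X) \<partial>\<mu> \<partial>\<mu>)"
    by (rule Bochner_Integration.integral_cong[OF refl]) simp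
  ultimately show ?thesis by simp
qed

lemma integral_right_translate:
  fixes f :: "complex^2^2 \<Rightarrow> real"
  assumes f: "continuous_on SU2 f" and A: "A \<in> SU2"
  shows "(\<integral>X. f (X ** A) \<partial>\<mu>) = (\<integral>X. f X \<partial>\<mu>)"
proof -
  have "(\<integral>X. f (X ** A) \<partial>\<mu>) = (\<integral>X. f (adjoint_mat X ** A) \<partial>\<mu>)"
    by (rule integral_adjoint[of "\<lambda>X. f (X ** A)", symmetric])
      (auto intro!: continuous_on_compose2[OF f] continuous_intros SU2_mult A)
  also have "\<dots> = (\<integral>X. f (adjoint_mat (adjoint_mat A ** X)) \<partial>\<mu>)"
    using A by (intro Bochner_Integration.integral_cong) (auto simp: adjoint_mult adjoint_mat_involution adjoint_mat_in_SU2)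
  also have "\<dots> = (\<integral>X. f (adjoint_mat X) \<partial>\<mu>)"
    by (rule integral_left_translate[of "\<lambda>X. f (adjoint_mat X)"])
      (auto intro!: continuous_on_compose2[OF f] continuous_intros adjoint_mat_in_SU2 A)
  also have "\<dots> = (\<integral>X. f X \<partial>\<mu>)" by (rule integral_adjoint[OF f])
  finally show ?thesis .
qed

text \<open>
  Integration over the group can be done by averaging along the orbits of a one-parameter group first.
  This turns inequalities on an interval into inequalities on the group, for any length \<open>T\<close> of the interval.
\<close>

lemma integral_one_param_average:
  fixes f :: "complex^2^2 \<Rightarrow> real"
  assumes f: "continuous_on SU2 f" and T: "0 < T"
  shows "(\<integral>X. integral {0..T} (\<lambda>t. f (X ** one_param b t)) \<partial>\<mu>) = T * (\<integral>X. f X \<partial>\<mu>)"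
proof -
  define L where "L = restrict_space lborel {0..T}"
  interpret L: finite_measure L
    unfolding L_def by (rule finite_measureI) (use T in \<open>simp add: emeasure_restrict_space space_restrict_space\<close>)
  interpret pair_sigma_finite \<mu> L ..
  interpret P: finite_measure "\<mu> \<Otimes>\<^sub>M L" by (rule finite_measure_pair_measure) unfold_locales
  let ?F = "\<lambda>p. f (fst p ** one_param b (snd p))"
  have c: "continuous_on (SU2 \<times> {0..T}) ?F"
    by (rule continuous_on_compose2[OF f]) (auto intro!: continuous_intros SU2_mult one_param_in_SU2)
  have sp: "space (\<mu> \<Otimes>\<^sub>M L) = SU2 \<times> {0..T}" by (simp add: space_pair_measure L_def space_restrict_space)
  have id: "(\<lambda>x. x) \<in> measurable \<mu> borel" by (rule borel_measurable_continuous) (rule continuous_on_id)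
  have idL: "(\<lambda>x. x) \<in> measurable L borel" unfolding L_def by (rule measurable_restrict_space1) simp
  have "(\<lambda>p. (fst p, snd p)) \<in> measurable (\<mu> \<Otimes>\<^sub>M L) (borel \<Otimes>\<^sub>M borel)"
    using id idL by measurable
  then have m: "(\<lambda>p. p) \<in> measurable (\<mu> \<Otimes>\<^sub>M L) borel" by (simp add: borel_prod)
  have "closed (SU2 \<times> {0..T})"
    by (intro closed_Times compact_imp_closed[OF compact_SU2]) simp
  then have "(\<lambda>p. indicator (SU2 \<times> {0..T}) p *\<^sub>R ?F p) \<in> borel_measurable borel"
    using c by (intro borel_measurable_continuous_on_indicator) auto
  from measurable_compose[OF m this]
  have "(\<lambda>p. indicator (SU2 \<times> {0..T}) p *\<^sub>R ?F p) \<in> borel_measurable (\<mu> \<Otimes>\<^sub>M L)" .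
  then have meas: "?F \<in> borel_measurable (\<mu> \<Otimes>\<^sub>M L)"
    by (rule measurable_cong[THEN iffD1, rotated]) (simp add: sp)
  have "bounded (f ` SU2)"
    using compact_imp_bounded compact_continuous_image compact_SU2 f by blast
  then obtain B where B: "\<forall>X\<in>SU2. norm (f X) \<le> B" unfolding bounded_iff by auto
  have "integrable (\<mu> \<Otimes>\<^sub>M L) ?F"
    by (intro P.integrable_const_bound[of _ B] meas AE_I2)
      (use B sp SU2_mult one_param_in_SU2 in auto)
  then have fub: "(\<integral>X. \<integral>t. f (X ** one_param b t) \<partial>L \<partial>\<mu>) = (\<integral>t. \<integral>X. f (X ** one_param b t) \<partial>\<mu> \<partial>L)"
    using Fubini_integral[of "\<lambda>X t. f (X ** one_param b t)"] by (simp add: case_prod_unfold)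
  have "(\<integral>t. f (X ** one_param b t) \<partial>L) = integral {0..T} (\<lambda>t. f (X ** one_param b t))" if X: "X \<in> SU2" for X
  proof -
    have "continuous_on {0..T} (\<lambda>t. f (X ** one_param b t))"
      by (rule continuous_on_compose2[OF f]) (auto intro!: continuous_intros SU2_mult one_param_in_SU2 X)
    then have "set_integrable lborel {0..T} (\<lambda>t. f (X ** one_param b t))"
      by (rule borel_integrable_atLeastAtMost')
    from set_borel_integral_eq_integral(2)[OF this] show ?thesis
      by (simp add: L_def integral_restrict_space set_lebesgue_integral_def)
  qed
  then have "(\<integral>X. integral {0..T} (\<lambda>t. f (X ** one_param b t)) \<partial>\<mu>) = (\<integral>X. \<integral>t. f (X ** one_param b t) \<partial>L \<partial>\<mu>)"
    by (intro Bochner_Integration.integral_cong) auto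
  also have "\<dots> = (\<integral>t. (\<integral>X. f X \<partial>\<mu>) \<partial>L)"
    unfolding fub by (intro Bochner_Integration.integral_cong refl integral_right_translate f one_param_in_SU2)
  also have "\<dots> = T * (\<integral>X. f X \<partial>\<mu>)"
    using T by (simp add: L_def integral_restrict_space measure_restrict_space space_restrict_space)
  finally show ?thesis .
qed

text \<open>
  Full support of the volume: if \<open>f\<close> were positive somewhere, then finitely many translates of \<open>f\<close> would
  have a sum that is positive, hence bounded below by a positive constant, on the whole compact group.
\<close>

lemma integral_eq_0_imp_eq_0:
  fixes f :: "complex^2^2 \<Rightarrow> real"
  assumes f: "continuous_on SU2 f" and nonneg: "\<And>X. X \<in> SU2 \<Longrightarrow> 0 \<le> f X"
    and zero: "(\<integral>X. f X \<partial>\<mu>) = 0" and A: "A \<in> SU2"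
  shows "f A = 0"
proof (rule ccontr)
  assume "f A \<noteq> 0"
  then have pos: "0 < f A" using nonneg[OF A] by simp
  define g where "g = (\<lambda>Y X. f (A ** adjoint_mat Y ** X))"
  have cg: "continuous_on SU2 (g Y)" if "Y \<in> SU2" for Y
    unfolding g_def by (rule continuous_on_compose2[OF f]) (auto intro!: continuous_intros SU2_mult adjoint_mat_in_SU2 A that)
  have gnn: "0 \<le> g Y X" if "X \<in> SU2" "Y \<in> SU2" for X Y
    unfolding g_def using that A by (intro nonneg SU2_mult adjoint_mat_in_SU2)
  have gYY: "0 < g Y Y" if "Y \<in> SU2" for Y
    using pos that SU2_mult_adjoint(2)[OF that] by (simp add: g_def matrix_mul_assoc[symmetric])
  have "\<exists>U. open U \<and> SU2 \<inter> g Y -` {0<..} = SU2 \<inter> U" if "Y \<in> SU2" for Y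
    using continuous_openin_preimage_gen[OF cg[OF that] open_greaterThan, of 0]
    unfolding openin_open by blast
  then have "\<forall>Y\<in>SU2. \<exists>U. open U \<and> SU2 \<inter> g Y -` {0<..} = SU2 \<inter> U" by blast
  from bchoice[OF this] obtain U
    where U: "\<forall>Y\<in>SU2. open (U Y) \<and> SU2 \<inter> g Y -` {0<..} = SU2 \<inter> U Y" ..
  have "SU2 \<subseteq> (\<Union>Y\<in>SU2. U Y)"
  proof
    fix Y assume Y: "Y \<in> SU2"
    then have "Y \<in> SU2 \<inter> g Y -` {0<..}" using gYY by simp
    then show "Y \<in> (\<Union>Y\<in>SU2. U Y)" using U Y by blast
  qed
  then obtain D where D: "D \<subseteq> SU2" "finite D" "SU2 \<subseteq> (\<Union>Y\<in>D. U Y)"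
    using compactE_image[OF compact_SU2, of SU2 U] U by metis
  define h where "h = (\<lambda>X. \<Sum>Y\<in>D. g Y X)"
  have ch: "continuous_on SU2 h" unfolding h_def using D by (intro continuous_on_sum cg) auto
  have hpos: "0 < h X" if X: "X \<in> SU2" for X
  proof -
    obtain Y where Y: "Y \<in> D" "X \<in> U Y" using D X by blast
    then have "0 < g Y X" using U D X by blast
    then show ?thesis unfolding h_def using D gnn X by (intro sum_pos2[of D Y]) (auto intro: Y)
  qed
  obtain X0 where X0: "X0 \<in> SU2" "\<And>X. X \<in> SU2 \<Longrightarrow> h X0 \<le> h X"
    using continuous_attains_inf[OF compact_SU2 _ ch] A by blast
  have "(\<integral>X. h X0 \<partial>\<mu>) \<le> (\<integral>X. h X \<partial>\<mu>)"
    by (intro integral_mono integrable_continuous ch continuous_on_const) (use X0 in auto)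
  also have "\<dots> = (\<Sum>Y\<in>D. \<integral>X. g Y X \<partial>\<mu>)"
    unfolding h_def using D by (intro Bochner_Integration.integral_sum integrable_continuous cg) auto
  also have "\<dots> = 0"
    unfolding g_def using D zero A
    by (intro sum.neutral ballI trans[OF integral_left_translate[OF f]] SU2_mult adjoint_mat_in_SU2) auto
  finally show False using hpos[OF X0(1)] by simp
qed

end

section \<open>The spectral gap\<close>

text \<open>
  \<open>u'\<close> is the derivative \<open>E\<^sub>b u\<close>. Stated along the flow lines \<open>X ** one_param b t\<close> of \<open>E\<^sub>b\<close>, the notion
  passes to right translates, and one-dimensional inequalities apply to it.
\<close>

definition flow_C1 :: "3 \<Rightarrow> (complex^2^2 \<Rightarrow> real) \<Rightarrow> (complex^2^2 \<Rightarrow> real) \<Rightarrow> bool" where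
  "flow_C1 b u u' \<longleftrightarrow> continuous_on SU2 u \<and> continuous_on SU2 u' \<and>
     (\<forall>X\<in>SU2. \<forall>t. ((\<lambda>t. u (X ** one_param b t)) has_real_derivative u' (X ** one_param b t)) (at t))"

lemma flow_C1D:
  assumes "flow_C1 b u u'"
  shows "continuous_on SU2 u" "continuous_on SU2 u'"
    "X \<in> SU2 \<Longrightarrow> ((\<lambda>t. u (X ** one_param b t)) has_real_derivative u' (X ** one_param b t)) (at t)"
  using assms unfolding flow_C1_def by auto

lemma flow_C1_combine:
  assumes "flow_C1 b u u'" "flow_C1 b v v'"
  shows "flow_C1 b (\<lambda>X. (u X + c * v X) / 2) (\<lambda>X. (u' X + c * v' X) / 2)"
  using assms unfolding flow_C1_def
  by (auto intro!: continuous_intros derivative_eq_intros)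

lemma continuous_on_right_translate:
  assumes "continuous_on SU2 f" "q \<in> SU2"
  shows "continuous_on SU2 (\<lambda>X. f (X ** q))"
  by (rule continuous_on_compose2[OF assms(1)]) (auto intro!: continuous_intros SU2_mult assms(2))

lemma continuous_on_flow_line:
  assumes "continuous_on SU2 f" "X \<in> SU2"
  shows "continuous_on S (\<lambda>t. f (X ** one_param b t))"
  by (rule continuous_on_compose2[OF assms(1)])
    (auto intro!: continuous_intros SU2_mult one_param_in_SU2 assms(2))

lemma continuous_on_flow_integral:
  fixes f :: "complex^2^2 \<Rightarrow> real"
  assumes "continuous_on SU2 f"
  shows "continuous_on SU2 (\<lambda>X. integral {0..T} (\<lambda>t. f (X ** one_param b t)))"
proof -
  have "continuous_on (SU2 \<times> cbox 0 T) (\<lambda>p. f (fst p ** one_param b (snd p)))"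
    by (rule continuous_on_compose2[OF assms])
      (auto intro!: continuous_intros SU2_mult one_param_in_SU2)
  then have "continuous_on SU2 (\<lambda>X. integral (cbox 0 T) (\<lambda>t. f (X ** one_param b t)))"
    by (intro integral_continuous_on_param) (simp add: case_prod_unfold)
  then show ?thesis by simp
qed

lemma flow_C1_right_translate:
  assumes u: "flow_C1 b u u'" and q: "q \<in> SU2"
    and comm: "\<And>t. one_param b t ** q = q ** one_param b (s * t)"
  shows "flow_C1 b (\<lambda>X. u (X ** q)) (\<lambda>X. s * u' (X ** q))"
  unfolding flow_C1_def
proof (intro conjI ballI allI)
  show "continuous_on SU2 (\<lambda>X. u (X ** q))" "continuous_on SU2 (\<lambda>X. s * u' (X ** q))"
    using flow_C1D[OF u] q by (auto intro!: continuous_intros continuous_on_right_translate)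
  fix X t assume X: "X \<in> SU2"
  have eq: "X ** one_param b t ** q = X ** q ** one_param b (s * t)" for t
    by (metis comm matrix_mul_assoc)
  have "((\<lambda>t. u (X ** q ** one_param b (s * t))) has_real_derivative u' (X ** q ** one_param b (s * t)) * s) (at t)"
    by (rule DERIV_chain2[OF flow_C1D(3)[OF u SU2_mult[OF X q]]]) (auto intro!: derivative_eq_intros)
  then show "((\<lambda>t. u (X ** one_param b t ** q)) has_real_derivative s * u' (X ** one_param b t ** q)) (at t)"
    by (simp add: eq mult.commute)
qed

lemma one_param_pi: "one_param b pi = - mat 1"
  by (simp add: one_param_def)

lemma one_param_pi_half: "one_param b (pi / 2) = generator b"
  by (simp add: one_param_def)

lemma generator_in_SU2: "generator b \<in> SU2"
  using one_param_in_SU2[of b "pi / 2"] by (simp add: one_param_pi_half)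

lemma minus_mat_1_in_SU2: "- mat 1 \<in> SU2"
  using one_param_in_SU2[of 1 pi] by (simp add: one_param_pi)

lemma uminus_A_mat: "- A_mat z w = A_mat (- z) (- w)"
  by (simp add: matrix_2_eq_iff)

lemma mult_minus_mat_1: "X ** (- mat 1) = - X" "(- mat 1) ** X = - X" for X :: "complex^2^2"
  by (simp_all add: bounded_bilinear.minus_right[OF bounded_bilinear_matrix_mult]
      bounded_bilinear.minus_left[OF bounded_bilinear_matrix_mult])

lemma minus_mult_generator: "(- X) ** generator b = - (X ** generator b)" for X :: "complex^2^2"
  by (simp add: bounded_bilinear.minus_left[OF bounded_bilinear_matrix_mult])

lemma mult_generator_generator: "X ** generator b ** generator b = - X" for X :: "complex^2^2"
proof -
  have "generator b ** generator b = - mat 1"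
    using one_param_add[of b "pi/2" "pi/2"] by (simp add: one_param_pi_half one_param_pi)
  then show ?thesis by (simp add: matrix_mul_assoc[symmetric] mult_minus_mat_1)
qed

lemma mult_generator_2_3: "X ** generator 2 ** generator 3 = - (X ** generator 3 ** generator 2)"
  for X :: "complex^2^2"
proof -
  have "generator 2 ** generator 3 = - (generator 3 ** generator 2)"
    by (simp add: A_mat_mult uminus_A_mat)
  then show ?thesis
    by (simp only: matrix_mul_assoc[symmetric] bounded_bilinear.minus_right[OF bounded_bilinear_matrix_mult])
qed

lemma one_param_mult_generator:
  "one_param 2 t ** generator 2 = generator 2 ** one_param 2 (1 * t)"
  "one_param 3 t ** generator 2 = generator 2 ** one_param 3 ((-1) * t)"
  "one_param 2 t ** generator 3 = generator 3 ** one_param 2 ((-1) * t)"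
  "one_param 3 t ** generator 3 = generator 3 ** one_param 3 (1 * t)"
  by (simp_all add: one_param_A_mat A_mat_mult cis_cnj)

lemma one_param_mult_minus_mat_1: "one_param b t ** (- mat 1) = (- mat 1) ** one_param b (1 * t)"
  by (simp add: mult_minus_mat_1)

context SU2_volume
begin

lemma integral_flow_le:
  fixes f g :: "complex^2^2 \<Rightarrow> real"
  assumes f: "continuous_on SU2 f" and g: "continuous_on SU2 g" and T: "0 < T"
    and le: "\<And>X. X \<in> SU2 \<Longrightarrow> c * integral {0..T} (\<lambda>t. f (X ** one_param b t))
        \<le> integral {0..T} (\<lambda>t. g (X ** one_param b t))"
  shows "c * (\<integral>X. f X \<partial>\<mu>) \<le> (\<integral>X. g X \<partial>\<mu>)"
proof -
  have "(\<integral>X. c * integral {0..T} (\<lambda>t. f (X ** one_param b t)) \<partial>\<mu>)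
      \<le> (\<integral>X. integral {0..T} (\<lambda>t. g (X ** one_param b t)) \<partial>\<mu>)"
    by (intro integral_mono integrable_continuous continuous_intros continuous_on_flow_integral f g)
      (use le in auto)
  then have "T * (c * (\<integral>X. f X \<partial>\<mu>)) \<le> T * (\<integral>X. g X \<partial>\<mu>)"
    using integral_one_param_average[OF f T, of b] integral_one_param_average[OF g T, of b]
    by (simp add: mult.left_commute)
  then show ?thesis using T by simp
qed

lemma flow_wirtinger_antiperiodic:
  assumes u: "flow_C1 b u u'" and T: "0 < T"
    and anti: "\<And>X. X \<in> SU2 \<Longrightarrow> u (X ** one_param b T) = - u X"
  shows "(pi / T)\<^sup>2 * (\<integral>X. (u X)\<^sup>2 \<partial>\<mu>) \<le> (\<integral>X. (u' X)\<^sup>2 \<partial>\<mu>)"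
proof (rule integral_flow_le[OF _ _ T, of _ _ _ b])
  fix X assume X: "X \<in> SU2"
  show "(pi / T)\<^sup>2 * integral {0..T} (\<lambda>t. (u (X ** one_param b t))\<^sup>2)
      \<le> integral {0..T} (\<lambda>t. (u' (X ** one_param b t))\<^sup>2)"
  proof (rule wirtinger_antiperiodic[OF T flow_C1D(3)[OF u X]])
    show "continuous_on UNIV (\<lambda>t. u' (X ** one_param b t))"
      by (rule continuous_on_flow_line[OF flow_C1D(2)[OF u] X])
    show "u (X ** one_param b (t + T)) = - u (X ** one_param b t)" for t
      using anti[OF SU2_mult[OF X one_param_in_SU2[of b t]]]
      by (simp add: matrix_mul_assoc[symmetric] one_param_add)
  qed
qed (auto intro!: continuous_intros flow_C1D[OF u])

lemma flow_shift_le: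
  assumes u: "flow_C1 b u u'" and T: "0 < T"
    and per: "\<And>X. X \<in> SU2 \<Longrightarrow> u (X ** one_param b T) = u X"
  shows "(pi / T)\<^sup>2 * (\<integral>X. (u X - u (X ** one_param b s))\<^sup>2 \<partial>\<mu>) \<le> (\<integral>X. (u' X)\<^sup>2 \<partial>\<mu>)"
proof (rule integral_flow_le[OF _ _ T, of _ _ _ b])
  fix X assume X: "X \<in> SU2"
  have "(pi / T)\<^sup>2 * integral {0..T} (\<lambda>t. (u (X ** one_param b t) - u (X ** one_param b (t + s)))\<^sup>2)
      \<le> integral {0..T} (\<lambda>t. (u' (X ** one_param b t))\<^sup>2)"
  proof (rule integral_power2_diff_shift_le[OF T flow_C1D(3)[OF u X]])
    show "continuous_on UNIV (\<lambda>t. u' (X ** one_param b t))"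
      by (rule continuous_on_flow_line[OF flow_C1D(2)[OF u] X])
    show "u (X ** one_param b (t + T)) = u (X ** one_param b t)" for t
      using per[OF SU2_mult[OF X one_param_in_SU2[of b t]]]
      by (simp add: matrix_mul_assoc[symmetric] one_param_add)
  qed
  then show "(pi / T)\<^sup>2 * integral {0..T} (\<lambda>t. (u (X ** one_param b t) - u (X ** one_param b t ** one_param b s))\<^sup>2)
      \<le> integral {0..T} (\<lambda>t. (u' (X ** one_param b t))\<^sup>2)"
    by (simp add: matrix_mul_assoc[symmetric] one_param_add)
qed (auto intro!: continuous_intros continuous_on_right_translate one_param_in_SU2 flow_C1D[OF u])

text \<open>
  The average \<open>f\<close> of \<open>u\<close> along the orbits is the orthogonal projection to the invariant functions, since
  \<open>u - f\<close> has mean zero on each orbit while \<open>f\<close> is constant there.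
\<close>

lemma flow_mean:
  assumes u: "flow_C1 b u u'" and T: "0 < T"
    and per: "\<And>X. X \<in> SU2 \<Longrightarrow> u (X ** one_param b T) = u X"
    and f_def: "f = (\<lambda>X. integral {0..T} (\<lambda>t. u (X ** one_param b t)) / T)"
  shows "continuous_on SU2 f"
    and "\<And>X s. X \<in> SU2 \<Longrightarrow> f (X ** one_param b s) = f X"
    and "(\<integral>X. f X \<partial>\<mu>) = (\<integral>X. u X \<partial>\<mu>)"
    and "(2 * pi / T)\<^sup>2 * (\<integral>X. (u X - f X)\<^sup>2 \<partial>\<mu>) \<le> (\<integral>X. (u' X)\<^sup>2 \<partial>\<mu>)"
    and "(\<integral>X. (u X)\<^sup>2 \<partial>\<mu>) = (\<integral>X. (f X)\<^sup>2 \<partial>\<mu>) + (\<integral>X. (u X - f X)\<^sup>2 \<partial>\<mu>)"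
proof -
  note cu = flow_C1D(1)[OF u]
  show cf: "continuous_on SU2 f"
    unfolding f_def using T by (intro continuous_intros continuous_on_flow_integral cu) auto
  have per': "u (X ** one_param b (t + T)) = u (X ** one_param b t)" if "X \<in> SU2" for X t
    using per[OF SU2_mult[OF that one_param_in_SU2[of b t]]]
    by (simp add: matrix_mul_assoc[symmetric] one_param_add)
  show finv: "f (X ** one_param b s) = f X" if X: "X \<in> SU2" for X s
  proof -
    let ?v = "\<lambda>t. u (X ** one_param b t)"
    have "integral {0..T} (\<lambda>t. u (X ** one_param b s ** one_param b t)) = integral {0..T} (?v \<circ> (\<lambda>t. t + s))"
      by (simp add: o_def matrix_mul_assoc[symmetric] one_param_add add.commute)
    also have "\<dots> = integral {0 + s..T + s} ?v"
      by (rule integral_shift) (rule continuous_on_flow_line[OF cu X])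
    also have "\<dots> = integral {0..T} ?v"
      using integral_shift_period[OF T continuous_on_flow_line[OF cu X] per'[OF X], where s = s]
      by (simp add: add.commute)
    finally show ?thesis by (simp add: f_def)
  qed
  show "(\<integral>X. f X \<partial>\<mu>) = (\<integral>X. u X \<partial>\<mu>)"
    using integral_one_param_average[OF cu T, of b] T by (simp add: f_def)
  show "(2 * pi / T)\<^sup>2 * (\<integral>X. (u X - f X)\<^sup>2 \<partial>\<mu>) \<le> (\<integral>X. (u' X)\<^sup>2 \<partial>\<mu>)"
  proof (rule integral_flow_le[OF _ _ T, of _ _ _ b])
    fix X assume X: "X \<in> SU2"
    let ?v = "\<lambda>t. u (X ** one_param b t)"
    obtain c where c: "(2 * pi / T)\<^sup>2 * integral {0..T} (\<lambda>t. (?v t - c)\<^sup>2)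
        \<le> integral {0..T} (\<lambda>t. (u' (X ** one_param b t))\<^sup>2)"
      using wirtinger_periodic[OF T flow_C1D(3)[OF u X] continuous_on_flow_line[OF flow_C1D(2)[OF u] X] per'[OF X]]
      by blast
    have "integral {0..T} (\<lambda>t. (?v t - f (X ** one_param b t))\<^sup>2)
        = integral {0..T} (\<lambda>t. (?v t - integral {0..T} ?v / T)\<^sup>2)"
      by (simp only: finv[OF X]) (simp only: f_def)
    also have "\<dots> \<le> integral {0..T} (\<lambda>t. (?v t - c)\<^sup>2)"
      by (rule integral_power2_diff_mean_le[OF T continuous_on_flow_line[OF cu X]])
    finally have "(2 * pi / T)\<^sup>2 * integral {0..T} (\<lambda>t. (?v t - f (X ** one_param b t))\<^sup>2)
        \<le> (2 * pi / T)\<^sup>2 * integral {0..T} (\<lambda>t. (?v t - c)\<^sup>2)"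
      by (rule mult_left_mono) simp
    with c show "(2 * pi / T)\<^sup>2 * integral {0..T} (\<lambda>t. (?v t - f (X ** one_param b t))\<^sup>2)
        \<le> integral {0..T} (\<lambda>t. (u' (X ** one_param b t))\<^sup>2)" by linarith
  qed (auto intro!: continuous_intros cf flow_C1D[OF u])
  have "(\<integral>X. f X * (u X - f X) \<partial>\<mu>) = 0"
  proof -
    have "integral {0..T} (\<lambda>t. f (X ** one_param b t) * (u (X ** one_param b t) - f (X ** one_param b t))) = 0"
      if X: "X \<in> SU2" for X
    proof -
      have i: "(\<lambda>t. u (X ** one_param b t)) integrable_on {0..T}"
        by (intro integrable_continuous_interval continuous_on_flow_line cu X)
      have "integral {0..T} (\<lambda>t. f X * (u (X ** one_param b t) - f X)) =
          f X * (integral {0..T} (\<lambda>t. u (X ** one_param b t)) - T * f X)"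
        using T Henstock_Kurzweil_Integration.integral_diff[OF i integrable_const_ivl[of "f X" 0 T]] by simp
      also have "\<dots> = 0" using T by (simp add: f_def)
      finally show ?thesis by (simp add: finv[OF X])
    qed
    then have "(\<integral>X. integral {0..T} (\<lambda>t. f (X ** one_param b t) * (u (X ** one_param b t) - f (X ** one_param b t))) \<partial>\<mu>) = 0"
      by (intro integral_eq_zero_AE AE_I2) simp
    moreover have "continuous_on SU2 (\<lambda>X. f X * (u X - f X))" by (intro continuous_intros cf cu)
    ultimately show ?thesis using integral_one_param_average[of "\<lambda>X. f X * (u X - f X)" T b] T by simp
  qed
  moreover have "(\<integral>X. (u X)\<^sup>2 \<partial>\<mu>) = (\<integral>X. (f X)\<^sup>2 + 2 * (f X * (u X - f X)) + (u X - f X)\<^sup>2 \<partial>\<mu>)"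
    by (intro Bochner_Integration.integral_cong) (auto simp: power2_eq_square algebra_simps)
  moreover have "\<dots> = (\<integral>X. (f X)\<^sup>2 \<partial>\<mu>) + 2 * (\<integral>X. f X * (u X - f X) \<partial>\<mu>) + (\<integral>X. (u X - f X)\<^sup>2 \<partial>\<mu>)"
  proof -
    have "integrable \<mu> (\<lambda>X. (f X)\<^sup>2)" "integrable \<mu> (\<lambda>X. f X * (u X - f X))" "integrable \<mu> (\<lambda>X. (u X - f X)\<^sup>2)"
      by (intro integrable_continuous continuous_intros cf cu)+
    then show ?thesis by simp
  qed
  ultimately show "(\<integral>X. (u X)\<^sup>2 \<partial>\<mu>) = (\<integral>X. (f X)\<^sup>2 \<partial>\<mu>) + (\<integral>X. (u X - f X)\<^sup>2 \<partial>\<mu>)" by simp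
qed

text \<open>
  Consider the correlation of \<open>f\<close> with its right translate by \<open>g = exp(\<alpha> e\<^sub>3) exp(\<beta> e\<^sub>2) exp(\<gamma> e\<^sub>3)\<close>. By the
  invariance of \<open>f\<close> and of the volume, \<open>\<alpha>\<close> and \<open>\<gamma>\<close> drop out, so the correlation is \<open>\<integral>f\<^sup>2\<close> minus half of
  \<open>\<integral>(f X - f (X exp(\<beta> e\<^sub>2)))\<^sup>2\<close>, hence at least \<open>\<integral>f\<^sup>2 - K/2\<close>. The average over \<open>g\<close> is zero because \<open>f\<close> has mean zero.
\<close>

lemma invariant_correlation:
  fixes K :: real
  assumes f: "continuous_on SU2 f" and inv: "\<And>X t. X \<in> SU2 \<Longrightarrow> f (X ** one_param 3 t) = f X"
    and mean: "(\<integral>X. f X \<partial>\<mu>) = 0"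
    and bound: "\<And>s. (\<integral>X. (f X - f (X ** one_param 2 s))\<^sup>2 \<partial>\<mu>) \<le> K"
  shows "2 * (\<integral>X. (f X)\<^sup>2 \<partial>\<mu>) \<le> K"
proof -
  define N where "N = (\<integral>X. (f X)\<^sup>2 \<partial>\<mu>)"
  have pointwise: "N - K / 2 \<le> (\<integral>X. f X * f (X ** g) \<partial>\<mu>)" if g: "g \<in> SU2" for g
  proof -
    obtain \<alpha> \<beta> \<gamma> where e: "g = one_param 3 \<alpha> ** one_param 2 \<beta> ** one_param 3 \<gamma>"
      using Euler_decomposition[OF g] .
    let ?b = "one_param 2 \<beta>"
    have cb: "continuous_on SU2 (\<lambda>X. f (X ** ?b))"
      by (intro continuous_on_right_translate f one_param_in_SU2)
    let ?h = "\<lambda>X. f X * f (X ** one_param 3 \<alpha> ** ?b)"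
    have "f (X ** one_param 3 \<alpha> ** ?b ** one_param 3 \<gamma>) = f (X ** one_param 3 \<alpha> ** ?b)" if "X \<in> SU2" for X
      by (intro inv SU2_mult one_param_in_SU2 that)
    then have "(\<integral>X. f X * f (X ** g) \<partial>\<mu>) = (\<integral>X. ?h X \<partial>\<mu>)"
      unfolding e by (intro Bochner_Integration.integral_cong) (auto simp: matrix_mul_assoc)
    also have "\<dots> = (\<integral>X. ?h (X ** one_param 3 (- \<alpha>)) \<partial>\<mu>)"
      by (rule integral_right_translate[symmetric])
        (auto intro!: continuous_intros f continuous_on_compose2[OF f] SU2_mult one_param_in_SU2)
    also have "\<dots> = (\<integral>X. f X * f (X ** ?b) \<partial>\<mu>)"
    proof (rule Bochner_Integration.integral_cong[OF refl])
      fix X assume "X \<in> space \<mu>"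
      moreover have "X ** one_param 3 (- \<alpha>) ** one_param 3 \<alpha> = X"
        by (simp add: matrix_mul_assoc[symmetric] one_param_add)
      ultimately show "?h (X ** one_param 3 (- \<alpha>)) = f X * f (X ** ?b)" by (simp add: inv)
    qed
    finally have eq: "(\<integral>X. f X * f (X ** g) \<partial>\<mu>) = (\<integral>X. f X * f (X ** ?b) \<partial>\<mu>)" .
    have "(\<integral>X. (f X - f (X ** ?b))\<^sup>2 \<partial>\<mu>) = (\<integral>X. (f X)\<^sup>2 - 2 * (f X * f (X ** ?b)) + (f (X ** ?b))\<^sup>2 \<partial>\<mu>)"
      by (intro Bochner_Integration.integral_cong) (auto simp: power2_eq_square algebra_simps)
    also have "\<dots> = N - 2 * (\<integral>X. f X * f (X ** ?b) \<partial>\<mu>) + (\<integral>X. (f (X ** ?b))\<^sup>2 \<partial>\<mu>)"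
    proof -
      have "integrable \<mu> (\<lambda>X. (f X)\<^sup>2)" "integrable \<mu> (\<lambda>X. f X * f (X ** ?b))" "integrable \<mu> (\<lambda>X. (f (X ** ?b))\<^sup>2)"
        by (intro integrable_continuous continuous_intros f cb)+
      then show ?thesis by (simp add: N_def)
    qed
    also have "(\<integral>X. (f (X ** ?b))\<^sup>2 \<partial>\<mu>) = N"
      unfolding N_def by (rule integral_right_translate[of "\<lambda>X. (f X)\<^sup>2"])
        (auto intro!: continuous_intros f one_param_in_SU2)
    finally show ?thesis using bound[of \<beta>] unfolding eq by simp
  qed
  have "continuous_on (SU2 \<times> SU2) (\<lambda>p. f (fst p) * f (fst p ** snd p))"
    by (intro continuous_intros continuous_on_compose2[OF f]) (auto intro!: continuous_intros SU2_mult)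
  then have c: "continuous_on (SU2 \<times> SU2) (\<lambda>(X, g). f X * f (X ** g))" by (simp add: case_prod_unfold)
  have "(\<integral>g. N - K / 2 \<partial>\<mu>) \<le> (\<integral>g. \<integral>X. f X * f (X ** g) \<partial>\<mu> \<partial>\<mu>)"
    by (intro integral_mono integral_swap(2)[OF c] integrable_continuous continuous_on_const)
      (use pointwise in auto)
  also have "\<dots> = (\<integral>X. \<integral>g. f X * f (X ** g) \<partial>\<mu> \<partial>\<mu>)" by (rule integral_swap(1)[OF c, symmetric])
  also have "\<dots> = 0"
    by (rule integral_eq_zero_AE, rule AE_I2) (simp add: integral_left_translate[OF f] mean)
  finally show ?thesis by (simp add: N_def)
qed

abbreviation gap_holds :: "(complex^2^2 \<Rightarrow> real) \<Rightarrow> (complex^2^2 \<Rightarrow> real) \<Rightarrow> (complex^2^2 \<Rightarrow> real) \<Rightarrow> bool" where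
  "gap_holds u u2 u3 \<equiv>
    4 * (\<integral>X. (u X)\<^sup>2 \<partial>\<mu>) \<le> (\<integral>X. (u2 X)\<^sup>2 \<partial>\<mu>) + 3 * (\<integral>X. (u3 X)\<^sup>2 \<partial>\<mu>)"

text \<open>
  Invariance under \<open>e\<^sub>b = exp((\<pi>/2) e\<^sub>b)\<close> means period \<open>\<pi>/2\<close> along the flow lines. With \<open>f\<close> the average of \<open>w\<close> along
  \<open>E\<^sub>3\<close> and \<open>B = \<integral>(w - f)\<^sup>2\<close>, the circle inequalities give \<open>16 B \<le> \<integral>(E\<^sub>3 w)\<^sup>2\<close> and
  \<open>4 \<integral>(w - w\<^sub>s)\<^sup>2 \<le> \<integral>(E\<^sub>2 w)\<^sup>2\<close> for all translates \<open>w\<^sub>s\<close> along \<open>E\<^sub>2\<close>. As \<open>\<integral>(f - f\<^sub>s)\<^sup>2 \<le> 2 \<integral>(w - w\<^sub>s)\<^sup>2 + 8 B\<close>,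
  \<open>invariant_correlation\<close> yields \<open>\<integral>(E\<^sub>2 w)\<^sup>2 \<ge> 4 \<integral>f\<^sup>2 - 16 B\<close>, and the loss is covered by \<open>3 \<integral>(E\<^sub>3 w)\<^sup>2 \<ge> 48 B\<close>.
\<close>

lemma gap_invariant:
  assumes w2: "flow_C1 2 w w2" and w3: "flow_C1 3 w w3"
    and inv2: "\<And>X. X \<in> SU2 \<Longrightarrow> w (X ** generator 2) = w X"
    and inv3: "\<And>X. X \<in> SU2 \<Longrightarrow> w (X ** generator 3) = w X"
    and mean: "(\<integral>X. w X \<partial>\<mu>) = 0"
  shows "gap_holds w w2 w3"
proof -
  have T: "0 < pi / 2" by simp
  define f where "f = (\<lambda>X. integral {0..pi/2} (\<lambda>t. w (X ** one_param 3 t)) / (pi / 2))"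
  note cw = flow_C1D(1)[OF w2]
  have per: "w (X ** one_param 3 (pi/2)) = w X" "w (X ** one_param 2 (pi/2)) = w X" if "X \<in> SU2" for X
    using inv2 inv3 that by (simp_all add: one_param_pi_half del: generator_simps)
  note fm = flow_mean[OF w3 T per(1) f_def]
  have cf: "continuous_on SU2 f" and finv: "\<And>X s. X \<in> SU2 \<Longrightarrow> f (X ** one_param 3 s) = f X"
    using fm(1,2) by auto
  have fmean: "(\<integral>X. f X \<partial>\<mu>) = 0" using fm(3) mean by simp
  define B where "B = (\<integral>X. (w X - f X)\<^sup>2 \<partial>\<mu>)"
  have B: "16 * B \<le> (\<integral>X. (w3 X)\<^sup>2 \<partial>\<mu>)"
    using fm(4) by (simp add: B_def power2_eq_square)
  have B0: "0 \<le> B" unfolding B_def by simp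
  have split: "(\<integral>X. (w X)\<^sup>2 \<partial>\<mu>) = (\<integral>X. (f X)\<^sup>2 \<partial>\<mu>) + B" using fm(5) by (simp add: B_def)
  have "(\<integral>X. (f X - f (X ** one_param 2 s))\<^sup>2 \<partial>\<mu>) \<le> (\<integral>X. (w2 X)\<^sup>2 \<partial>\<mu>) / 2 + 8 * B" for s
  proof -
    let ?s = "one_param 2 s"
    have cs: "continuous_on SU2 (\<lambda>X. w (X ** ?s))" "continuous_on SU2 (\<lambda>X. f (X ** ?s))"
      by (intro continuous_on_right_translate cw cf one_param_in_SU2)+
    have "(\<integral>X. (f X - f (X ** ?s))\<^sup>2 \<partial>\<mu>) \<le>
        (\<integral>X. 2 * (w X - w (X ** ?s))\<^sup>2 + 4 * (w X - f X)\<^sup>2 + 4 * (w (X ** ?s) - f (X ** ?s))\<^sup>2 \<partial>\<mu>)"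
    proof (intro integral_mono integrable_continuous continuous_intros cw cf cs)
      fix X
      define x y z where "x = w X - w (X ** ?s)" and "y = w X - f X" and "z = w (X ** ?s) - f (X ** ?s)"
      have e: "f X - f (X ** ?s) = x - y + z" by (simp add: x_def y_def z_def)
      have "(x - y + z)\<^sup>2 = 2 * x\<^sup>2 + 4 * y\<^sup>2 + 4 * z\<^sup>2 - (x + y - z)\<^sup>2 - 2 * (y + z)\<^sup>2"
        by (simp add: power2_eq_square algebra_simps)
      then have "(f X - f (X ** ?s))\<^sup>2 \<le> 2 * x\<^sup>2 + 4 * y\<^sup>2 + 4 * z\<^sup>2"
        using zero_le_power2[of "x + y - z"] zero_le_power2[of "y + z"] unfolding e by linarith
      then show "(f X - f (X ** ?s))\<^sup>2 \<le> 2 * (w X - w (X ** ?s))\<^sup>2 + 4 * (w X - f X)\<^sup>2 + 4 * (w (X ** ?s) - f (X ** ?s))\<^sup>2"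
        by (simp only: x_def y_def z_def)
    qed
    also have "\<dots> = 2 * (\<integral>X. (w X - w (X ** ?s))\<^sup>2 \<partial>\<mu>) + 4 * B + 4 * (\<integral>X. (w (X ** ?s) - f (X ** ?s))\<^sup>2 \<partial>\<mu>)"
    proof -
      have "integrable \<mu> (\<lambda>X. (w X - w (X ** ?s))\<^sup>2)" "integrable \<mu> (\<lambda>X. (w X - f X)\<^sup>2)"
          "integrable \<mu> (\<lambda>X. (w (X ** ?s) - f (X ** ?s))\<^sup>2)"
        by (intro integrable_continuous continuous_intros cw cf cs)+
      then show ?thesis by (simp add: B_def)
    qed
    also have "(\<integral>X. (w (X ** ?s) - f (X ** ?s))\<^sup>2 \<partial>\<mu>) = B"
      unfolding B_def by (rule integral_right_translate[of "\<lambda>X. (w X - f X)\<^sup>2"])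
        (auto intro!: continuous_intros cw cf one_param_in_SU2)
    finally show ?thesis
      using flow_shift_le[OF w2 T per(2), of s] by (simp add: power2_eq_square)
  qed
  from invariant_correlation[OF cf finv fmean this] split B B0 show ?thesis by simp
qed

lemma parallelogram_integral:
  fixes u v :: "complex^2^2 \<Rightarrow> real"
  assumes "continuous_on SU2 u" "continuous_on SU2 v" "(\<integral>X. (v X)\<^sup>2 \<partial>\<mu>) = (\<integral>X. (u X)\<^sup>2 \<partial>\<mu>)"
  shows "(\<integral>X. ((u X + 1 * v X) / 2)\<^sup>2 \<partial>\<mu>) + (\<integral>X. ((u X + (-1) * v X) / 2)\<^sup>2 \<partial>\<mu>) = (\<integral>X. (u X)\<^sup>2 \<partial>\<mu>)"
proof -
  have "(\<integral>X. ((u X + 1 * v X) / 2)\<^sup>2 \<partial>\<mu>) + (\<integral>X. ((u X + (-1) * v X) / 2)\<^sup>2 \<partial>\<mu>)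
      = (\<integral>X. ((u X + 1 * v X) / 2)\<^sup>2 + ((u X + (-1) * v X) / 2)\<^sup>2 \<partial>\<mu>)"
    by (intro Bochner_Integration.integral_add[symmetric] integrable_continuous continuous_intros assms) auto
  also have "\<dots> = (\<integral>X. (u X)\<^sup>2 / 2 + (v X)\<^sup>2 / 2 \<partial>\<mu>)"
    by (intro Bochner_Integration.integral_cong) (auto simp: power2_eq_square field_simps)
  also have "\<dots> = (\<integral>X. (u X)\<^sup>2 / 2 \<partial>\<mu>) + (\<integral>X. (v X)\<^sup>2 / 2 \<partial>\<mu>)"
    by (intro Bochner_Integration.integral_add integrable_continuous continuous_intros assms) auto
  finally show ?thesis using assms(3) by simp
qed

text \<open>
  If \<open>q\<close> normalizes both circle subgroups, then translation by \<open>q\<close> preserves the two quadratic forms in the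
  claim. By the parallelogram identity it suffices to treat the symmetric and the antisymmetric part of
  \<open>u\<close> separately.
\<close>

lemma gap_split:
  assumes u2: "flow_C1 2 u u2" and u3: "flow_C1 3 u u3" and q: "q \<in> SU2"
    and comm2: "\<And>t. one_param 2 t ** q = q ** one_param 2 (s2 * t)"
    and comm3: "\<And>t. one_param 3 t ** q = q ** one_param 3 (s3 * t)"
    and s: "s2\<^sup>2 = 1" "s3\<^sup>2 = 1"
    and sym: "\<And>v v2 v3. v = (\<lambda>X. (u X + 1 * u (X ** q)) / 2) \<Longrightarrow> flow_C1 2 v v2 \<Longrightarrow> flow_C1 3 v v3 \<Longrightarrow>
        (\<integral>X. v X \<partial>\<mu>) = (\<integral>X. u X \<partial>\<mu>) \<Longrightarrow>
        gap_holds v v2 v3"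
    and anti: "\<And>v v2 v3. v = (\<lambda>X. (u X + (-1) * u (X ** q)) / 2) \<Longrightarrow> flow_C1 2 v v2 \<Longrightarrow> flow_C1 3 v v3 \<Longrightarrow>
        gap_holds v v2 v3"
  shows "gap_holds u u2 u3"
proof -
  note c = flow_C1D(1)[OF u2] flow_C1D(2)[OF u2] flow_C1D(2)[OF u3]
  note cq = c[THEN continuous_on_right_translate, OF q]
  have tr: "(\<integral>X. (f (X ** q))\<^sup>2 \<partial>\<mu>) = (\<integral>X. (f X)\<^sup>2 \<partial>\<mu>)" if "continuous_on SU2 f" for f :: "_ \<Rightarrow> real"
    by (rule integral_right_translate[of "\<lambda>X. (f X)\<^sup>2"]) (auto intro!: continuous_intros that q)
  note f2 = flow_C1_combine[OF u2 flow_C1_right_translate[OF u2 q comm2]]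
  note f3 = flow_C1_combine[OF u3 flow_C1_right_translate[OF u3 q comm3]]
  have "(\<integral>X. (u X + 1 * u (X ** q)) / 2 \<partial>\<mu>) = (\<integral>X. u X \<partial>\<mu>)"
    using integral_right_translate[OF c(1) q] integrable_continuous[OF c(1)] integrable_continuous[OF cq(1)]
    by (simp add: add_divide_distrib)
  from sym[OF refl f2 f3 this] anti[OF refl f2 f3]
    parallelogram_integral[OF c(1) cq(1) tr[OF c(1)]]
    parallelogram_integral[OF c(2), of "\<lambda>X. s2 * u2 (X ** q)"]
    parallelogram_integral[OF c(3), of "\<lambda>X. s3 * u3 (X ** q)"]
  show ?thesis
    using tr[OF c(2)] tr[OF c(3)] s by (simp add: power_mult_distrib cq continuous_on_mult_left)
qed

text \<open>
  Splitting with \<open>q = e\<^sub>3\<close>: the antisymmetric part is antiperiodic with \<open>T = \<pi>/2\<close> along \<open>E\<^sub>3\<close>, so that \<open>E\<^sub>3\<close> alone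
  suffices.
\<close>

lemma gap_even_2:
  assumes u2: "flow_C1 2 u u2" and u3: "flow_C1 3 u u3" and mean: "(\<integral>X. u X \<partial>\<mu>) = 0"
    and even: "\<And>X. X \<in> SU2 \<Longrightarrow> u (- X) = u X"
    and inv2: "\<And>X. X \<in> SU2 \<Longrightarrow> u (X ** generator 2) = u X"
  shows "gap_holds u u2 u3"
proof (rule gap_split[OF u2 u3 generator_in_SU2[of 3] one_param_mult_generator(3,4)])
  fix v v2 v3 assume v: "v = (\<lambda>X. (u X + 1 * u (X ** generator 3)) / 2)"
    and v2: "flow_C1 2 v v2" and v3: "flow_C1 3 v v3" and m: "(\<integral>X. v X \<partial>\<mu>) = (\<integral>X. u X \<partial>\<mu>)"
  show "gap_holds v v2 v3"
  proof (rule gap_invariant[OF v2 v3])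
    fix X assume X: "X \<in> SU2"
    note X3 = SU2_mult[OF X generator_in_SU2[of 3]]
    note X32 = SU2_mult[OF X3 generator_in_SU2[of 2]]
    show "v (X ** generator 3) = v X"
      using even[OF X] by (simp add: v mult_generator_generator del: generator_simps)
    show "v (X ** generator 2) = v X"
      using even[OF X32] inv2[OF X] inv2[OF X3] by (simp add: v mult_generator_2_3 del: generator_simps)
  qed (simp add: m mean)
next
  fix v v2 v3 assume v: "v = (\<lambda>X. (u X + (-1) * u (X ** generator 3)) / 2)"
    and v2: "flow_C1 2 v v2" and v3: "flow_C1 3 v v3"
  have "v (X ** one_param 3 (pi / 2)) = - v X" if X: "X \<in> SU2" for X
    using even[OF X] by (simp add: v one_param_pi_half mult_generator_generator field_simps del: generator_simps)
  from flow_wirtinger_antiperiodic[OF v3 _ this]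
  have "4 * (\<integral>X. (v X)\<^sup>2 \<partial>\<mu>) \<le> (\<integral>X. (v3 X)\<^sup>2 \<partial>\<mu>)" by (simp add: power2_eq_square)
  moreover have "0 \<le> (\<integral>X. (v2 X)\<^sup>2 \<partial>\<mu>)" "0 \<le> (\<integral>X. (v3 X)\<^sup>2 \<partial>\<mu>)" by simp_all
  ultimately show "gap_holds v v2 v3" by linarith
qed simp_all

text \<open>
  Splitting with \<open>q = e\<^sub>2\<close>: the antisymmetric part is antiperiodic with \<open>T = \<pi>/2\<close> along \<open>E\<^sub>2\<close>, so that \<open>E\<^sub>2\<close> alone
  suffices.
\<close>

lemma gap_even:
  assumes u2: "flow_C1 2 u u2" and u3: "flow_C1 3 u u3" and mean: "(\<integral>X. u X \<partial>\<mu>) = 0"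
    and even: "\<And>X. X \<in> SU2 \<Longrightarrow> u (- X) = u X"
  shows "gap_holds u u2 u3"
proof (rule gap_split[OF u2 u3 generator_in_SU2[of 2] one_param_mult_generator(1,2)])
  fix v v2 v3 assume v: "v = (\<lambda>X. (u X + 1 * u (X ** generator 2)) / 2)"
    and v2: "flow_C1 2 v v2" and v3: "flow_C1 3 v v3" and m: "(\<integral>X. v X \<partial>\<mu>) = (\<integral>X. u X \<partial>\<mu>)"
  show "gap_holds v v2 v3"
  proof (rule gap_even_2[OF v2 v3])
    fix X assume X: "X \<in> SU2"
    show "v (- X) = v X"
      using even[OF X] even[OF SU2_mult[OF X generator_in_SU2[of 2]]]
      by (simp add: v minus_mult_generator del: generator_simps)
    show "v (X ** generator 2) = v X"
      using even[OF X] by (simp add: v mult_generator_generator del: generator_simps)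
  qed (simp add: m mean)
next
  fix v v2 v3 assume v: "v = (\<lambda>X. (u X + (-1) * u (X ** generator 2)) / 2)"
    and v2: "flow_C1 2 v v2" and v3: "flow_C1 3 v v3"
  have "v (X ** one_param 2 (pi / 2)) = - v X" if X: "X \<in> SU2" for X
    using even[OF X] by (simp add: v one_param_pi_half mult_generator_generator field_simps del: generator_simps)
  from flow_wirtinger_antiperiodic[OF v2 _ this]
  have "4 * (\<integral>X. (v X)\<^sup>2 \<partial>\<mu>) \<le> (\<integral>X. (v2 X)\<^sup>2 \<partial>\<mu>)" by (simp add: power2_eq_square)
  moreover have "0 \<le> (\<integral>X. (v3 X)\<^sup>2 \<partial>\<mu>)" by simp
  ultimately show "gap_holds v v2 v3" by linarith
qed simp_all

text \<open>
  Splitting with \<open>q = -1\<close>, which lies on both circles: an odd function is antiperiodic with \<open>T = \<pi>\<close> along both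
  of them, and the two inequalities \<open>\<integral>(E\<^sub>b u)\<^sup>2 \<ge> \<integral>u\<^sup>2\<close> add up to the constant \<open>1 + 3\<close>.
\<close>

lemma spectral_gap:
  assumes u2: "flow_C1 2 u u2" and u3: "flow_C1 3 u u3" and mean: "(\<integral>X. u X \<partial>\<mu>) = 0"
  shows "4 * (\<integral>X. (u X)\<^sup>2 \<partial>\<mu>) \<le> (\<integral>X. (u2 X)\<^sup>2 \<partial>\<mu>) + 3 * (\<integral>X. (u3 X)\<^sup>2 \<partial>\<mu>)"
proof (rule gap_split[OF u2 u3 minus_mat_1_in_SU2 one_param_mult_minus_mat_1 one_param_mult_minus_mat_1])
  fix v v2 v3 assume v: "v = (\<lambda>X. (u X + 1 * u (X ** (- mat 1))) / 2)"
    and v2: "flow_C1 2 v v2" and v3: "flow_C1 3 v v3" and m: "(\<integral>X. v X \<partial>\<mu>) = (\<integral>X. u X \<partial>\<mu>)"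
  show "gap_holds v v2 v3"
    by (rule gap_even[OF v2 v3]) (simp_all only: m mean, simp add: v mult_minus_mat_1)
next
  fix v v2 v3 assume v: "v = (\<lambda>X. (u X + (-1) * u (X ** (- mat 1))) / 2)"
    and v2: "flow_C1 2 v v2" and v3: "flow_C1 3 v v3"
  have "v (X ** one_param b pi) = - v X" for X b
    by (simp add: v one_param_pi mult_minus_mat_1 field_simps)
  from flow_wirtinger_antiperiodic[OF v2 _ this] flow_wirtinger_antiperiodic[OF v3 _ this]
  show "gap_holds v v2 v3" by simp
qed simp_all

end

section \<open>Contractions and the first eigenvalue\<close>

lemma linear_in_cotangent_space: "linear L \<Longrightarrow> L \<in> cotangent_space M x"
  unfolding cotangent_space_def by blast

lemma cotangent_space_cong:
  "\<alpha> \<in> cotangent_space M x \<Longrightarrow> (\<And>v. v \<in> tangent_space M x \<Longrightarrow> \<beta> v = \<alpha> v) \<Longrightarrow> \<beta> \<in> cotangent_space M x"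
  unfolding cotangent_space_def by auto

lemma cotangent_space_sum:
  assumes "\<And>i. i \<in> I \<Longrightarrow> \<alpha> i \<in> cotangent_space M x"
  shows "(\<lambda>v. \<Sum>i\<in>I. c i * \<alpha> i v) \<in> cotangent_space M x"
proof -
  have "\<forall>i\<in>I. \<exists>L. linear L \<and> (\<forall>v\<in>tangent_space M x. \<alpha> i v = L v)"
    using assms unfolding cotangent_space_def by blast
  from bchoice[OF this] obtain L where
    L: "\<forall>i\<in>I. linear (L i) \<and> (\<forall>v\<in>tangent_space M x. \<alpha> i v = L i v)" ..
  have "linear (\<lambda>v. \<Sum>i\<in>I. c i *\<^sub>R L i v)"
    using L by (intro linear_compose_sum ballI linear_compose_scale_right) auto
  then show ?thesis
    unfolding cotangent_space_def using L by (auto intro!: exI sum.cong)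
qed

lemma S2T_sectionsD:
  assumes "g \<in> S2T_sections M" "x \<in> M" "\<alpha> \<in> cotangent_space M x" "\<beta> \<in> cotangent_space M x"
  shows "g x \<alpha> \<beta> = g x \<beta> \<alpha>"
    and "\<gamma> \<in> cotangent_space M x \<Longrightarrow> g x (\<lambda>v. \<alpha> v + c * \<gamma> v) \<beta> = g x \<alpha> \<beta> + c * g x \<gamma> \<beta>"
    and "(\<And>v. v \<in> tangent_space M x \<Longrightarrow> \<gamma> v = \<alpha> v) \<Longrightarrow> g x \<gamma> \<beta> = g x \<alpha> \<beta>"
  using assms unfolding S2T_sections_def by blast+

lemma S2T_cong:
  assumes g: "g \<in> S2T_sections M" "x \<in> M" and c: "\<alpha> \<in> cotangent_space M x" "\<beta> \<in> cotangent_space M x"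
    and eq: "\<And>v. v \<in> tangent_space M x \<Longrightarrow> \<gamma> v = \<alpha> v" "\<And>v. v \<in> tangent_space M x \<Longrightarrow> \<delta> v = \<beta> v"
  shows "g x \<gamma> \<delta> = g x \<alpha> \<beta>"
proof -
  have c': "\<gamma> \<in> cotangent_space M x" "\<delta> \<in> cotangent_space M x"
    using cotangent_space_cong c eq by blast+
  have "g x \<gamma> \<delta> = g x \<alpha> \<delta>" by (rule S2T_sectionsD(3)[OF g c(1) c'(2)]) (rule eq)
  also have "\<dots> = g x \<delta> \<alpha>" by (rule S2T_sectionsD(1)[OF g c(1) c'(2)])
  also have "\<dots> = g x \<beta> \<alpha>" by (rule S2T_sectionsD(3)[OF g c(2) c(1)]) (rule eq)
  also have "\<dots> = g x \<alpha> \<beta>" by (rule S2T_sectionsD(1)[OF g c(2) c(1)])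
  finally show ?thesis .
qed

lemma S2T_sum_left:
  assumes g: "g \<in> S2T_sections M" "x \<in> M" and "finite I"
    and c: "\<And>i. i \<in> I \<Longrightarrow> \<alpha> i \<in> cotangent_space M x" and \<beta>: "\<beta> \<in> cotangent_space M x"
  shows "g x (\<lambda>v. \<Sum>i\<in>I. c i * \<alpha> i v) \<beta> = (\<Sum>i\<in>I. c i * g x (\<alpha> i) \<beta>)"
  using \<open>finite I\<close> c
proof (induction I)
  case empty
  have z: "(\<lambda>v. 0) \<in> cotangent_space M x" by (intro linear_in_cotangent_space linear_zero)
  have "g x (\<lambda>v. 0 + 1 * 0) \<beta> = g x (\<lambda>v. 0) \<beta> + 1 * g x (\<lambda>v. 0) \<beta>"
    by (rule S2T_sectionsD(2)[OF g z \<beta> z])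
  then show ?case by simp
next
  case (insert i I)
  have "g x (\<lambda>v. (\<Sum>i\<in>I. c i * \<alpha> i v) + c i * \<alpha> i v) \<beta>
      = g x (\<lambda>v. \<Sum>i\<in>I. c i * \<alpha> i v) \<beta> + c i * g x (\<alpha> i) \<beta>"
    using insert.prems by (intro S2T_sectionsD(2)[OF g _ \<beta>] cotangent_space_sum) auto
  then show ?case using insert by (simp add: add.commute)
qed

lemma S2T_sum:
  assumes g: "g \<in> S2T_sections M" "x \<in> M" and fin: "finite I"
    and c: "\<And>i. i \<in> I \<Longrightarrow> \<alpha> i \<in> cotangent_space M x"
  shows "g x (\<lambda>v. \<Sum>i\<in>I. c i * \<alpha> i v) (\<lambda>v. \<Sum>j\<in>I. c j * \<alpha> j v)
    = (\<Sum>i\<in>I. \<Sum>j\<in>I. c i * c j * g x (\<alpha> i) (\<alpha> j))"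
proof -
  let ?s = "\<lambda>v. \<Sum>j\<in>I. c j * \<alpha> j v"
  have s: "?s \<in> cotangent_space M x" by (rule cotangent_space_sum[OF c])
  have "g x ?s ?s = (\<Sum>i\<in>I. c i * g x (\<alpha> i) ?s)" by (rule S2T_sum_left[OF g fin c s])
  also have "\<dots> = (\<Sum>i\<in>I. c i * g x ?s (\<alpha> i))"
    by (intro sum.cong refl arg_cong[of _ _ "(*) _"] S2T_sectionsD(1)[OF g c s])
  also have "\<dots> = (\<Sum>i\<in>I. c i * (\<Sum>j\<in>I. c j * g x (\<alpha> j) (\<alpha> i)))"
    by (intro sum.cong refl arg_cong[of _ _ "(*) _"] S2T_sum_left[OF g fin c c])
  also have "\<dots> = (\<Sum>i\<in>I. \<Sum>j\<in>I. c i * c j * g x (\<alpha> i) (\<alpha> j))"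
    by (intro sum.cong refl) (simp add: sum_distrib_left mult.assoc S2T_sectionsD(1)[OF g c c] cong: sum.cong)
  finally show ?thesis .
qed

text \<open>
  Contracting with \<open>l \<otimes> l\<close> means inserting \<open>l\<close> twice: expand \<open>l\<close> in the dual basis that occurs in the
  definition. One bilinear form may have several such expansions, and comparing them computes sums of
  \<open>g(l\<^sub>i, l\<^sub>i)\<close>.
\<close>

lemma contraction_sum_of_squares:
  assumes g: "g \<in> S2T_sections M" and x: "x \<in> M" and sub: "subspace (tangent_space M x)"
    and I: "finite I" and l: "\<And>i. i \<in> I \<Longrightarrow> l i \<in> cotangent_space M x"
    and k: "\<And>v w. v \<in> tangent_space M x \<Longrightarrow> w \<in> tangent_space M x \<Longrightarrow> k x v w = (\<Sum>i\<in>I. l i v * l i w)"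
  shows "contraction M g k x = (\<Sum>i\<in>I. g x (l i) (l i))"
proof -
  let ?T = "tangent_space M x"
  define B where "B = (SOME B. independent B \<and> span B = ?T)"
  have "\<exists>B. independent B \<and> span B = ?T"
    by (metis basis_exists span_subspace sub)
  then have "independent B \<and> span B = ?T" unfolding B_def by (rule someI_ex)
  then have ind: "independent B" and span: "span B = ?T" by auto
  have fin: "finite B" using ind by (rule independent_imp_finite)
  have BT: "e \<in> ?T" if "e \<in> B" for e using span that span_base by blast
  let ?r = "\<lambda>e v. representation B v e"
  have r: "?r e \<in> cotangent_space M x" if e: "e \<in> B" for e
  proof -
    obtain L :: "'a \<Rightarrow> real" where L: "linear L" "\<forall>v\<in>B. L v = (if v = e then 1 else 0)"
      using linear_independent_extend[OF ind, of "\<lambda>v. if v = e then 1 else 0 :: real"] by (elim exE conjE) (rule that)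
    have "?r e v = L v" if "v \<in> ?T" for v
    proof -
      have "v = (\<Sum>f\<in>B. ?r f v *\<^sub>R f)"
        using sum_representation_eq[OF ind _ fin order_refl, of v] that span by simp
      then have "L v = L (\<Sum>f\<in>B. ?r f v *\<^sub>R f)" by simp
      also have "\<dots> = (\<Sum>f\<in>B. ?r f v * L f)" by (simp add: linear_sum[OF L(1)] linear_scale[OF L(1)])
      also have "\<dots> = (\<Sum>f\<in>B. if f = e then ?r f v else 0)" using L(2) by (intro sum.cong) auto
      also have "\<dots> = ?r e v" using e fin by simp
      finally show ?thesis by simp
    qed
    with L(1) show ?thesis unfolding cotangent_space_def by blast
  qed
  have expand: "l i v = (\<Sum>e\<in>B. l i e * ?r e v)" if i: "i \<in> I" and v: "v \<in> ?T" for i v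
  proof -
    obtain L where L: "linear L" "\<forall>v\<in>?T. l i v = L v" using l[OF i] unfolding cotangent_space_def by blast
    have "v = (\<Sum>e\<in>B. ?r e v *\<^sub>R e)"
      using sum_representation_eq[OF ind _ fin order_refl, of v] v span by simp
    then have "L v = L (\<Sum>e\<in>B. ?r e v *\<^sub>R e)" by simp
    also have "\<dots> = (\<Sum>e\<in>B. ?r e v * L e)" by (simp add: linear_sum[OF L(1)] linear_scale[OF L(1)])
    also have "\<dots> = (\<Sum>e\<in>B. l i e * ?r e v)" using L(2) BT by (intro sum.cong) (auto simp: mult.commute)
    finally show ?thesis using L(2) v by simp
  qed
  have "g x (l i) (l i) = (\<Sum>e\<in>B. \<Sum>f\<in>B. l i e * l i f * g x (?r e) (?r f))" if i: "i \<in> I" for i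
  proof -
    have "g x (l i) (l i) = g x (\<lambda>v. \<Sum>e\<in>B. l i e * ?r e v) (\<lambda>v. \<Sum>e\<in>B. l i e * ?r e v)"
      by (rule S2T_cong[OF g x]) (auto intro!: cotangent_space_sum r expand[OF i])
    then show ?thesis using S2T_sum[OF g x fin, of ?r "l i"] r by simp
  qed
  then have "(\<Sum>i\<in>I. g x (l i) (l i)) = (\<Sum>i\<in>I. \<Sum>e\<in>B. \<Sum>f\<in>B. l i e * l i f * g x (?r e) (?r f))"
    by simp
  also have "\<dots> = (\<Sum>e\<in>B. \<Sum>i\<in>I. \<Sum>f\<in>B. l i e * l i f * g x (?r e) (?r f))" by (rule sum.swap)
  also have "\<dots> = (\<Sum>e\<in>B. \<Sum>f\<in>B. \<Sum>i\<in>I. l i e * l i f * g x (?r e) (?r f))"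
    by (intro sum.cong refl sum.swap)
  also have "\<dots> = (\<Sum>e\<in>B. \<Sum>f\<in>B. g x (?r e) (?r f) * k x e f)"
    using k BT by (intro sum.cong refl) (simp add: sum_distrib_right mult.commute[of "g x _ _"])
  also have "\<dots> = contraction M g k x" unfolding contraction_def B_def[symmetric] Let_def ..
  finally show ?thesis by simp
qed

text \<open>
  In ambient coordinates, \<open>L x\<close> is a combination of the coordinate forms, on which \<open>g\<close> is smooth.
\<close>

lemma continuous_on_S2T:
  assumes g: "g \<in> S2T_sections M" and L: "\<And>x. x \<in> M \<Longrightarrow> linear (L x)"
    and c: "\<And>v. continuous_on M (\<lambda>x. L x v)"
  shows "continuous_on M (\<lambda>x. g x (L x) (L x))"
proof -
  let ?i = "\<lambda>i v. inner v i"
  have "g x (L x) (L x) = (\<Sum>i\<in>Basis. \<Sum>j\<in>Basis. L x i * L x j * g x (?i i) (?i j))" if x: "x \<in> M" for x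
  proof -
    have "L x v = (\<Sum>i\<in>Basis. L x i * ?i i v)" for v
    proof -
      have "L x v = L x (\<Sum>i\<in>Basis. inner v i *\<^sub>R i)" by (simp add: euclidean_representation)
      also have "\<dots> = (\<Sum>i\<in>Basis. L x i * ?i i v)"
        using L[OF x] by (simp add: linear_sum linear_scale mult.commute)
      finally show ?thesis .
    qed
    then have e: "L x = (\<lambda>v. \<Sum>i\<in>Basis. L x i * ?i i v)" by blast
    have "?i i \<in> cotangent_space M x" for i
      by (intro linear_in_cotangent_space bounded_linear.linear bounded_linear_inner_left)
    then have "g x (\<lambda>v. \<Sum>i\<in>Basis. L x i * ?i i v) (\<lambda>v. \<Sum>i\<in>Basis. L x i * ?i i v)
        = (\<Sum>i\<in>Basis. \<Sum>j\<in>Basis. L x i * L x j * g x (?i i) (?i j))"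
      by (intro S2T_sum[OF g x]) auto
    then show ?thesis using e by simp
  qed
  moreover have cont: "continuous_on M (\<lambda>x. \<Sum>i\<in>Basis. \<Sum>j\<in>Basis. L x i * L x j * g x (?i i) (?i j))"
  proof -
    have "continuous_on M (\<lambda>x. g x (?i i) (?i j))" if "i \<in> Basis" "j \<in> Basis" for i j
    proof -
      have "C_map \<infinity> M (\<lambda>x. g x (?i i) (?i j))" using g that unfolding S2T_sections_def by blast
      then show ?thesis by (rule C_map_imp_continuous_on)
    qed
    then show ?thesis by (intro continuous_intros c) auto
  qed
  ultimately show ?thesis by (intro continuous_on_eq[OF cont]) simp
qed

lemma dirichlet_nonneg:
  assumes "g \<in> M_star M" "C_map 1 M u" "space \<mu> = M"
  shows "0 \<le> (\<integral>x. g x (differential M u x) (differential M u x) \<partial>\<mu>)"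
  using assms differential_in_cotangent_space[OF assms(2)]
  unfolding M_star_def by (intro integral_nonneg_AE AE_I2) auto

text \<open>
  The Rayleigh bound, multiplied out so as to cover functions with vanishing integral of \<open>u\<^sup>2\<close>.
\<close>

lemma lambda1_le:
  assumes g: "g \<in> M_star M" and u: "C_map 1 M u" and sp: "space \<mu> = M" and mean: "(\<integral>x. u x \<partial>\<mu>) = 0"
  shows "lambda1 M \<mu> g * (\<integral>x. (u x)\<^sup>2 \<partial>\<mu>) \<le> (\<integral>x. g x (differential M u x) (differential M u x) \<partial>\<mu>)"
proof (cases "(\<integral>x. (u x)\<^sup>2 \<partial>\<mu>) = 0")
  case True
  then show ?thesis using dirichlet_nonneg[OF g u sp] by simp
next
  case False
  let ?Q = "\<lambda>u. (\<integral>x. g x (differential M u x) (differential M u x) \<partial>\<mu>) / (\<integral>x. (u x)\<^sup>2 \<partial>\<mu>)"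
  let ?S = "{?Q u | u. C_map 1 M u \<and> (\<exists>x\<in>M. u x \<noteq> 0) \<and> (\<integral>x. u x \<partial>\<mu>) = 0}"
  have "\<exists>x\<in>M. u x \<noteq> 0"
  proof (rule ccontr)
    assume "\<not> (\<exists>x\<in>M. u x \<noteq> 0)"
    then have "(\<integral>x. (u x)\<^sup>2 \<partial>\<mu>) = (\<integral>x. 0 \<partial>\<mu>)"
      using sp by (intro Bochner_Integration.integral_cong) auto
    then show False using False by simp
  qed
  then have "?Q u \<in> ?S" using u mean by blast
  moreover have "bdd_below ?S"
    by (rule bdd_belowI[of _ 0]) (auto intro!: divide_nonneg_nonneg dirichlet_nonneg[OF g _ sp])
  ultimately have "lambda1 M \<mu> g \<le> ?Q u" unfolding lambda1_def by (rule cInf_lower)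
  moreover have "0 < (\<integral>x. (u x)\<^sup>2 \<partial>\<mu>)"
    using False by (simp add: less_le)
  ultimately show ?thesis by (simp add: pos_le_divide_eq)
qed

section \<open>Eigenfunctions of the left-invariant Laplacian\<close>

lemma flow_C1_differential:
  assumes u: "C_map k SU2 u" "1 \<le> k"
  shows "flow_C1 b u (\<lambda>X. differential SU2 u X (E_field b X))"
  unfolding flow_C1_def
proof (intro conjI ballI allI)
  show "continuous_on SU2 u" by (rule C_map_imp_continuous_on[OF u(1)])
  show "continuous_on SU2 (\<lambda>X. differential SU2 u X (E_field b X))"
    by (rule continuous_on_differential[OF u continuous_on_E_field E_field_in_tangent_space])
  fix X t assume X: "X \<in> SU2"
  let ?Y = "X ** one_param b t"
  have Y: "?Y \<in> SU2" by (rule SU2_mult[OF X one_param_in_SU2])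
  have "((\<lambda>s. ?Y ** one_param b s) has_vector_derivative E_field b ?Y) (at 0)"
    using one_param_derivative[of ?Y b 0] by (simp add: E_field_eq[OF Y])
  then have "((\<lambda>s. u (?Y ** one_param b s)) has_vector_derivative differential SU2 u ?Y (E_field b ?Y)) (at 0)"
    by (intro C_map_has_vector_derivative[OF u]) (auto intro: SU2_mult[OF Y one_param_in_SU2])
  then have "((\<lambda>s. u (X ** one_param b (s + t))) has_real_derivative differential SU2 u ?Y (E_field b ?Y)) (at 0)"
    by (simp add: has_real_derivative_iff_has_vector_derivative matrix_mul_assoc[symmetric] one_param_add add.commute)
  then show "((\<lambda>t. u (X ** one_param b t)) has_real_derivative differential SU2 u ?Y (E_field b ?Y)) (at t)"
    using DERIV_shift[of "\<lambda>t. u (X ** one_param b t)" _ 0 t] by simp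
qed

lemma flow_C1_unique:
  assumes "flow_C1 b u v" "flow_C1 b u w" "X \<in> SU2"
  shows "v X = w X"
  using DERIV_unique[OF flow_C1D(3)[OF assms(1,3), of 0] flow_C1D(3)[OF assms(2,3), of 0]] by simp

lemma flow_C1_mult:
  assumes "flow_C1 b u u'" "flow_C1 b v v'"
  shows "flow_C1 b (\<lambda>X. u X * v X) (\<lambda>X. u' X * v X + u X * v' X)"
  using assms unfolding flow_C1_def
  by (auto intro!: continuous_intros derivative_eq_intros)

context SU2_volume
begin

text \<open>
  The flow lines close up after time \<open>2\<pi>\<close>, so the derivative already integrates to zero along each of them.
\<close>

lemma integral_flow_derivative:
  assumes u: "flow_C1 b u u'"
  shows "(\<integral>X. u' X \<partial>\<mu>) = 0"
proof -
  have "integral {0..2*pi} (\<lambda>t. u' (X ** one_param b t)) = 0" if X: "X \<in> SU2" for X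
  proof -
    have "((\<lambda>t. u' (X ** one_param b t)) has_integral
        u (X ** one_param b (2*pi)) - u (X ** one_param b 0)) {0..2*pi}"
      using flow_C1D(3)[OF u X]
      by (intro fundamental_theorem_of_calculus)
        (auto simp: has_real_derivative_iff_has_vector_derivative[symmetric] intro: has_field_derivative_at_within)
    moreover have "one_param b (2*pi) = mat 1" by (simp add: one_param_def)
    ultimately show ?thesis by (simp add: integral_unique)
  qed
  then have "(\<integral>X. integral {0..2*pi} (\<lambda>t. u' (X ** one_param b t)) \<partial>\<mu>) = 0"
    by (intro integral_eq_zero_AE AE_I2) simp
  then show ?thesis using integral_one_param_average[OF flow_C1D(2)[OF u], of "2*pi" b] by simp
qed

lemma integration_by_parts:
  assumes u: "flow_C1 b u u'" and v: "flow_C1 b v v'"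
  shows "(\<integral>X. u X * v' X \<partial>\<mu>) = - (\<integral>X. u' X * v X \<partial>\<mu>)"
proof -
  have "integrable \<mu> (\<lambda>X. u' X * v X)" "integrable \<mu> (\<lambda>X. u X * v' X)"
    by (intro integrable_continuous continuous_intros flow_C1D[OF u] flow_C1D[OF v])+
  then show ?thesis using integral_flow_derivative[OF flow_C1_mult[OF u v]] by simp
qed

text \<open>
  Integration by parts along \<open>E\<^sub>2\<close> and \<open>E\<^sub>3\<close>. For an eigenfunction \<open>u\<close> of \<open>- p E\<^sub>2\<^sup>2 - q E\<^sub>3\<^sup>2\<close> this is the identity
  that defines the Bakry-Emery Laplacian.
\<close>

lemma weak_eigenvalue:
  assumes u: "C_map \<infinity> SU2 u" and v: "C_map k SU2 v" "1 \<le> k"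
    and u2: "flow_C1 2 u u2" "flow_C1 2 u2 u22" and u3: "flow_C1 3 u u3" "flow_C1 3 u3 u33"
    and eq: "\<And>X. X \<in> SU2 \<Longrightarrow> p * u22 X + q * u33 X = - l * u X"
  shows "(\<integral>X. h_star 0 p q X (differential SU2 u X) (differential SU2 v X) \<partial>\<mu>) = l * (\<integral>X. u X * v X \<partial>\<mu>)"
proof -
  let ?v = "\<lambda>b X. differential SU2 v X (E_field b X)"
  note fv = flow_C1_differential[OF v]
  note c = flow_C1D(1,2)[OF u2(2)] flow_C1D(1,2)[OF u3(2)] flow_C1D(1,2)[OF fv] flow_C1D(1)[OF u2(1)]
  have i: "integrable \<mu> (\<lambda>X. u2 X * ?v 2 X)" "integrable \<mu> (\<lambda>X. u3 X * ?v 3 X)"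
      "integrable \<mu> (\<lambda>X. u22 X * v X)" "integrable \<mu> (\<lambda>X. u33 X * v X)"
    by (intro integrable_continuous continuous_intros c)+
  have du: "differential SU2 u X (E_field 2 X) = u2 X" "differential SU2 u X (E_field 3 X) = u3 X"
    if "X \<in> SU2" for X
    using flow_C1_unique[OF flow_C1_differential[OF u] u2(1) that]
      flow_C1_unique[OF flow_C1_differential[OF u] u3(1) that] by simp_all
  have "(\<integral>X. h_star 0 p q X (differential SU2 u X) (differential SU2 v X) \<partial>\<mu>)
      = (\<integral>X. p * (u2 X * ?v 2 X) + q * (u3 X * ?v 3 X) \<partial>\<mu>)"
    by (intro Bochner_Integration.integral_cong) (auto simp: h_star_def du)
  also have "\<dots> = p * (\<integral>X. u2 X * ?v 2 X \<partial>\<mu>) + q * (\<integral>X. u3 X * ?v 3 X \<partial>\<mu>)"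
    using i by simp
  also have "\<dots> = - (p * (\<integral>X. u22 X * v X \<partial>\<mu>) + q * (\<integral>X. u33 X * v X \<partial>\<mu>))"
    by (simp add: integration_by_parts[OF u2(2) fv] integration_by_parts[OF u3(2) fv])
  also have "p * (\<integral>X. u22 X * v X \<partial>\<mu>) + q * (\<integral>X. u33 X * v X \<partial>\<mu>)
      = (\<integral>X. (p * u22 X + q * u33 X) * v X \<partial>\<mu>)"
    using i by (simp add: distrib_right mult.assoc)
  also have "\<dots> = (\<integral>X. - l * (u X * v X) \<partial>\<mu>)"
    by (intro Bochner_Integration.integral_cong) (auto simp: eq)
  finally show ?thesis by simp
qed

text \<open>
  The definite description in the Laplacian needs uniqueness: the difference \<open>d\<close> of two solutions is smooth
  and may be used as the test function, and the volume has full support.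
\<close>

lemma BE_laplacian_eq:
  assumes u: "C_map \<infinity> SU2 u"
    and weak: "\<And>v. C_map \<infinity> SU2 v \<Longrightarrow>
      (\<integral>X. g X (differential SU2 u X) (differential SU2 v X) \<partial>\<mu>) = l * (\<integral>X. u X * v X \<partial>\<mu>)"
    and X: "X \<in> SU2"
  shows "- BE_laplacian SU2 \<mu> g u X = l * u X"
proof -
  let ?w = "restrict (\<lambda>X. - l * u X) SU2"
  have cu: "C_map \<infinity> SU2 (\<lambda>X. - l * u X)"
    by (rule C_map_compose_linear[OF u]) (rule bounded_linear_mult_right)
  then have cw: "C_map \<infinity> SU2 ?w" by (rule C_map_cong[THEN iffD1, rotated]) simp
  have ww: "(\<integral>X. ?w X * v X \<partial>\<mu>) = - (\<integral>X. g X (differential SU2 u X) (differential SU2 v X) \<partial>\<mu>)"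
    if "C_map \<infinity> SU2 v" for v
  proof -
    have "(\<integral>X. ?w X * v X \<partial>\<mu>) = (\<integral>X. - l * (u X * v X) \<partial>\<mu>)"
      by (intro Bochner_Integration.integral_cong) auto
    then show ?thesis using weak[OF that] by simp
  qed
  have "BE_laplacian SU2 \<mu> g u = ?w"
    unfolding BE_laplacian_def
  proof (rule the_equality)
    show "?w \<in> extensional SU2 \<and> C_map \<infinity> SU2 ?w \<and> (\<forall>v. C_map \<infinity> SU2 v \<longrightarrow>
        (\<integral>X. ?w X * v X \<partial>\<mu>) = - (\<integral>X. g X (differential SU2 u X) (differential SU2 v X) \<partial>\<mu>))"
      using cw ww by simp
    fix w assume w: "w \<in> extensional SU2 \<and> C_map \<infinity> SU2 w \<and> (\<forall>v. C_map \<infinity> SU2 v \<longrightarrow>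
        (\<integral>X. w X * v X \<partial>\<mu>) = - (\<integral>X. g X (differential SU2 u X) (differential SU2 v X) \<partial>\<mu>))"
    define d where "d = (\<lambda>X. w X - ?w X)"
    have cd: "C_map \<infinity> SU2 d" unfolding d_def using C_map_diff w cw by blast
    have "integrable \<mu> (\<lambda>X. w X * d X)" "integrable \<mu> (\<lambda>X. ?w X * d X)"
      by (intro integrable_continuous continuous_intros C_map_imp_continuous_on[OF cd]
          C_map_imp_continuous_on[OF cw] C_map_imp_continuous_on[of \<infinity> SU2 w] conjunct1[OF conjunct2[OF w]])+
    then have "(\<integral>X. w X * d X - ?w X * d X \<partial>\<mu>) = 0"
      using w ww[OF cd] cd by simp
    moreover have "w X * d X - ?w X * d X = (d X)\<^sup>2" for X
      by (simp only: d_def power2_eq_square left_diff_distrib)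
    ultimately have d0: "(\<integral>X. (d X)\<^sup>2 \<partial>\<mu>) = 0" by simp
    have "(d X)\<^sup>2 = 0" if "X \<in> SU2" for X
    proof (rule integral_eq_0_imp_eq_0[OF _ _ d0 that])
      show "continuous_on SU2 (\<lambda>X. (d X)\<^sup>2)"
        by (intro continuous_intros C_map_imp_continuous_on[OF cd])
    qed simp_all
    then have "d X = 0" if "X \<in> SU2" for X using that by simp
    then have "w X = ?w X" if "X \<in> SU2" for X using that unfolding d_def by (simp only: right_minus_eq)
    then show "w = ?w" using w by (intro extensionalityI[of w SU2]) auto
  qed
  then show ?thesis using X by simp
qed

lemma h_star_dirichlet_ge:
  assumes u: "C_map k SU2 u" "1 \<le> k" and mean: "(\<integral>X. u X \<partial>\<mu>) = 0"
  shows "4 / 3 * (\<integral>X. (u X)\<^sup>2 \<partial>\<mu>) \<le> (\<integral>X. h_star 0 (1/3) 1 X (differential SU2 u X) (differential SU2 u X) \<partial>\<mu>)"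
proof -
  let ?u = "\<lambda>b X. differential SU2 u X (E_field b X)"
  note f = flow_C1_differential[OF u]
  have "integrable \<mu> (\<lambda>X. (?u 2 X)\<^sup>2)" "integrable \<mu> (\<lambda>X. (?u 3 X)\<^sup>2)"
    by (intro integrable_continuous continuous_intros flow_C1D(2)[OF f])+
  then have "(\<integral>X. h_star 0 (1/3) 1 X (differential SU2 u X) (differential SU2 u X) \<partial>\<mu>)
      = 1/3 * (\<integral>X. (?u 2 X)\<^sup>2 \<partial>\<mu>) + (\<integral>X. (?u 3 X)\<^sup>2 \<partial>\<mu>)"
    by (simp add: h_star_def power2_eq_square)
  with spectral_gap[OF f f mean] show ?thesis by simp
qed

end

section \<open>The linear and the Hopf components of the map\<close>

text \<open>
  The map of the theorem has \<open>k\<^sup>2 = 1/c\<close> and \<open>m\<^sup>2 = 1/b - 1/c\<close>. The last two components are the Hopf fibration onto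
  the sphere of radius \<open>m/2\<close> in \<open>\<complex> \<times> \<real>\<close>.
\<close>

definition hopf_map :: "real \<Rightarrow> real \<Rightarrow> complex^2^2 \<Rightarrow> complex \<times> complex \<times> complex \<times> real" where
  "hopf_map k m X = (of_real k * X $ 1 $ 1, of_real k * X $ 2 $ 1,
     of_real m * (X $ 1 $ 1 * cnj (X $ 2 $ 1)),
     m / 2 * Re (X $ 1 $ 1 * cnj (X $ 1 $ 1) - X $ 2 $ 1 * cnj (X $ 2 $ 1)))"

definition hopf_deriv :: "real \<Rightarrow> real \<Rightarrow> complex^2^2 \<Rightarrow> complex^2^2 \<Rightarrow> complex \<times> complex \<times> complex \<times> real" where
  "hopf_deriv k m X V = (of_real k * V $ 1 $ 1, of_real k * V $ 2 $ 1,
     of_real m * (V $ 1 $ 1 * cnj (X $ 2 $ 1) + X $ 1 $ 1 * cnj (V $ 2 $ 1)),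
     m * Re (X $ 1 $ 1 * cnj (V $ 1 $ 1) - X $ 2 $ 1 * cnj (V $ 2 $ 1)))"

lemma has_vector_derivative_entries:
  fixes \<gamma> :: "real \<Rightarrow> complex^2^2"
  assumes "(\<gamma> has_vector_derivative V) (at t)"
  shows "((\<lambda>t. \<gamma> t $ i $ j) has_vector_derivative V $ i $ j) (at t)"
    and "((\<lambda>t. cnj (\<gamma> t $ i $ j)) has_vector_derivative cnj (V $ i $ j)) (at t)"
proof -
  show 1: "((\<lambda>t. \<gamma> t $ i $ j) has_vector_derivative V $ i $ j) (at t)"
    by (rule bounded_linear.has_vector_derivative[OF
          bounded_linear_compose[OF bounded_linear_vec_nth bounded_linear_vec_nth] assms])
  show "((\<lambda>t. cnj (\<gamma> t $ i $ j)) has_vector_derivative cnj (V $ i $ j)) (at t)"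
    by (rule bounded_linear.has_vector_derivative[OF bounded_linear_cnj 1])
qed

lemmas entry_derivatives =
  has_vector_derivative_Pair has_vector_derivative_mult has_vector_derivative_const
  has_vector_derivative_diff bounded_linear.has_vector_derivative[OF bounded_linear_Re]

lemma hopf_map_has_derivative:
  assumes "(\<gamma> has_vector_derivative V) (at t)"
  shows "((\<lambda>t. hopf_map k m (\<gamma> t)) has_vector_derivative hopf_deriv k m (\<gamma> t) V) (at t)"
  unfolding hopf_map_def
  by (rule has_vector_derivative_eq_rhs, (rule entry_derivatives has_vector_derivative_entries[OF assms])+)
    (simp add: hopf_deriv_def algebra_simps)

lemma linear_hopf_deriv: "linear (hopf_deriv k m X)"
  by (rule linearI) (auto simp: hopf_deriv_def complex_eq_iff algebra_simps)

lemma continuous_on_hopf_deriv: "continuous_on S (\<lambda>X. hopf_deriv k m X V)"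
  unfolding hopf_deriv_def by (intro continuous_intros)

lemma n_times_entry:
  "n_times_continuously_differentiable_on n UNIV (\<lambda>X::complex^2^2. X $ i $ j)"
  "n_times_continuously_differentiable_on n UNIV (\<lambda>X::complex^2^2. cnj (X $ i $ j))"
proof -
  have l: "bounded_linear (\<lambda>X::complex^2^2. X $ i $ j)"
    by (intro bounded_linear_compose[OF bounded_linear_vec_nth bounded_linear_vec_nth])
  show "n_times_continuously_differentiable_on n UNIV (\<lambda>X::complex^2^2. X $ i $ j)"
    "n_times_continuously_differentiable_on n UNIV (\<lambda>X::complex^2^2. cnj (X $ i $ j))"
    by (intro n_times_bounded_linear open_UNIV l bounded_linear_compose[OF bounded_linear_cnj l])+
qed

lemma n_times_hopf_map: "n_times_continuously_differentiable_on n UNIV (hopf_map k m)"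
proof -
  have eq: "hopf_map k m = (\<lambda>X. (of_real k * X $ 1 $ 1, of_real k * X $ 2 $ 1,
     of_real m * (X $ 1 $ 1 * cnj (X $ 2 $ 1)),
     m / 2 * Re (X $ 1 $ 1 * cnj (X $ 1 $ 1) + (- 1) * (X $ 2 $ 1 * cnj (X $ 2 $ 1)))))"
    by (simp add: hopf_map_def fun_eq_iff)
  show ?thesis
    unfolding eq
    by (intro n_times_Pair n_times_mult n_times_add n_times_const n_times_entry open_UNIV
        n_times_compose_linear[OF open_UNIV bounded_linear_Re])
qed

text \<open>
  The linear components contribute \<open>k\<^sup>2\<close> times the round metric. The Hopf components are invariant under
  \<open>E\<^sub>3\<close> and contribute \<open>m\<^sup>2 (\<sigma>\<^sub>1\<^sup>2 + \<sigma>\<^sub>2\<^sup>2)\<close>. In real coordinates this is a polynomial identity after using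
  \<open>|\<zeta>\<^sub>1|\<^sup>2 + |\<zeta>\<^sub>2|\<^sup>2 = 1\<close>.
\<close>

lemma hopf_deriv_square:
  assumes X: "X \<in> SU2" and V: "V \<in> tangent_space SU2 X"
  shows "inner (hopf_deriv k m X V) (hopf_deriv k m X V)
    = (k\<^sup>2 + m\<^sup>2) * ((sigma X V $ 1)\<^sup>2 + (sigma X V $ 2)\<^sup>2) + k\<^sup>2 * (sigma X V $ 3)\<^sup>2"
proof -
  obtain z w where zw: "X = A_mat z w" "(cmod z)\<^sup>2 + (cmod w)\<^sup>2 = 1" using X by (rule SU2_cases)
  define x1 x2 x3 where "x1 = sigma X V $ 1" and "x2 = sigma X V $ 2" and "x3 = sigma X V $ 3"
  define a b c d where "a = Re z" and "b = Im z" and "c = Re w" and "d = Im w"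
  have unit: "a\<^sup>2 + b\<^sup>2 + c\<^sup>2 + d\<^sup>2 = 1"
    using zw(2) unfolding cmod_power2 a_def b_def c_def d_def by simp
  have V': "V = x1 *\<^sub>R (X ** generator 1) + x2 *\<^sub>R (X ** generator 2) + x3 *\<^sub>R (X ** generator 3)"
    using tangent_space_expand[OF X V] by (simp only: sum_3 x1_def x2_def x3_def)
  have z: "z = Complex a b" and w: "w = Complex c d" by (simp_all add: a_def b_def c_def d_def)
  have V11: "V $ 1 $ 1 = Complex (- x3 * b - x1 * d + x2 * c) (x3 * a - x1 * c - x2 * d)"
    and V21: "V $ 2 $ 1 = Complex (- x3 * d + x1 * b - x2 * a) (x3 * c + x1 * a + x2 * b)"
    unfolding V' by (simp_all add: zw(1) z w A_mat_mult complex_eq_iff algebra_simps)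
  have "inner (hopf_deriv k m X V) (hopf_deriv k m X V)
      = k\<^sup>2 * (a\<^sup>2 + b\<^sup>2 + c\<^sup>2 + d\<^sup>2) * (x1\<^sup>2 + x2\<^sup>2 + x3\<^sup>2) + m\<^sup>2 * (a\<^sup>2 + b\<^sup>2 + c\<^sup>2 + d\<^sup>2)\<^sup>2 * (x1\<^sup>2 + x2\<^sup>2)"
    unfolding hopf_deriv_def V11 V21 zw(1) z w
    by (simp add: inner_Pair inner_complex_def power2_eq_square algebra_simps)
  then show ?thesis unfolding unit x1_def[symmetric] x2_def[symmetric] x3_def[symmetric]
    by (simp add: algebra_simps)
qed

lemma hopf_deriv_inner:
  assumes X: "X \<in> SU2" and V: "V \<in> tangent_space SU2 X" and W: "W \<in> tangent_space SU2 X"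
  shows "inner (hopf_deriv k m X V) (hopf_deriv k m X W)
    = (k\<^sup>2 + m\<^sup>2) * (sigma X V $ 1 * sigma X W $ 1 + sigma X V $ 2 * sigma X W $ 2)
      + k\<^sup>2 * (sigma X V $ 3 * sigma X W $ 3)"
proof -
  let ?D = "hopf_deriv k m X"
  have VW: "V + W \<in> tangent_space SU2 X" by (rule subspace_add[OF subspace_tangent_space_SU2[OF X] V W])
  have "2 * inner (?D V) (?D W) = inner (?D (V + W)) (?D (V + W)) - inner (?D V) (?D V) - inner (?D W) (?D W)"
    by (simp add: linear_add[OF linear_hopf_deriv] inner_add_left inner_add_right inner_commute)
  also have "\<dots> = 2 * ((k\<^sup>2 + m\<^sup>2) * (sigma X V $ 1 * sigma X W $ 1 + sigma X V $ 2 * sigma X W $ 2)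
      + k\<^sup>2 * (sigma X V $ 3 * sigma X W $ 3))"
    unfolding hopf_deriv_square[OF X V] hopf_deriv_square[OF X W] hopf_deriv_square[OF X VW]
      linear_add[OF linear_sigma] vector_add_component
    by (simp add: power2_eq_square algebra_simps del: sigma_nth)
  finally show ?thesis by simp
qed

lemma norm_hopf_map:
  assumes "X \<in> SU2"
  shows "(norm (hopf_map k m X))\<^sup>2 = k\<^sup>2 + m\<^sup>2 / 4"
proof -
  obtain z w where zw: "X = A_mat z w" "(cmod z)\<^sup>2 + (cmod w)\<^sup>2 = 1" using assms by (rule SU2_cases)
  define a b c d where "a = Re z" and "b = Im z" and "c = Re w" and "d = Im w"
  have unit: "a\<^sup>2 + b\<^sup>2 + c\<^sup>2 + d\<^sup>2 = 1"
    using zw(2) unfolding cmod_power2 a_def b_def c_def d_def by simp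
  have z: "z = Complex a b" and w: "w = Complex c d" by (simp_all add: a_def b_def c_def d_def)
  have "(norm (hopf_map k m X))\<^sup>2 = k\<^sup>2 * (a\<^sup>2 + b\<^sup>2 + c\<^sup>2 + d\<^sup>2) + m\<^sup>2 / 4 * (a\<^sup>2 + b\<^sup>2 + c\<^sup>2 + d\<^sup>2)\<^sup>2"
    unfolding power2_norm_eq_inner hopf_map_def zw(1) z w
    by (simp add: inner_Pair inner_complex_def power2_eq_square algebra_simps)
  then show ?thesis by (simp add: unit)
qed

lemma flow_C1_inner:
  assumes "continuous_on SU2 F" "continuous_on SU2 G"
    and "\<And>X t. X \<in> SU2 \<Longrightarrow> ((\<lambda>t. F (X ** one_param b t)) has_vector_derivative G (X ** one_param b t)) (at t)"
  shows "flow_C1 b (\<lambda>X. inner (F X) i) (\<lambda>X. inner (G X) i)"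
  unfolding flow_C1_def has_real_derivative_iff_has_vector_derivative
  using assms bounded_linear.has_vector_derivative[OF bounded_linear_inner_left assms(3)]
  by (auto intro!: continuous_intros)

text \<open>
  On the linear components both \<open>E\<^sub>2\<^sup>2\<close> and \<open>E\<^sub>3\<^sup>2\<close> act as \<open>-1\<close>; on the Hopf components they act as \<open>-4\<close> and \<open>0\<close>. The
  weights \<open>1/3\<close> and \<open>1\<close> are those for which both cases give \<open>-4/3\<close>.
\<close>

lemma hopf_flows:
  fixes k m :: real and i :: "complex \<times> complex \<times> complex \<times> real"
  obtains u2 u22 u3 u33 where
    "flow_C1 2 (\<lambda>X. inner (hopf_map k m X) i) u2" "flow_C1 2 u2 u22"
    "flow_C1 3 (\<lambda>X. inner (hopf_map k m X) i) u3" "flow_C1 3 u3 u33"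
    "\<And>X. X \<in> SU2 \<Longrightarrow> 1 / 3 * u22 X + 1 * u33 X = - (4 / 3) * inner (hopf_map k m X) i"
proof -
  define h2 :: "complex^2^2 \<Rightarrow> complex \<times> complex \<times> complex \<times> real" where
    "h2 = (\<lambda>X. (of_real k * cnj (X $ 2 $ 1), - of_real k * cnj (X $ 1 $ 1),
      of_real m * (cnj (X $ 2 $ 1) * cnj (X $ 2 $ 1) - X $ 1 $ 1 * X $ 1 $ 1), 2 * m * Re (X $ 1 $ 1 * X $ 2 $ 1)))"
  define h22 :: "complex^2^2 \<Rightarrow> complex \<times> complex \<times> complex \<times> real" where
    "h22 = (\<lambda>X. (- of_real k * X $ 1 $ 1, - of_real k * X $ 2 $ 1, - 4 * of_real m * (X $ 1 $ 1 * cnj (X $ 2 $ 1)),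
      - 2 * m * Re (X $ 1 $ 1 * cnj (X $ 1 $ 1) - X $ 2 $ 1 * cnj (X $ 2 $ 1))))"
  define h3 :: "complex^2^2 \<Rightarrow> complex \<times> complex \<times> complex \<times> real" where
    "h3 = (\<lambda>X. (of_real k * \<i> * X $ 1 $ 1, of_real k * \<i> * X $ 2 $ 1, 0, 0))"
  define h33 :: "complex^2^2 \<Rightarrow> complex \<times> complex \<times> complex \<times> real" where
    "h33 = (\<lambda>X. (- of_real k * X $ 1 $ 1, - of_real k * X $ 2 $ 1, 0, 0))"
  note entries = has_vector_derivative_entries[OF one_param_derivative]
  have c: "continuous_on SU2 (hopf_map k m)" "continuous_on SU2 h2" "continuous_on SU2 h22"
      "continuous_on SU2 h3" "continuous_on SU2 h33"
    unfolding hopf_map_def h2_def h22_def h3_def h33_def by (intro continuous_intros)+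
  have cases: "\<exists>z w. X ** one_param b t = A_mat z w" if "X \<in> SU2" for X b t
    using SU2_mult[OF that one_param_in_SU2] by (blast elim: SU2_cases)
  show thesis
  proof (rule that)
    show "flow_C1 2 (\<lambda>X. inner (hopf_map k m X) i) (\<lambda>X. inner (h2 X) i)"
    proof (rule flow_C1_inner[OF c(1,2)])
      fix X t assume "X \<in> SU2"
      then obtain z w where "X ** one_param 2 t = A_mat z w" using cases by blast
      then have "hopf_deriv k m (X ** one_param 2 t) ((X ** one_param 2 t) ** generator 2) = h2 (X ** one_param 2 t)"
        by (simp add: hopf_deriv_def h2_def A_mat_mult algebra_simps)
      then show "((\<lambda>t. hopf_map k m (X ** one_param 2 t)) has_vector_derivative h2 (X ** one_param 2 t)) (at t)"
        using hopf_map_has_derivative[OF one_param_derivative, of k m X 2 t] by simp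
    qed
    show "flow_C1 3 (\<lambda>X. inner (hopf_map k m X) i) (\<lambda>X. inner (h3 X) i)"
    proof (rule flow_C1_inner[OF c(1,4)])
      fix X t assume "X \<in> SU2"
      then obtain z w where "X ** one_param 3 t = A_mat z w" using cases by blast
      then have "hopf_deriv k m (X ** one_param 3 t) ((X ** one_param 3 t) ** generator 3) = h3 (X ** one_param 3 t)"
        by (simp add: hopf_deriv_def h3_def A_mat_mult algebra_simps)
      then show "((\<lambda>t. hopf_map k m (X ** one_param 3 t)) has_vector_derivative h3 (X ** one_param 3 t)) (at t)"
        using hopf_map_has_derivative[OF one_param_derivative, of k m X 3 t] by simp
    qed
    show "flow_C1 2 (\<lambda>X. inner (h2 X) i) (\<lambda>X. inner (h22 X) i)"
    proof (rule flow_C1_inner[OF c(2,3)])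
      fix X t assume "X \<in> SU2"
      then obtain z w where zw: "X ** one_param 2 t = A_mat z w" using cases by blast
      show "((\<lambda>t. h2 (X ** one_param 2 t)) has_vector_derivative h22 (X ** one_param 2 t)) (at t)"
        unfolding h2_def
        by (rule has_vector_derivative_eq_rhs, (rule entry_derivatives entries)+)
          (simp add: zw h22_def A_mat_mult algebra_simps)
    qed
    show "flow_C1 3 (\<lambda>X. inner (h3 X) i) (\<lambda>X. inner (h33 X) i)"
    proof (rule flow_C1_inner[OF c(4,5)])
      fix X t assume "X \<in> SU2"
      then obtain z w where zw: "X ** one_param 3 t = A_mat z w" using cases by blast
      show "((\<lambda>t. h3 (X ** one_param 3 t)) has_vector_derivative h33 (X ** one_param 3 t)) (at t)"
        unfolding h3_def
        by (rule has_vector_derivative_eq_rhs, (rule entry_derivatives entries)+)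
          (simp add: zw h33_def A_mat_mult algebra_simps)
    qed
    have "(1 / 3) *\<^sub>R h22 X + h33 X = (- (4 / 3)) *\<^sub>R hopf_map k m X" for X
      by (simp add: h22_def h33_def hopf_map_def scaleR_conv_of_real algebra_simps)
    then have "inner ((1 / 3) *\<^sub>R h22 X + h33 X) i = inner ((- (4 / 3)) *\<^sub>R hopf_map k m X) i" for X by simp
    then show "1 / 3 * inner (h22 X) i + 1 * inner (h33 X) i = - (4 / 3) * inner (hopf_map k m X) i" for X
      unfolding inner_add_left inner_scaleR_left by simp
  qed
qed

lemma C_map_hopf_map: "C_map n SU2 (hopf_map k m)"
  by (rule C_map_globalI[OF n_times_hopf_map]) simp

lemma C_map_hopf_map_inner: "C_map n SU2 (\<lambda>X. inner (hopf_map k m X) i)"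
  by (rule C_map_compose_linear[OF C_map_hopf_map bounded_linear_inner_left])

lemma differential_hopf_map:
  assumes "V \<in> tangent_space SU2 X"
  shows "differential SU2 (hopf_map k m) X V = hopf_deriv k m X V"
proof (rule differential_eqI[OF assms])
  fix \<gamma> assume "\<gamma> 0 = X" "(\<gamma> has_vector_derivative V) (at (0::real))"
  then show "((\<lambda>t. hopf_map k m (\<gamma> t)) has_vector_derivative hopf_deriv k m X V) (at 0)"
    using hopf_map_has_derivative[of \<gamma> V 0 k m] by simp
qed

lemma differential_hopf_map_inner:
  assumes "V \<in> tangent_space SU2 X"
  shows "differential SU2 (\<lambda>X. inner (hopf_map k m X) i) X V = inner (hopf_deriv k m X V) i"
  using differential_compose_linear[OF C_map_hopf_map order_refl bounded_linear_inner_left assms]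
  by (simp add: differential_hopf_map[OF assms])

text \<open>
  The map of the theorem is known only on the group, while \<open>hopf_map\<close> is defined on all matrices.
\<close>

lemma differential_cong:
  assumes "\<And>x. x \<in> M \<Longrightarrow> f x = g x"
  shows "differential M f = differential M g"
proof -
  have "(\<lambda>t. f (\<gamma> t)) = (\<lambda>t. g (\<gamma> t))" if "\<forall>t. \<gamma> t \<in> M" for \<gamma> :: "real \<Rightarrow> 'a"
    using assms that by auto
  then show ?thesis unfolding differential_def by (intro ext) (metis (no_types, lifting))
qed

lemma smooth_embedding_hopf_map:
  assumes k: "k \<noteq> 0"
  shows "smooth_embedding SU2 (hopf_map k m)"
  unfolding smooth_embedding_def
proof (intro conjI ballI)
  show "C_map \<infinity> SU2 (hopf_map k m)" by (rule C_map_hopf_map)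
  show "inj_on (differential SU2 (hopf_map k m) X) (tangent_space SU2 X)" if X: "X \<in> SU2" for X
  proof (rule inj_onI)
    fix V W assume V: "V \<in> tangent_space SU2 X" and W: "W \<in> tangent_space SU2 X"
      and eq: "differential SU2 (hopf_map k m) X V = differential SU2 (hopf_map k m) X W"
    then have "hopf_deriv k m X V = hopf_deriv k m X W" by (simp add: differential_hopf_map)
    then have "V $ 1 $ 1 = W $ 1 $ 1" "V $ 2 $ 1 = W $ 2 $ 1" using k by (simp_all add: hopf_deriv_def)
    then have "sigma X V = sigma X W" by (simp add: sigma_def)
    then show "V = W" using tangent_space_expand[OF X V] tangent_space_expand[OF X W] by simp
  qed
  have "inj_on (hopf_map k m) SU2"
  proof (rule inj_onI)
    fix X Y assume "X \<in> SU2" "Y \<in> SU2" "hopf_map k m X = hopf_map k m Y"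
    then show "X = Y" using k by (auto elim!: SU2_cases simp: hopf_map_def)
  qed
  then show "\<exists>g. homeomorphism SU2 (hopf_map k m ` SU2) (hopf_map k m) g"
    using homeomorphism_compact[OF compact_SU2 C_map_imp_continuous_on[OF C_map_hopf_map]] by metis
qed

lemma pullback_hopf_map:
  assumes X: "X \<in> SU2" and V: "V \<in> tangent_space SU2 X" and W: "W \<in> tangent_space SU2 X"
  shows "pullback_metric SU2 (hopf_map k m) X V W =
    (k\<^sup>2 + m\<^sup>2) * (sigma X V $ 1 * sigma X W $ 1 + sigma X V $ 2 * sigma X W $ 2)
      + k\<^sup>2 * (sigma X V $ 3 * sigma X W $ 3)"
  unfolding pullback_metric_def differential_hopf_map[OF V] differential_hopf_map[OF W]
  by (rule hopf_deriv_inner[OF X V W])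

lemma h_star_in_M_star:
  assumes "0 \<le> u" "0 \<le> v" "0 \<le> w"
  shows "h_star u v w \<in> M_star SU2"
proof -
  have smooth: "C_map \<infinity> SU2 (\<lambda>X. h_star u v w X (\<lambda>V. inner V i) (\<lambda>V. inner V j))" for i j
  proof (rule C_map_globalI)
    let ?e = "\<lambda>b X. inner (X ** generator b) i" and ?f = "\<lambda>b X. inner (X ** generator b) j"
    let ?F = "\<lambda>X. u * (?e 1 X * ?f 1 X) + v * (?e 2 X * ?f 2 X) + w * (?e 3 X * ?f 3 X)"
    have "bounded_linear (\<lambda>X. inner (X ** generator b) l)" for b and l :: "complex^2^2"
      by (rule bounded_linear_compose[OF bounded_linear_inner_left
            bounded_bilinear.bounded_linear_left[OF bounded_bilinear_matrix_mult]])
    then show "n_times_continuously_differentiable_on n UNIV ?F" for n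
      by (intro n_times_add n_times_mult n_times_const n_times_bounded_linear open_UNIV)
    show "?F X = h_star u v w X (\<lambda>V. inner V i) (\<lambda>V. inner V j)" if "X \<in> SU2" for X
      using that by (simp only: h_star_def E_field_eq)
  qed
  have "h_star u v w X \<gamma> \<beta> = h_star u v w X \<alpha> \<beta>"
    if "X \<in> SU2" "\<forall>V\<in>tangent_space SU2 X. \<gamma> V = \<alpha> V" for X \<alpha> \<beta> \<gamma>
    using that E_field_in_tangent_space[OF that(1)] by (simp add: h_star_def)
  moreover have "h_star u v w X \<alpha> \<beta> = h_star u v w X \<beta> \<alpha>"
    "h_star u v w X (\<lambda>V. \<alpha> V + c * \<gamma> V) \<beta> = h_star u v w X \<alpha> \<beta> + c * h_star u v w X \<gamma> \<beta>" for X \<alpha> \<beta> \<gamma> c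
    by (simp_all add: h_star_def algebra_simps)
  moreover have "0 \<le> h_star u v w X \<alpha> \<alpha>" for X \<alpha>
    using assms by (simp add: h_star_def)
  ultimately show ?thesis
    using smooth unfolding M_star_def S2T_sections_def by blast
qed

lemma sigma_in_cotangent_space: "(\<lambda>V. sigma X V $ i) \<in> cotangent_space M x"
  by (intro linear_in_cotangent_space linear_compose[OF linear_sigma, unfolded o_def]
      bounded_linear.linear bounded_linear_vec_nth)

lemma contraction_diagonal:
  assumes g: "g \<in> S2T_sections SU2" and X: "X \<in> SU2" and r: "\<And>i. 0 \<le> r i"
    and K: "\<And>V W. V \<in> tangent_space SU2 X \<Longrightarrow> W \<in> tangent_space SU2 X \<Longrightarrow>
      K X V W = (\<Sum>i\<in>UNIV. r i * (sigma X V $ i * sigma X W $ i))"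
  shows "contraction SU2 g K X = (\<Sum>i\<in>UNIV. r i * g X (\<lambda>V. sigma X V $ i) (\<lambda>V. sigma X V $ i))"
proof -
  let ?s = "\<lambda>i V. sigma X V $ i"
  let ?l = "\<lambda>i V. sqrt (r i) * ?s i V"
  have sq: "(sqrt (r i) * x) * (sqrt (r i) * y) = r i * (x * y)" for i x y
  proof -
    have "(sqrt (r i) * x) * (sqrt (r i) * y) = (sqrt (r i) * sqrt (r i)) * (x * y)"
      by (simp only: mult_ac)
    then show ?thesis using r by simp
  qed
  have l: "?l i = (\<lambda>V. \<Sum>j\<in>{i}. sqrt (r i) * ?s j V)" for i
    by (simp del: sigma_nth)
  have "contraction SU2 g K X = (\<Sum>i\<in>UNIV. g X (?l i) (?l i))"
  proof (rule contraction_sum_of_squares[OF g X subspace_tangent_space_SU2[OF X] finite])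
    show "?l i \<in> cotangent_space SU2 X" for i
      unfolding l by (rule cotangent_space_sum) (rule sigma_in_cotangent_space)
    show "K X V W = (\<Sum>i\<in>UNIV. ?l i V * ?l i W)"
      if "V \<in> tangent_space SU2 X" "W \<in> tangent_space SU2 X" for V W
      unfolding sq by (rule K[OF that])
  qed
  also have "\<dots> = (\<Sum>i\<in>UNIV. r i * g X (?s i) (?s i))"
  proof (rule sum.cong[OF refl])
    fix i
    have "g X (?l i) (?l i) = (\<Sum>j\<in>{i}. \<Sum>j'\<in>{i}. sqrt (r i) * sqrt (r i) * g X (?s j) (?s j'))"
      unfolding l by (rule S2T_sum[OF g X]) (simp_all only: sigma_in_cotangent_space finite.intros)
    then show "g X (?l i) (?l i) = r i * g X (?s i) (?s i)" using r by (simp del: sigma_nth)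
  qed
  finally show ?thesis .
qed

lemma continuous_on_sigma_form:
  assumes g: "g \<in> S2T_sections SU2"
  shows "continuous_on SU2 (\<lambda>X. g X (\<lambda>V. sigma X V $ i) (\<lambda>V. sigma X V $ i))"
proof (rule continuous_on_S2T[OF g])
  show "linear (\<lambda>V. sigma X V $ i)" for X
    by (intro linear_compose[OF linear_sigma, unfolded o_def] bounded_linear.linear bounded_linear_vec_nth)
  show "continuous_on SU2 (\<lambda>X. sigma X V $ i)" for V
    using exhaust_3[of i]
    by (elim disjE) (simp_all only: sigma_nth, (intro continuous_intros)+)
qed

section \<open>Duality between the two maximization problems\<close>

context SU2_volume
begin

text \<open>
  A component \<open>u\<close> of the map is a combination of the derivatives \<open>E\<^sub>2\<^sup>2 u\<close> and \<open>E\<^sub>3\<^sup>2 u\<close>, which integrate to zero.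
\<close>

lemma hopf_map_mean: "(\<integral>X. inner (hopf_map k m X) i \<partial>\<mu>) = 0"
proof -
  obtain u2 u22 u3 u33 where
    f: "flow_C1 2 (\<lambda>X. inner (hopf_map k m X) i) u2" "flow_C1 2 u2 u22"
    "flow_C1 3 (\<lambda>X. inner (hopf_map k m X) i) u3" "flow_C1 3 u3 u33"
    and eq: "\<And>X. X \<in> SU2 \<Longrightarrow> 1 / 3 * u22 X + 1 * u33 X = - (4 / 3) * inner (hopf_map k m X) i"
    using hopf_flows[of k m i] by metis
  have "(\<integral>X. - (4 / 3) * inner (hopf_map k m X) i \<partial>\<mu>) = (\<integral>X. 1 / 3 * u22 X + 1 * u33 X \<partial>\<mu>)"
    by (rule Bochner_Integration.integral_cong[OF refl]) (rule eq[symmetric], simp)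
  also have "\<dots> = 1 / 3 * (\<integral>X. u22 X \<partial>\<mu>) + (\<integral>X. u33 X \<partial>\<mu>)"
    using integrable_continuous[OF flow_C1D(2)[OF f(2)]] integrable_continuous[OF flow_C1D(2)[OF f(4)]] by simp
  also have "\<dots> = 0" by (simp add: integral_flow_derivative[OF f(2)] integral_flow_derivative[OF f(4)])
  finally show ?thesis by simp
qed

lemma hopf_map_weak_eigenvalue:
  assumes "C_map n SU2 v" "1 \<le> n"
  shows "(\<integral>X. h_star 0 (1/3) 1 X (differential SU2 (\<lambda>X. inner (hopf_map k m X) i) X) (differential SU2 v X) \<partial>\<mu>)
    = 4 / 3 * (\<integral>X. inner (hopf_map k m X) i * v X \<partial>\<mu>)"
proof -
  obtain u2 u22 u3 u33 where
    f: "flow_C1 2 (\<lambda>X. inner (hopf_map k m X) i) u2" "flow_C1 2 u2 u22"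
    "flow_C1 3 (\<lambda>X. inner (hopf_map k m X) i) u3" "flow_C1 3 u3 u33"
    and eq: "\<And>X. X \<in> SU2 \<Longrightarrow> 1 / 3 * u22 X + 1 * u33 X = - (4 / 3) * inner (hopf_map k m X) i"
    using hopf_flows[of k m i] by metis
  show ?thesis by (rule weak_eigenvalue[OF C_map_hopf_map_inner assms f eq])
qed

text \<open>
  The spectral gap is the lower bound, and the real part of \<open>\<zeta>\<^sub>1\<close> attains it.
\<close>

lemma lambda1_h_star: "lambda1 SU2 \<mu> (h_star 0 (1/3) 1) = 4 / 3"
  unfolding lambda1_def
proof (rule cInf_eq_minimum)
  let ?g = "h_star 0 (1/3) 1"
  let ?Q = "\<lambda>u. (\<integral>x. ?g x (differential SU2 u x) (differential SU2 u x) \<partial>\<mu>) / (\<integral>x. (u x)\<^sup>2 \<partial>\<mu>)"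
  let ?S = "{?Q u | u. C_map 1 SU2 u \<and> (\<exists>x\<in>SU2. u x \<noteq> 0) \<and> (\<integral>x. u x \<partial>\<mu>) = 0}"
  have pos: "0 < (\<integral>x. (u x)\<^sup>2 \<partial>\<mu>)" if u: "C_map n SU2 u" "\<exists>x\<in>SU2. u x \<noteq> 0" for n and u :: "_ \<Rightarrow> real"
  proof -
    have "(\<integral>x. (u x)\<^sup>2 \<partial>\<mu>) \<noteq> 0"
    proof
      assume 0: "(\<integral>x. (u x)\<^sup>2 \<partial>\<mu>) = 0"
      have "(u x)\<^sup>2 = 0" if "x \<in> SU2" for x
        by (rule integral_eq_0_imp_eq_0[OF _ _ 0 that])
          (auto intro!: continuous_intros C_map_imp_continuous_on[OF u(1)])
      then show False using u(2) by auto
    qed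
    then show ?thesis by (simp add: less_le)
  qed
  let ?u = "\<lambda>X. inner (hopf_map 1 0 X) (1, 0, 0, 0)"
  have u: "C_map 1 SU2 ?u" "\<exists>x\<in>SU2. ?u x \<noteq> 0"
  proof -
    show "C_map 1 SU2 ?u" by (rule C_map_hopf_map_inner)
    have "?u (mat 1) \<noteq> 0" by (simp add: hopf_map_def mat_1_A_mat inner_Pair)
    then show "\<exists>x\<in>SU2. ?u x \<noteq> 0" using mat_1_in_SU2 by blast
  qed
  have Q: "?Q ?u = 4 / 3"
    using hopf_map_weak_eigenvalue[OF u(1) order_refl, of 1 0 "(1, 0, 0, 0)"] pos[OF u]
    by (simp add: power2_eq_square)
  have "?Q ?u \<in> ?S" using u hopf_map_mean[of 1 0 "(1, 0, 0, 0)"] by blast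
  then show "4 / 3 \<in> ?S" unfolding Q .
  show "4 / 3 \<le> q" if "q \<in> ?S" for q
  proof -
    obtain u where u: "q = ?Q u" "C_map 1 SU2 u" "\<exists>x\<in>SU2. u x \<noteq> 0" "(\<integral>x. u x \<partial>\<mu>) = 0"
      using \<open>q \<in> ?S\<close> by blast
    show ?thesis
      unfolding u(1) using h_star_dirichlet_ge[OF u(2) order_refl u(4)] pos[OF u(2,3)]
      by (simp add: pos_le_divide_eq)
  qed
qed

lemma hopf_map_first_eigenfunction:
  "first_eigenfunction SU2 \<mu> (h_star 0 (1/3) 1) (\<lambda>X. inner (hopf_map k m X) i)"
  unfolding first_eigenfunction_def lambda1_h_star
proof (intro conjI ballI)
  show "C_map \<infinity> SU2 (\<lambda>X. inner (hopf_map k m X) i)" by (rule C_map_hopf_map_inner)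
  show "- BE_laplacian SU2 \<mu> (h_star 0 (1/3) 1) (\<lambda>X. inner (hopf_map k m X) i) X = 4 / 3 * inner (hopf_map k m X) i"
    if "X \<in> SU2" for X
    by (rule BE_laplacian_eq[where u = "\<lambda>X. inner (hopf_map k m X) i", OF C_map_hopf_map_inner _ that])
      (rule hopf_map_weak_eigenvalue, assumption, simp add: enat_ord_code)
qed

text \<open>
  The first inequality of the duality, for an arbitrary \<open>g\<close> and the map \<open>hopf_map\<close>. The sum of the Dirichlet
  integrals of the components is the integrated contraction of \<open>g\<close> with the pullback metric; this contraction
  is computed once from the components and once from the diagonal form of the pullback metric.
\<close>

lemma lambda1_hopf_map_le:
  assumes g: "g \<in> M_star SU2"
  defines "S \<equiv> \<lambda>i X. g X (\<lambda>V. sigma X V $ i) (\<lambda>V. sigma X V $ i)"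
  shows "lambda1 SU2 \<mu> g * (k\<^sup>2 + m\<^sup>2 / 4)
    \<le> (k\<^sup>2 + m\<^sup>2) * ((\<integral>X. S 1 X \<partial>\<mu>) + (\<integral>X. S 2 X \<partial>\<mu>)) + k\<^sup>2 * (\<integral>X. S 3 X \<partial>\<mu>)"
proof -
  have g': "g \<in> S2T_sections SU2" using g by (simp add: M_star_def)
  let ?u = "\<lambda>i X. inner (hopf_map k m X) i"
  let ?q = "\<lambda>i X. g X (\<lambda>V. inner (hopf_deriv k m X V) i) (\<lambda>V. inner (hopf_deriv k m X V) i)"
  have lin: "linear (\<lambda>V. inner (hopf_deriv k m X V) i)" for X i
    by (intro linear_compose[OF linear_hopf_deriv, unfolded o_def] bounded_linear.linear bounded_linear_inner_left)
  have cq: "continuous_on SU2 (?q i)" for i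
    by (intro continuous_on_S2T[OF g' lin] continuous_intros continuous_on_hopf_deriv)
  have cS: "continuous_on SU2 (S i)" for i
    unfolding S_def by (rule continuous_on_sigma_form[OF g'])
  note iS = integrable_continuous[OF cS]
  have cu: "continuous_on SU2 (?u i)" for i by (rule C_map_imp_continuous_on[OF C_map_hopf_map_inner])
  have le: "lambda1 SU2 \<mu> g * (\<integral>X. (?u i X)\<^sup>2 \<partial>\<mu>) \<le> (\<integral>X. ?q i X \<partial>\<mu>)" for i
  proof -
    have "lambda1 SU2 \<mu> g * (\<integral>X. (?u i X)\<^sup>2 \<partial>\<mu>)
        \<le> (\<integral>X. g X (differential SU2 (?u i) X) (differential SU2 (?u i) X) \<partial>\<mu>)"
      by (rule lambda1_le[OF g C_map_hopf_map_inner space_volume hopf_map_mean])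
    also have "\<dots> = (\<integral>X. ?q i X \<partial>\<mu>)"
      by (intro Bochner_Integration.integral_cong refl S2T_cong[OF g'] linear_in_cotangent_space lin
          differential_hopf_map_inner) auto
    finally show ?thesis .
  qed
  have "lambda1 SU2 \<mu> g * (k\<^sup>2 + m\<^sup>2 / 4) = lambda1 SU2 \<mu> g * (\<integral>X. (\<Sum>i\<in>Basis. (?u i X)\<^sup>2) \<partial>\<mu>)"
  proof -
    have "(\<integral>X. (\<Sum>i\<in>Basis. (?u i X)\<^sup>2) \<partial>\<mu>) = (\<integral>X. k\<^sup>2 + m\<^sup>2 / 4 \<partial>\<mu>)"
    proof (intro Bochner_Integration.integral_cong refl)
      fix X assume "X \<in> space \<mu>"
      then have "k\<^sup>2 + m\<^sup>2 / 4 = (norm (hopf_map k m X))\<^sup>2" by (simp add: norm_hopf_map)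
      also have "\<dots> = (\<Sum>i\<in>Basis. (?u i X)\<^sup>2)"
        unfolding power2_norm_eq_inner by (subst euclidean_inner) (simp add: power2_eq_square)
      finally show "(\<Sum>i\<in>Basis. (?u i X)\<^sup>2) = k\<^sup>2 + m\<^sup>2 / 4" by simp
    qed
    then show ?thesis by simp
  qed
  also have "\<dots> = (\<Sum>i\<in>Basis. lambda1 SU2 \<mu> g * (\<integral>X. (?u i X)\<^sup>2 \<partial>\<mu>))"
    by (subst Bochner_Integration.integral_sum)
      (auto intro!: integrable_continuous continuous_intros cu simp: sum_distrib_left)
  also have "\<dots> \<le> (\<Sum>i\<in>Basis. (\<integral>X. ?q i X \<partial>\<mu>))" by (intro sum_mono le)
  also have "\<dots> = (\<integral>X. (\<Sum>i\<in>Basis. ?q i X) \<partial>\<mu>)"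
    by (rule Bochner_Integration.integral_sum[symmetric]) (intro integrable_continuous cq)
  also have "\<dots> = (\<integral>X. (k\<^sup>2 + m\<^sup>2) * (S 1 X + S 2 X) + k\<^sup>2 * S 3 X \<partial>\<mu>)"
  proof (intro Bochner_Integration.integral_cong refl)
    fix X assume "X \<in> space \<mu>"
    then have X: "X \<in> SU2" by simp
    let ?K = "\<lambda>X V W. inner (hopf_deriv k m X V) (hopf_deriv k m X W)"
    let ?r = "\<lambda>i::3. if i = 3 then k\<^sup>2 else k\<^sup>2 + m\<^sup>2"
    have "contraction SU2 g ?K X = (\<Sum>i\<in>Basis. ?q i X)"
      by (rule contraction_sum_of_squares[OF g' X subspace_tangent_space_SU2[OF X] finite_Basis])
        (auto intro: linear_in_cotangent_space lin euclidean_inner)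
    moreover have "contraction SU2 g ?K X = (\<Sum>i\<in>UNIV. ?r i * g X (\<lambda>V. sigma X V $ i) (\<lambda>V. sigma X V $ i))"
      by (rule contraction_diagonal[OF g' X])
        (simp_all add: hopf_deriv_inner[OF X] sum_3 distrib_left del: sigma_nth)
    ultimately show "(\<Sum>i\<in>Basis. ?q i X) = (k\<^sup>2 + m\<^sup>2) * (S 1 X + S 2 X) + k\<^sup>2 * S 3 X"
      by (simp add: sum_3 S_def distrib_left del: sigma_nth)
  qed
  also have "\<dots> = (k\<^sup>2 + m\<^sup>2) * ((\<integral>X. S 1 X \<partial>\<mu>) + (\<integral>X. S 2 X \<partial>\<mu>)) + k\<^sup>2 * (\<integral>X. S 3 X \<partial>\<mu>)"
    using iS by simp
  finally show ?thesis .
qed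

text \<open>
  The duality for \<open>g = h_star 0 (1/3) 1\<close>, where \<open>\<lambda>\<^sub>1(g) = 4/3\<close> and \<open>(g, h) = 1/(3b) + 1/c\<close>, and an arbitrary
  competitor \<open>f\<close>. The spectral gap is applied to finitely many components of \<open>f\<close> at a time, and shortness
  bounds the sums of the squares of their derivatives along \<open>E\<^sub>2\<close> and \<open>E\<^sub>3\<close>.
\<close>

lemma inflated_candidate_bound:
  assumes f: "f \<in> inflated_candidates SU2 \<mu> (h_metric a b c)"
  shows "(\<integral>X. (norm (f X))\<^sup>2 \<partial>\<mu>) \<le> 1 / (4 * b) + 3 / (4 * c)"
proof -
  have Cf: "C_map \<infinity> SU2 f" and short: "short_map SU2 (h_metric a b c) f" and mean: "(\<integral>X. f X \<partial>\<mu>) = 0"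
    using f by (auto simp: inflated_candidates_def average_eq)
  have cf: "continuous_on SU2 f" by (rule C_map_imp_continuous_on[OF Cf])
  have bl: "bounded_linear (\<lambda>x. l2_nth x n)" for n
    by (rule bounded_linear_intro[of _ 1]) (simp_all add: abs_l2_nth_le_norm)
  let ?f = "\<lambda>n X. l2_nth (f X) n"
  have Cn: "C_map \<infinity> SU2 (?f n)" for n by (rule C_map_compose_linear[OF Cf bl])
  have mn: "(\<integral>X. ?f n X \<partial>\<mu>) = 0" for n
    using integral_bounded_linear[OF bl integrable_continuous[OF cf], of n] mean by simp
  let ?D = "\<lambda>b X. differential SU2 f X (E_field b X)"
  have Dn: "differential SU2 (?f n) X (E_field b X) = l2_nth (?D b X) n" if "X \<in> SU2" for n b X
    by (rule differential_compose_linear[OF Cf _ bl E_field_in_tangent_space[OF that]]) simp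
  have partial: "(\<integral>X. (\<Sum>n<N. (?f n X)\<^sup>2) \<partial>\<mu>) \<le> 1 / (4 * b) + 3 / (4 * c)" for N
  proof -
    let ?h = "\<lambda>n X. h_star 0 (1/3) 1 X (differential SU2 (?f n) X) (differential SU2 (?f n) X)"
    have ch: "continuous_on SU2 (?h n)" for n
      unfolding h_star_def by (intro continuous_intros flow_C1D(2)[OF flow_C1_differential[OF Cn]]) simp_all
    have "4 / 3 * (\<integral>X. (\<Sum>n<N. (?f n X)\<^sup>2) \<partial>\<mu>) = (\<Sum>n<N. 4 / 3 * (\<integral>X. (?f n X)\<^sup>2 \<partial>\<mu>))"
      by (subst Bochner_Integration.integral_sum)
        (auto intro!: integrable_continuous continuous_intros C_map_imp_continuous_on[OF Cn] simp: sum_distrib_left)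
    also have "\<dots> \<le> (\<Sum>n<N. (\<integral>X. ?h n X \<partial>\<mu>))"
      by (intro sum_mono h_star_dirichlet_ge[OF Cn _ mn]) simp
    also have "\<dots> = (\<integral>X. (\<Sum>n<N. ?h n X) \<partial>\<mu>)"
      by (rule Bochner_Integration.integral_sum[symmetric]) (intro integrable_continuous ch)
    also have "\<dots> \<le> (\<integral>X. 1 / (3 * b) + 1 / c \<partial>\<mu>)"
    proof (intro integral_mono integrable_continuous continuous_intros ch)
      fix X assume "X \<in> space \<mu>"
      then have X: "X \<in> SU2" by simp
      have "(\<Sum>n<N. ?h n X) = 1/3 * (\<Sum>n<N. (l2_nth (?D 2 X) n)\<^sup>2) + (\<Sum>n<N. (l2_nth (?D 3 X) n)\<^sup>2)"
        by (simp add: h_star_def Dn[OF X] sum.distrib sum_distrib_left power2_eq_square)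
      also have "\<dots> \<le> 1/3 * (norm (?D 2 X))\<^sup>2 + (norm (?D 3 X))\<^sup>2"
        by (intro add_mono mult_left_mono sum_square_le_norm_l2) simp_all
      also have "\<dots> \<le> 1/3 * h_metric a b c X (E_field 2 X) (E_field 2 X) + h_metric a b c X (E_field 3 X) (E_field 3 X)"
        using short X E_field_in_tangent_space[OF X]
        by (intro add_mono mult_left_mono) (auto simp: short_map_def pullback_metric_def power2_norm_eq_inner)
      also have "\<dots> = 1 / (3 * b) + 1 / c"
        by (simp add: h_metric_def sigma_E_field[OF X] del: sigma_nth)
      finally show "(\<Sum>n<N. ?h n X) \<le> 1 / (3 * b) + 1 / c" .
    qed
    finally show ?thesis by simp
  qed
  have "(\<lambda>N. \<integral>X. (\<Sum>n<N. (?f n X)\<^sup>2) \<partial>\<mu>) \<longlonglongrightarrow> (\<integral>X. (norm (f X))\<^sup>2 \<partial>\<mu>)"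
  proof (rule integral_dominated_convergence[where w = "\<lambda>X. (norm (f X))\<^sup>2"])
    show "(\<lambda>X. (norm (f X))\<^sup>2) \<in> borel_measurable \<mu>" "integrable \<mu> (\<lambda>X. (norm (f X))\<^sup>2)"
      by (intro borel_measurable_continuous integrable_continuous continuous_intros cf)+
    show "(\<lambda>X. \<Sum>n<N. (?f n X)\<^sup>2) \<in> borel_measurable \<mu>" for N
      by (intro borel_measurable_continuous continuous_intros C_map_imp_continuous_on[OF Cn])
    show "AE X in \<mu>. (\<lambda>N. \<Sum>n<N. (?f n X)\<^sup>2) \<longlonglongrightarrow> (norm (f X))\<^sup>2"
      unfolding norm_l2_square by (intro AE_I2 summable_LIMSEQ summable_l2_nth)
    show "AE X in \<mu>. norm (\<Sum>n<N. (?f n X)\<^sup>2) \<le> (norm (f X))\<^sup>2" for N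
      by (intro AE_I2) (simp add: sum_nonneg sum_square_le_norm_l2)
  qed
  then show ?thesis by (rule LIMSEQ_le_const2) (use partial in blast)
qed

end

theorem proposition3p4:
  fixes a b c :: real
    and \<mu> :: "(complex^2^2) measure"
    and \<phi> :: "complex^2^2 \<Rightarrow> complex \<times> complex \<times> complex \<times> real"
  assumes "0 < a" and "a < b" and "b < c"
    and "normalized_left_invariant_volume \<mu>"
    and "\<And>\<zeta>\<^sub>1 \<zeta>\<^sub>2. (cmod \<zeta>\<^sub>1)\<^sup>2 + (cmod \<zeta>\<^sub>2)\<^sup>2 = 1 \<Longrightarrow>
      \<phi> (A_mat \<zeta>\<^sub>1 \<zeta>\<^sub>2) =
        (complex_of_real (sqrt (1 / c)) * \<zeta>\<^sub>1,
         complex_of_real (sqrt (1 / c)) * \<zeta>\<^sub>2,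
         complex_of_real (sqrt (1 / b - 1 / c)) * (\<zeta>\<^sub>1 * cnj \<zeta>\<^sub>2),
         sqrt (1 / b - 1 / c) / 2 * Re (\<zeta>\<^sub>1 * cnj \<zeta>\<^sub>1 - \<zeta>\<^sub>2 * cnj \<zeta>\<^sub>2))"
  shows "smooth_embedding SU2 \<phi> \<and>
    short_map SU2 (h_metric a b c) \<phi> \<and>
    by_first_eigenfunctions SU2 \<mu> (h_star 0 (1 / 3) 1) \<phi> \<and>
    (\<forall>X\<in>SU2. contraction SU2 (h_star 0 (1 / 3) 1)
       (\<lambda>X V W. h_metric a b c X V W - pullback_metric SU2 \<phi> X V W) X = 0) \<and>
    inflated_map SU2 \<mu> (h_metric a b c) (l2_of_R7 \<circ> \<phi>) \<and>
    solves_first_eigenvalue_maximization SU2 \<mu> (h_metric a b c) (h_star 0 (1 / 3) 1)"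
proof -
  interpret SU2_volume \<mu> by unfold_locales (rule assms(4))
  define k m where "k = sqrt (1 / c)" and "m = sqrt (1 / b - 1 / c)"
  have pos: "0 < a" "0 < b" "0 < c" using assms(1-3) by linarith+
  have ba: "1 / b < 1 / a" and cb: "1 / c < 1 / b"
    using pos assms(2,3) by (simp_all add: divide_strict_left_mono)
  have k2: "k\<^sup>2 = 1 / c" and m2: "m\<^sup>2 = 1 / b - 1 / c" and k0: "k \<noteq> 0"
    using pos cb by (simp_all add: k_def m_def)
  then have km: "k\<^sup>2 + m\<^sup>2 = 1 / b" by simp
  let ?h = "h_metric a b c" and ?g = "h_star 0 (1 / 3) 1" and ?\<psi> = "hopf_map k m"
  have \<phi>: "\<phi> X = ?\<psi> X" if X: "X \<in> SU2" for X
  proof -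
    obtain z w where "X = A_mat z w" "(cmod z)\<^sup>2 + (cmod w)\<^sup>2 = 1" using X by (rule SU2_cases)
    then show ?thesis using assms(5)[of z w] by (simp add: hopf_map_def k_def m_def)
  qed
  have d\<phi>: "differential SU2 \<phi> = differential SU2 ?\<psi>"
    by (rule differential_cong) (rule \<phi>)
  have gap: "?h X V W - pullback_metric SU2 \<phi> X V W = (1 / a - 1 / b) * (sigma X V $ 1 * sigma X W $ 1)"
    if "X \<in> SU2" "V \<in> tangent_space SU2 X" "W \<in> tangent_space SU2 X" for X V W
    using pullback_hopf_map[OF that, of k m] unfolding km unfolding k2
    by (simp add: pullback_metric_def d\<phi> h_metric_def algebra_simps del: sigma_nth)

  have C\<phi>: "C_map \<infinity> SU2 \<phi>"
    by (rule C_map_cong[THEN iffD2, OF \<phi> C_map_hopf_map])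
  have embedding: "smooth_embedding SU2 \<phi>"
    unfolding smooth_embedding_def
  proof (intro conjI)
    note \<psi> = smooth_embedding_hopf_map[OF k0, of m, unfolded smooth_embedding_def]
    show "C_map \<infinity> SU2 \<phi>" by (rule C\<phi>)
    show "\<forall>X\<in>SU2. inj_on (differential SU2 \<phi> X) (tangent_space SU2 X)" unfolding d\<phi> using \<psi> by blast
    have im: "\<phi> ` SU2 = ?\<psi> ` SU2" by (rule image_cong[OF refl]) (rule \<phi>)
    obtain g where g: "homeomorphism SU2 (?\<psi> ` SU2) ?\<psi> g" using \<psi> by blast
    have "homeomorphism SU2 (?\<psi> ` SU2) \<phi> g"
      by (rule homeomorphism_cong[OF g refl refl]) (simp_all add: \<phi>)
    then show "\<exists>g. homeomorphism SU2 (\<phi> ` SU2) \<phi> g" unfolding im by blast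
  qed

  have short: "short_map SU2 ?h \<phi>"
    unfolding short_map_def
  proof (intro ballI)
    fix X V assume "X \<in> SU2" "V \<in> tangent_space SU2 X"
    then have "?h X V V - pullback_metric SU2 \<phi> X V V = (1 / a - 1 / b) * (sigma X V $ 1)\<^sup>2"
      using gap[of X V V] by (simp add: power2_eq_square del: sigma_nth)
    moreover have "0 \<le> (1 / a - 1 / b) * (sigma X V $ 1)\<^sup>2" using ba by (simp del: sigma_nth)
    ultimately show "pullback_metric SU2 \<phi> X V V \<le> ?h X V V" by linarith
  qed

  have eigen: "by_first_eigenfunctions SU2 \<mu> ?g \<phi>"
    unfolding by_first_eigenfunctions_def
  proof
    fix i :: "complex \<times> complex \<times> complex \<times> real"
    let ?u = "\<lambda>X. inner (\<phi> X) i" and ?v = "\<lambda>X. inner (?\<psi> X) i"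
    have uv: "?u X = ?v X" if "X \<in> SU2" for X using \<phi>[OF that] by simp
    have "differential SU2 ?u = differential SU2 ?v" by (rule differential_cong) (rule uv)
    then have "BE_laplacian SU2 \<mu> ?g ?u = BE_laplacian SU2 \<mu> ?g ?v" unfolding BE_laplacian_def by simp
    moreover have "C_map \<infinity> SU2 ?u \<longleftrightarrow> C_map \<infinity> SU2 ?v" by (rule C_map_cong) (rule uv)
    ultimately show "first_eigenfunction SU2 \<mu> ?g ?u"
      using hopf_map_first_eigenfunction[of k m i] unfolding first_eigenfunction_def by (simp add: uv)
  qed

  have gM: "?g \<in> M_star SU2" by (rule h_star_in_M_star) simp_all
  then have gS: "?g \<in> S2T_sections SU2" by (simp add: M_star_def)
  have g_sigma: "?g X (\<lambda>V. sigma X V $ i) (\<lambda>V. sigma X V $ i) = (if i = 2 then 1 / 3 else if i = 3 then 1 else 0)"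
    if "X \<in> SU2" for X i
    using exhaust_3[of i] that by (auto simp: h_star_def sigma_E_field simp del: sigma_nth)

  have complementary: "contraction SU2 ?g (\<lambda>X V W. ?h X V W - pullback_metric SU2 \<phi> X V W) X = 0"
    if X: "X \<in> SU2" for X
  proof -
    let ?r = "\<lambda>i::3. if i = 1 then 1 / a - 1 / b else 0"
    have "contraction SU2 ?g (\<lambda>X V W. ?h X V W - pullback_metric SU2 \<phi> X V W) X
        = (\<Sum>i\<in>UNIV. ?r i * ?g X (\<lambda>V. sigma X V $ i) (\<lambda>V. sigma X V $ i))"
      by (rule contraction_diagonal[OF gS X]) (use ba gap[OF X] in \<open>simp_all add: sum_3 del: sigma_nth\<close>)
    then show ?thesis by (simp add: sum_3 g_sigma[OF X] del: sigma_nth)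
  qed

  have contr_h: "contraction SU2 g ?h X = 1 / a * g X (\<lambda>V. sigma X V $ 1) (\<lambda>V. sigma X V $ 1)
      + 1 / b * g X (\<lambda>V. sigma X V $ 2) (\<lambda>V. sigma X V $ 2) + 1 / c * g X (\<lambda>V. sigma X V $ 3) (\<lambda>V. sigma X V $ 3)"
    if g: "g \<in> S2T_sections SU2" and X: "X \<in> SU2" for g X
  proof -
    let ?r = "\<lambda>i::3. if i = 1 then 1 / a else if i = 2 then 1 / b else 1 / c"
    have "contraction SU2 g ?h X = (\<Sum>i\<in>UNIV. ?r i * g X (\<lambda>V. sigma X V $ i) (\<lambda>V. sigma X V $ i))"
      by (rule contraction_diagonal[OF g X]) (use pos in \<open>simp_all add: sum_3 h_metric_def del: sigma_nth\<close>)
    then show ?thesis by (simp add: sum_3 del: sigma_nth)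
  qed

  have inflated: "inflated_map SU2 \<mu> ?h (l2_of_R7 \<circ> \<phi>)"
  proof -
    have bl: "bounded_linear l2_of_R7"
      using linear_l2_of_R7 by (simp add: linear_conv_bounded_linear)
    have c\<phi>: "continuous_on SU2 \<phi>" by (rule C_map_imp_continuous_on[OF C\<phi>])
    have C: "C_map \<infinity> SU2 (\<lambda>X. l2_of_R7 (\<phi> X))" by (rule C_map_compose_linear[OF C\<phi> bl])
    have "differential SU2 (\<lambda>X. l2_of_R7 (\<phi> X)) X V = l2_of_R7 (differential SU2 \<phi> X V)"
      if "V \<in> tangent_space SU2 X" for X V
      by (rule differential_compose_linear[OF C\<phi> _ bl that]) (simp add: enat_ord_code)
    then have "pullback_metric SU2 (\<lambda>X. l2_of_R7 (\<phi> X)) X V V = pullback_metric SU2 \<phi> X V V"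
      if "V \<in> tangent_space SU2 X" for X V
      using that by (simp add: pullback_metric_def norm_l2_of_R7 flip: power2_norm_eq_inner)
    then have S: "short_map SU2 ?h (\<lambda>X. l2_of_R7 (\<phi> X))" using short by (simp add: short_map_def)
    have "inner (\<integral>X. \<phi> X \<partial>\<mu>) i = 0" for i
    proof -
      have "inner (\<integral>X. \<phi> X \<partial>\<mu>) i = (\<integral>X. inner (\<phi> X) i \<partial>\<mu>)"
        by (rule integral_inner_left[symmetric]) (rule integrable_continuous[OF c\<phi>])
      also have "\<dots> = (\<integral>X. inner (?\<psi> X) i \<partial>\<mu>)"
        by (rule Bochner_Integration.integral_cong[OF refl]) (simp add: \<phi>)
      finally show ?thesis by (simp add: hopf_map_mean)
    qed
    then have "(\<integral>X. \<phi> X \<partial>\<mu>) = 0" by (metis inner_eq_zero_iff)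
    then have A: "average \<mu> (\<lambda>X. l2_of_R7 (\<phi> X)) = 0"
      using integral_bounded_linear[OF bl integrable_continuous[OF c\<phi>]]
      by (simp add: average_eq linear_0[OF linear_l2_of_R7])
    have "(\<integral>X. (norm (l2_of_R7 (\<phi> X)))\<^sup>2 \<partial>\<mu>) = (\<integral>X. k\<^sup>2 + m\<^sup>2 / 4 \<partial>\<mu>)"
      by (rule Bochner_Integration.integral_cong[OF refl]) (simp add: \<phi> norm_l2_of_R7 norm_hopf_map)
    also have "\<dots> = 1 / (4 * b) + 3 / (4 * c)" by (simp add: k2 m2 field_simps)
    finally show ?thesis
      unfolding inflated_map_def o_def average_eq
      using C S A inflated_candidate_bound by (auto simp: inflated_candidates_def)
  qed

  have "solves_first_eigenvalue_maximization SU2 \<mu> ?h ?g"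
    unfolding solves_first_eigenvalue_maximization_def average_eq
  proof (intro conjI ballI impI)
    show "?g \<in> M_star SU2" by (rule gM)
    show "nonzero_section SU2 ?g"
      unfolding nonzero_section_def
      by (intro bexI[OF _ mat_1_in_SU2] bexI[OF _ sigma_in_cotangent_space[where X = "mat 1" and i = 3]])
        (simp add: g_sigma[OF mat_1_in_SU2] del: sigma_nth)
    fix g assume g: "g \<in> M_star SU2"
    then have g': "g \<in> S2T_sections SU2" by (simp add: M_star_def)
    define S where "S = (\<lambda>i X. g X (\<lambda>V. sigma X V $ i) (\<lambda>V. sigma X V $ i))"
    have i: "integrable \<mu> (S i)" for i
      unfolding S_def by (rule integrable_continuous[OF continuous_on_sigma_form[OF g']])
    have nn: "0 \<le> (\<integral>X. S i X \<partial>\<mu>)" for i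
    proof (rule integral_nonneg_AE, rule AE_I2)
      fix X assume "X \<in> space \<mu>"
      then show "0 \<le> S i X" using g sigma_in_cotangent_space unfolding S_def M_star_def by auto
    qed
    have "(\<integral>X. contraction SU2 g ?h X \<partial>\<mu>) = (\<integral>X. 1 / a * S 1 X + 1 / b * S 2 X + 1 / c * S 3 X \<partial>\<mu>)"
      unfolding S_def by (rule Bochner_Integration.integral_cong[OF refl]) (rule contr_h[OF g'], simp)
    also have "\<dots> = 1 / a * (\<integral>X. S 1 X \<partial>\<mu>) + 1 / b * (\<integral>X. S 2 X \<partial>\<mu>) + 1 / c * (\<integral>X. S 3 X \<partial>\<mu>)"
      using i by simp
    finally have A: "(\<integral>X. contraction SU2 g ?h X \<partial>\<mu>) =
      1 / a * (\<integral>X. S 1 X \<partial>\<mu>) + 1 / b * (\<integral>X. S 2 X \<partial>\<mu>) + 1 / c * (\<integral>X. S 3 X \<partial>\<mu>)" .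
    have A0: "0 \<le> (\<integral>X. contraction SU2 g ?h X \<partial>\<mu>)"
      unfolding A using nn pos by (intro add_nonneg_nonneg mult_nonneg_nonneg) auto
    have "lambda1 SU2 \<mu> g * (k\<^sup>2 + m\<^sup>2 / 4)
        \<le> 1 / b * ((\<integral>X. S 1 X \<partial>\<mu>) + (\<integral>X. S 2 X \<partial>\<mu>)) + 1 / c * (\<integral>X. S 3 X \<partial>\<mu>)"
      using lambda1_hopf_map_le[OF g, of k m] unfolding km unfolding k2 S_def .
    also have "\<dots> \<le> (\<integral>X. contraction SU2 g ?h X \<partial>\<mu>)"
      unfolding A using mult_right_mono[OF less_imp_le[OF ba] nn[of 1]] by (simp add: distrib_left)
    finally have le: "lambda1 SU2 \<mu> g * (k\<^sup>2 + m\<^sup>2 / 4) \<le> (\<integral>X. contraction SU2 g ?h X \<partial>\<mu>)" .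
    \<comment> \<open>This is the equality \<open>\<lambda>\<^sub>1(g) \<integral>\<parallel>\<phi>\<parallel>\<^sup>2 = (g, h)\<close> for \<open>g = h_star 0 (1/3) 1\<close>.\<close>
    have N: "k\<^sup>2 + m\<^sup>2 / 4 = 3 / 4 * (1 / (3 * b) + 1 / c)" by (simp add: k2 m2 field_simps)
    have K: "0 < 1 / (3 * b) + 1 / c" using pos by (simp add: add_pos_pos)
    have "(\<integral>X. contraction SU2 ?g ?h X \<partial>\<mu>) = (\<integral>X. 1 / (3 * b) + 1 / c \<partial>\<mu>)"
      by (rule Bochner_Integration.integral_cong[OF refl]) (simp add: contr_h[OF gS] g_sigma del: sigma_nth)
    then have B: "(\<integral>X. contraction SU2 ?g ?h X \<partial>\<mu>) = 1 / (3 * b) + 1 / c" by simp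
    show "lambda1 SU2 \<mu> g / (\<integral>X. contraction SU2 g ?h X \<partial>\<mu>)
        \<le> lambda1 SU2 \<mu> ?g / (\<integral>X. contraction SU2 ?g ?h X \<partial>\<mu>)"
    proof (cases "(\<integral>X. contraction SU2 g ?h X \<partial>\<mu>) = 0")
      case True
      \<comment> \<open>By \<open>x / 0 = 0\<close> the quotient on the left is zero.\<close>
      then show ?thesis using K by (simp add: B lambda1_h_star del: sigma_nth)
    next
      case False
      with A0 have "0 < (\<integral>X. contraction SU2 g ?h X \<partial>\<mu>)" by simp
      then show ?thesis
        using le K unfolding B lambda1_h_star N by (simp add: divide_le_eq field_simps)
    qed
  qed
  with embedding short eigen complementary inflated show ?thesis by (intro conjI ballI)
qed

end
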